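(* Consider the Lurye system $y_1=Gu_1$, $y_2=\phi u_2$, $u_1=r_1-y_2$, $u_2=y_1+r_2$, assumed well-posed, with $G:\mathcal{L}_{2e}\to\mathcal{L}_{2e}$ linear time-invariant, causal and stable, and $\phi:\mathcal{L}_{2e}\to\mathcal{L}_{2e}$ a (nonlinear) operator. Suppose that: (i) for $y=\phi u$, $y(t)=0$ whenever $u(t)=0$; the nonlinearity of $\phi$ is bounded below by $\underline{\alpha}$ and above by $\overline{\alpha}$, where $\underline{\alpha},\overline{\alpha}:\mathbb{R}\to\mathbb{R}$ are monotone and bounded, and $\underline\alpha(x)/x\ge 0$ for all $x\neq 0$; the nonlinearity is also bounded below by $\underline{\beta}$ and above by $\overline{\beta}$, where $\underline{\beta},\overline{\beta}:\mathbb{R}\to\mathbb{R}$ are monotone, bounded and odd, and $\underline\beta(x)/x\ge 0$ for all $x\neq 0$; (ii) $\underline\alpha,\overline\alpha,\underline\beta,\overline\beta$ are all slope-restricted on $[0,s]$, and $k>s$; there is a finite $A_k\ge1$ such that $\overline\alpha_k$ is bounded above by $A_k\underline\alpha_k$, and there is a (possibly infinite) $B_k\ge A_k$ such that $\overline\beta_k$ is bounded above by $B_k\underline\beta_k$, where for each $f\in\{\underline\alpha,\overline\alpha,\underline\beta,\overline\beta\}$ the function $f_k$ is the map from $x-f(x)/k$ to $f(x)$. Let $H_+$ and $H_-$ be (not necessarily causal) convolution operators whose impulse responses are respectively $h_+\in\mathbf{H_p}$ and $h_-\in\mathbf{H_p}$, satisfying $$A_k\|h_+\|_H+B_k\|h_-\|_H<1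 .$$ Let $M=1-H_++H_-$. Then for any $u\in\mathcal{L}_2$, $$\int_{-\infty}^{\infty}\big(M(u-\phi u/k)\big)(t)\,(\phi u)(t)\,dt\ge 0 ,$$ and the Lurye system is stable provided there exists $\varepsilon>0$ such that $$\mathrm{Re}\left[M(j\omega)(1+kG(j\omega))\right]\ge\varepsilon\quad\text{for all }\omega\in\mathbb{R}.$$
   Context: Signals are real-valued measurable functions of $t\in\mathbb{R}$. $\mathcal{L}_2$ is the space of square-integrable signals; $\mathcal{L}_{2e}$ is the extended space of signals all of whose truncations $x_T$ ($x_T(t)=x(t)$ for $t\le T$, $x_T(t)=0$ for $t>T$) lie in $\mathcal{L}_2$. Pointwise conditions on signals are understood for almost all $t$. The Lurye system is well-posed if for all $r_1,r_2\in\mathcal{L}_{2e}$ there are unique $u_1,u_2,y_1,y_2\in\mathcal{L}_{2e}$ satisfying its equations. It is stable if $r_1,r_2\in\mathcal{L}_2$ implies $u_1,u_2,y_1,y_2\in\mathcal{L}_2$. Stability of $G$ means that it maps $\mathcal{L}_2$ boundedly into $\mathcal{L}_2$; $G(j\omega)$ and $M(j\omega)$ denote frequency responses. A function $\alpha:\mathbb{R}\to\mathbb{R}$ is monotone if $\alpha(x_1)\ge\alpha(x_2)$ whenever $x_1\ge x_2$; bounded if there is $C\ge0$ with $|\alpha(x)|\le C|x|$ for all $x$; odd if $\alpha(-x)=-\alpha(x)$ for all $x$; slope-restricted on $[0,s]$ if $0\le(\alpha(x_1)-\alpha(x_2))/(x_1-x_2)\le s$ for all $x_1\ne x_2$. If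 $f$ is slope-restricted on $[0,s]$ and $k>s$, then $x\mapsto x-f(x)/k$ is a bijection of $\mathbb{R}$, so $f_k$ is a well-defined function $\mathbb{R}\to\mathbb{R}$. The nonlinearity of $\phi$ (the possibly multivalued relation between $u(t)$ and $y(t)=(\phi u)(t)$) is bounded below by $\underline\alpha$ and above by $\overline\alpha$ if, for all $u\in\mathcal{L}_{2e}$ and $y=\phi u$, $\frac{\underline\alpha(u(t))}{u(t)}\le\frac{y(t)}{u(t)}\le\frac{\overline\alpha(u(t))}{u(t)}$ for all $t$ with $u(t)\ne0$. The operator $\phi$ need not be memoryless or time-invariant. A function $f:\mathbb{R}\to\mathbb{R}$ is bounded above by $g:\mathbb{R}\to\mathbb{R}$ if $f(x)/x\le g(x)/x$ for all $x\ne0$. When $B_k=\infty$ the condition that $\overline\beta_k$ is bounded above by $B_k\underline\beta_k$ is void, and $B_k\|h_-\|_H$ is read as $0$ if $h_-=0$ and $\infty$ otherwise. $\mathbf{H}$ is the set of generalized functions $h(t)=\sum_i h_i\delta(t-t_i)+h_a(t)$ with $t_i\neq0$, $h_a(0)=0$, $h_i\in\mathbb{R}$, $h_a(t)\in\mathbb{R}$, and $\|h\|_H=\sum_i|h_i|+\int_{-\infty}^{\infty}|h_a(t)|\,dt<\infty$. $\mathbf{H_p}\subset\mathbf{H}$ is the subset with $h_i\ge0$ for all $i$ and $h_a(t)\ge0$ for all $t$. $M=1-H_++H_-$ has impulse response $\delta(t)-h_+(t)+h_-(t)$. *)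

theory Defs
  imports "HOL-Analysis.Analysis"
begin

section \<open>Signals\<close>

text \<open>
  Signals are Borel measurable functions on the real line, identified when they agree almost
  everywhere. Every Lebesgue measurable function agrees almost everywhere with a Borel one, so
  working with Borel representatives does not change the signal spaces.
\<close>

type_synonym signal = "real \<Rightarrow> real"

abbreviation ae_eq :: "signal \<Rightarrow> signal \<Rightarrow> bool" (infix "=ae" 50) where
  "x =ae y \<equiv> (AE t in lborel. x t = y t)"

definition L2 :: "signal set" where
  "L2 = {x \<in> borel_measurable borel. integrable lborel (\<lambda>t. (x t)\<^sup>2)}"

definition L2_nrm :: "signal \<Rightarrow> real" where
  "L2_nrm x = sqrt (LINT t|lborel. (x t)\<^sup>2)"

definition trunc :: "real \<Rightarrow> signal \<Rightarrow> signal" where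
  "trunc T x = (\<lambda>t. if t \<le> T then x t else 0)"

definition L2e :: "signal set" where
  "L2e = {x \<in> borel_measurable borel. \<forall>T. trunc T x \<in> L2}"

section \<open>Operators\<close>

text \<open>The second conjunct says that the operator is well defined on almost-everywhere classes.\<close>

definition L2e_operator :: "(signal \<Rightarrow> signal) \<Rightarrow> bool" where
  "L2e_operator F \<longleftrightarrow>
     (\<forall>u\<in>L2e. F u \<in> L2e) \<and> (\<forall>u\<in>L2e. \<forall>v\<in>L2e. u =ae v \<longrightarrow> F u =ae F v)"

definition linear_op :: "(signal \<Rightarrow> signal) \<Rightarrow> bool" where
  "linear_op F \<longleftrightarrow>
     (\<forall>u\<in>L2e. \<forall>v\<in>L2e. \<forall>a b. F (\<lambda>t. a * u t + b * v t) =ae (\<lambda>t. a * F u t + b * F v t))"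

definition time_invariant :: "(signal \<Rightarrow> signal) \<Rightarrow> bool" where
  "time_invariant F \<longleftrightarrow> (\<forall>u\<in>L2e. \<forall>\<tau>. F (\<lambda>t. u (t - \<tau>)) =ae (\<lambda>t. F u (t - \<tau>)))"

definition causal :: "(signal \<Rightarrow> signal) \<Rightarrow> bool" where
  "causal F \<longleftrightarrow> (\<forall>u\<in>L2e. \<forall>T. trunc T (F u) =ae trunc T (F (trunc T u)))"

definition stable_op :: "(signal \<Rightarrow> signal) \<Rightarrow> bool" where
  "stable_op F \<longleftrightarrow> (\<exists>C\<ge>0. \<forall>u\<in>L2. F u \<in> L2 \<and> L2_nrm (F u) \<le> C * L2_nrm u)"

section \<open>Frequency response\<close>

text \<open>
  \<open>L2_fourier u U\<close>: the function \<open>U\<close> of the angular frequency is the Fourier transform of the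
  square-integrable signal \<open>u\<close>, that is, the mean-square limit for \<open>T \<rightarrow> \<infinity>\<close> of the
  integrals of \<open>u(t) exp(-j\<omega>t)\<close> over \<open>[-T, T]\<close>. It determines \<open>U\<close> up to null sets.
\<close>

definition L2_fourier :: "signal \<Rightarrow> (real \<Rightarrow> complex) \<Rightarrow> bool" where
  "L2_fourier u U \<longleftrightarrow>
     U \<in> borel_measurable borel \<and> integrable lborel (\<lambda>\<omega>. (cmod (U \<omega>))\<^sup>2) \<and>
     ((\<lambda>T. \<integral>\<^sup>+\<omega>. ennreal ((cmod ((CLINT t:{-T..T}|lborel. of_real (u t) * cis (-(\<omega> * t))) - U \<omega>))\<^sup>2)
           \<partial>lborel) \<longlongrightarrow> 0) at_top"

text \<open>
  The frequency response of an operator that is only known to be bounded on \<open>L2\<close> is a function on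
  the imaginary axis determined up to null sets; the predicate says that \<open>Gf \<omega>\<close> is a version of
  \<open>G(j\<omega>)\<close>.
\<close>

definition frequency_response :: "(signal \<Rightarrow> signal) \<Rightarrow> (real \<Rightarrow> complex) \<Rightarrow> bool" where
  "frequency_response G Gf \<longleftrightarrow>
     Gf \<in> borel_measurable borel \<and>
     (\<forall>u\<in>L2. \<forall>U. L2_fourier u U \<longrightarrow> L2_fourier (G u) (\<lambda>\<omega>. Gf \<omega> * U \<omega>))"

section \<open>Generalized functions and convolution operators\<close>

text \<open>
  The record represents the generalized function with atoms \<open>weight i\<close> at \<open>node i\<close> and
  density \<open>dens\<close>; finitely many atoms are obtained by padding with zero weights. Nodes may
  coincide: for nonnegative weights this changes neither the generalized function nor its norm.
\<close>

record gen_fun =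
  weight :: "nat \<Rightarrow> real"
  node :: "nat \<Rightarrow> real"
  dens :: "real \<Rightarrow> real"

definition H_class :: "gen_fun set" where
  "H_class = {h. (\<forall>i. node h i \<noteq> 0) \<and> dens h 0 = 0 \<and>
                 summable (\<lambda>i. \<bar>weight h i\<bar>) \<and> integrable lborel (dens h) \<and>
                 dens h \<in> borel_measurable borel}"

definition Hp_class :: "gen_fun set" where
  "Hp_class = {h \<in> H_class. (\<forall>i. weight h i \<ge> 0) \<and> (\<forall>t. dens h t \<ge> 0)}"

definition H_nrm :: "gen_fun \<Rightarrow> real" where
  "H_nrm h = (\<Sum>i. \<bar>weight h i\<bar>) + (LINT t|lborel. \<bar>dens h t\<bar>)"

text \<open>For \<open>h \<in> H_class\<close> and \<open>u \<in> L2\<close> the series and the integral converge absolutely for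
  almost every \<open>t\<close>.\<close>

definition conv_op :: "gen_fun \<Rightarrow> signal \<Rightarrow> signal" where
  "conv_op h u = (\<lambda>t. (\<Sum>i. weight h i * u (t - node h i)) + (LINT \<tau>|lborel. dens h \<tau> * u (t - \<tau>)))"

definition conv_freq :: "gen_fun \<Rightarrow> real \<Rightarrow> complex" where
  "conv_freq h \<omega> = (\<Sum>i. of_real (weight h i) * cis (-(\<omega> * node h i)))
                 + (CLINT t|lborel. of_real (dens h t) * cis (-(\<omega> * t)))"

definition mult_op :: "gen_fun \<Rightarrow> gen_fun \<Rightarrow> signal \<Rightarrow> signal" where
  "mult_op hp hm u = (\<lambda>t. u t - conv_op hp u t + conv_op hm u t)"

definition mult_freq :: "gen_fun \<Rightarrow> gen_fun \<Rightarrow> real \<Rightarrow> complex" where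
  "mult_freq hp hm \<omega> = 1 - conv_freq hp \<omega> + conv_freq hm \<omega>"

section \<open>Nonlinearities\<close>

definition lin_bounded :: "(real \<Rightarrow> real) \<Rightarrow> bool" where
  "lin_bounded f \<longleftrightarrow> (\<exists>C\<ge>0. \<forall>x. \<bar>f x\<bar> \<le> C * \<bar>x\<bar>)"

definition odd_fun :: "(real \<Rightarrow> real) \<Rightarrow> bool" where
  "odd_fun f \<longleftrightarrow> (\<forall>x. f (- x) = - f x)"

definition slope_restricted :: "(real \<Rightarrow> real) \<Rightarrow> real \<Rightarrow> bool" where
  "slope_restricted f s \<longleftrightarrow>
     (\<forall>x1 x2. x1 \<noteq> x2 \<longrightarrow> 0 \<le> (f x1 - f x2) / (x1 - x2) \<and> (f x1 - f x2) / (x1 - x2) \<le> s)"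

definition bounded_above_by :: "(real \<Rightarrow> real) \<Rightarrow> (real \<Rightarrow> real) \<Rightarrow> bool" where
  "bounded_above_by f g \<longleftrightarrow> (\<forall>x. x \<noteq> 0 \<longrightarrow> f x / x \<le> g x / x)"

definition nonlinearity_between ::
    "(signal \<Rightarrow> signal) \<Rightarrow> (real \<Rightarrow> real) \<Rightarrow> (real \<Rightarrow> real) \<Rightarrow> bool" where
  "nonlinearity_between \<phi> lo up \<longleftrightarrow>
     (\<forall>u\<in>L2e. AE t in lborel. u t \<noteq> 0 \<longrightarrow>
        lo (u t) / u t \<le> \<phi> u t / u t \<and> \<phi> u t / u t \<le> up (u t) / u t)"

text \<open>The map \<open>f\<^sub>k\<close> from \<open>x - f(x)/k\<close> to \<open>f(x)\<close>, used only where \<open>x \<mapsto> x - f(x)/k\<close> is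
  bijective.\<close>

definition loop_shift :: "real \<Rightarrow> (real \<Rightarrow> real) \<Rightarrow> real \<Rightarrow> real" where
  "loop_shift k f = f \<circ> inv (\<lambda>x. x - f x / k)"

lemma bij_loop_shift_arg:
  assumes f: "slope_restricted f s" and "s < k"
  shows "bij (\<lambda>x. x - f x / k)"
proof -
  let ?g = "\<lambda>x. x - f x / k"
  have slope: "0 \<le> f x - f y \<and> f x - f y \<le> s * (x - y)" if "y < x" for x y
  proof -
    have "0 \<le> (f x - f y) / (x - y)" "(f x - f y) / (x - y) \<le> s"
      using f that by (auto simp: slope_restricted_def)
    then show ?thesis
      using that by (simp add: pos_divide_le_eq zero_le_divide_iff)
  qed
  have s0: "0 \<le> s" using slope[of 0 1] by simp
  then have k: "k > 0" using assms(2) by simp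
  have g: "?g x - ?g y \<ge> (1 - s / k) * (x - y)" if "y < x" for x y
  proof -
    have "(f x - f y) / k \<le> s * (x - y) / k"
      using slope[OF that] k by (intro divide_right_mono) auto
    then show ?thesis by (simp add: algebra_simps diff_divide_distrib)
  qed
  have c: "1 - s / k > 0" using k assms(2) by simp
  have mono: "?g y < ?g x" if "y < x" for x y
    using g[OF that] mult_pos_pos[OF c, of "x - y"] that by simp
  have inj: "inj ?g"
    by (rule injI) (metis mono less_irrefl linorder_neqE_linordered_idom)
  have "dist (f x) (f y) \<le> s * dist x y" for x y
    using slope[of x y] slope[of y x] by (cases x y rule: linorder_cases) (auto simp: dist_real_def)
  then have "s-lipschitz_on UNIV f" using s0 by (intro lipschitz_onI) auto
  then have cont: "continuous_on UNIV ?g"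
    using k by (intro continuous_intros lipschitz_on_continuous_on) auto
  have "\<exists>x. ?g x = z" for z
  proof -
    define d where "d = \<bar>z - ?g 0\<bar> / (1 - s / k) + 1"
    have d: "d > 0" using c by (simp add: d_def add_nonneg_pos)
    have e: "(1 - s / k) * d \<ge> \<bar>z - ?g 0\<bar>" 
      using c k assms(2) unfolding d_def distrib_left by auto
    have "?g (- d) \<le> z" "z \<le> ?g d"
    proof -
      have "(1 - s / k) * d \<le> ?g d - ?g 0" "(1 - s / k) * d \<le> ?g 0 - ?g (- d)"
        using g[of 0 d] g[of "- d" 0] d by simp_all
      with e show "?g (- d) \<le> z" "z \<le> ?g d" by linarith+
    qed
    then have "\<exists>x\<ge>-d. x \<le> d \<and> ?g x = z"
      using d by (intro IVT' continuous_on_subset[OF cont]) auto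
    then show ?thesis by blast
  qed
  then have "surj ?g" unfolding surj_def by metis
  with inj show ?thesis by (rule bijI)
qed

lemma loop_shift_apply:
  assumes "slope_restricted f s" "s < k"
  shows "loop_shift k f (x - f x / k) = f x"
  using inv_f_f[OF bij_is_inj[OF bij_loop_shift_arg[OF assms]], of x]
  by (simp add: loop_shift_def)

section \<open>The Lurye system\<close>

definition lurye_solution ::
    "(signal \<Rightarrow> signal) \<Rightarrow> (signal \<Rightarrow> signal) \<Rightarrow> signal \<Rightarrow> signal \<Rightarrow>
     signal \<Rightarrow> signal \<Rightarrow> signal \<Rightarrow> signal \<Rightarrow> bool" where
  "lurye_solution G \<phi> r1 r2 u1 u2 y1 y2 \<longleftrightarrow>
     u1 \<in> L2e \<and> u2 \<in> L2e \<and> y1 \<in> L2e \<and> y2 \<in> L2e \<and>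
     y1 =ae G u1 \<and> y2 =ae \<phi> u2 \<and> u1 =ae (\<lambda>t. r1 t - y2 t) \<and> u2 =ae (\<lambda>t. y1 t + r2 t)"

definition lurye_well_posed :: "(signal \<Rightarrow> signal) \<Rightarrow> (signal \<Rightarrow> signal) \<Rightarrow> bool" where
  "lurye_well_posed G \<phi> \<longleftrightarrow>
     (\<forall>r1\<in>L2e. \<forall>r2\<in>L2e.
        (\<exists>u1 u2 y1 y2. lurye_solution G \<phi> r1 r2 u1 u2 y1 y2) \<and>
        (\<forall>u1 u2 y1 y2 v1 v2 z1 z2.
           lurye_solution G \<phi> r1 r2 u1 u2 y1 y2 \<longrightarrow> lurye_solution G \<phi> r1 r2 v1 v2 z1 z2 \<longrightarrow>
           u1 =ae v1 \<and> u2 =ae v2 \<and> y1 =ae z1 \<and> y2 =ae z2))"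

definition lurye_stable :: "(signal \<Rightarrow> signal) \<Rightarrow> (signal \<Rightarrow> signal) \<Rightarrow> bool" where
  "lurye_stable G \<phi> \<longleftrightarrow>
     (\<forall>r1\<in>L2. \<forall>r2\<in>L2. \<forall>u1 u2 y1 y2.
        lurye_solution G \<phi> r1 r2 u1 u2 y1 y2 \<longrightarrow> u1 \<in> L2 \<and> u2 \<in> L2 \<and> y1 \<in> L2 \<and> y2 \<in> L2)"

end

theory Submission
  imports Defs "HOL-Probability.Probability"
begin

text \<open>
  A pair \<open>(u, y)\<close> satisfying the pointwise bounds gives \<open>w = u - y/k\<close> and \<open>y\<close> with \<open>y\<close> in the sector
  between \<open>p(w)\<close> and \<open>A p(w)\<close>, where \<open>p\<close> is the loop shift of the lower bound. The subgradient inequality for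
  the antiderivative of \<open>p\<close> yields \<open>\<integral>w(t - \<tau>) y(t) dt \<le> A \<integral>w y\<close>, and for odd \<open>p\<close> also the bound for
  \<open>- w(t - \<tau>)\<close>; integrating against \<open>h\<^sub>+\<close> and \<open>h\<^sub>-\<close> gives the positivity statement.

  For stability no factorization of \<open>M\<close> is needed. Since \<open>M\<close> differs from the identity by an operator of norm
  less than one, its compression to signals supported after \<open>T\<close> is invertible. Hence \<open>w\<close> and \<open>y\<close> can be
  altered after \<open>T\<close> to \<open>w'\<close> and \<open>z\<close> in \<open>L2\<close> such that \<open>M w'\<close> and \<open>M\<^sup>* z\<close> vanish after \<open>T\<close>, and \<open>w'\<close> has a partner
  \<open>y'\<close> in the sector with \<open>y' = y\<close> before \<open>T\<close>. With \<open>K = (1 + kG)/k\<close> and \<open>w = f - K y\<close>, causality gives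
  \<open>0 \<le> \<langle>M w', y'\<rangle> = \<langle>M w', z\<rangle> = \<langle>w', M\<^sup>* z\<rangle> = \<langle>f - K z, M\<^sup>* z\<rangle>\<close>, while the frequency condition and Parseval's
  identity give \<open>\<langle>K z, M\<^sup>* z\<rangle> \<ge> (\<epsilon>/k) \<parallel>z\<parallel>\<^sup>2\<close>. This bounds \<open>\<parallel>z\<parallel>\<close>, hence the truncation of \<open>y\<close>, uniformly in \<open>T\<close>.
\<close>

section \<open>Square-integrable signals\<close>

definition L2_ip :: "signal \<Rightarrow> signal \<Rightarrow> real" where
  "L2_ip x y = (LINT t|lborel. x t * y t)"

lemma L2_measurable [measurable_dest]: "x \<in> L2 \<Longrightarrow> x \<in> borel_measurable borel"
  by (simp add: L2_def)

lemma L2_square_integrable: "x \<in> L2 \<Longrightarrow> integrable lborel (\<lambda>t. (x t)\<^sup>2)"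
  by (simp add: L2_def)

lemma L2_nrm_eq_ip: "L2_nrm x = sqrt (L2_ip x x)"
  by (simp add: L2_nrm_def L2_ip_def power2_eq_square)

lemma L2_ip_self_nonneg: "0 \<le> L2_ip x x"
  by (simp add: L2_ip_def)

lemma L2_nrm_nonneg [simp]: "0 \<le> L2_nrm x"
  by (simp add: L2_nrm_eq_ip L2_ip_self_nonneg)

lemma L2_nrm_power2: "(L2_nrm x)\<^sup>2 = L2_ip x x"
  by (simp add: L2_nrm_eq_ip L2_ip_self_nonneg)

lemma L2_mult_integrable:
  assumes "x \<in> L2" "y \<in> L2"
  shows "integrable lborel (\<lambda>t. x t * y t)"
proof (rule Bochner_Integration.integrable_bound)
  show "integrable lborel (\<lambda>t. (x t)\<^sup>2 + (y t)\<^sup>2)"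
    using assms by (simp add: L2_def)
  have "\<bar>a * b\<bar> \<le> \<bar>a\<^sup>2 + b\<^sup>2\<bar>" for a b :: real
    using sum_squares_bound[of a b] sum_squares_bound[of a "- b"] zero_le_power2[of a] zero_le_power2[of b]
    by (auto simp: abs_if)
  then show "AE t in lborel. norm (x t * y t) \<le> norm ((x t)\<^sup>2 + (y t)\<^sup>2)"
    by simp
qed (use assms in measurable)

lemma L2_dominated:
  assumes x: "x \<in> L2" and y: "y \<in> borel_measurable borel"
    and le: "AE t in lborel. \<bar>y t\<bar> \<le> \<bar>x t\<bar>"
  shows "y \<in> L2" "L2_nrm y \<le> L2_nrm x"
proof -
  have le2: "AE t in lborel. (y t)\<^sup>2 \<le> (x t)\<^sup>2"
    using le by eventually_elim (simp add: abs_le_square_iff)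
  have "integrable lborel (\<lambda>t. (y t)\<^sup>2)"
    by (rule Bochner_Integration.integrable_bound[OF L2_square_integrable[OF x]])
      (use y le2 in auto)
  then show "y \<in> L2" using y by (simp add: L2_def)
  then show "L2_nrm y \<le> L2_nrm x"
    unfolding L2_nrm_def real_sqrt_le_iff
    by (intro integral_mono_AE le2 L2_square_integrable x)
qed

lemma L2_cong_AE:
  assumes "x \<in> L2" "y \<in> borel_measurable borel" "x =ae y"
  shows "y \<in> L2"
proof (rule L2_dominated(1)[OF assms(1,2)])
  show "AE t in lborel. \<bar>y t\<bar> \<le> \<bar>x t\<bar>" using assms(3) by eventually_elim simp
qed

lemma L2_cmult: "x \<in> L2 \<Longrightarrow> (\<lambda>t. c * x t) \<in> L2"
  by (auto simp: L2_def power_mult_distrib)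

lemma L2_add:
  assumes "x \<in> L2" "y \<in> L2" shows "(\<lambda>t. x t + y t) \<in> L2"
proof -
  have "integrable lborel (\<lambda>t. (x t)\<^sup>2 + (y t)\<^sup>2 + 2 * (x t * y t))"
    using L2_mult_integrable[OF assms] assms by (simp add: L2_def)
  then show ?thesis
    using assms by (auto simp: L2_def power2_sum mult.assoc)
qed

lemma L2_diff: "x \<in> L2 \<Longrightarrow> y \<in> L2 \<Longrightarrow> (\<lambda>t. x t - y t) \<in> L2"
  using L2_add[of x "\<lambda>t. (-1) * y t"] L2_cmult[of y "-1"] by simp

lemma L2_divide: "x \<in> L2 \<Longrightarrow> (\<lambda>t. x t / c) \<in> L2"
  using L2_cmult[of x "inverse c"] by (simp add: divide_inverse_commute)

lemma L2_ip_commute: "L2_ip x y = L2_ip y x"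
  by (simp add: L2_ip_def mult.commute)

lemma L2_ip_add_left:
  "x \<in> L2 \<Longrightarrow> y \<in> L2 \<Longrightarrow> z \<in> L2 \<Longrightarrow> L2_ip (\<lambda>t. x t + y t) z = L2_ip x z + L2_ip y z"
  unfolding L2_ip_def distrib_right by (intro Bochner_Integration.integral_add L2_mult_integrable)

lemma L2_ip_diff_left:
  "x \<in> L2 \<Longrightarrow> y \<in> L2 \<Longrightarrow> z \<in> L2 \<Longrightarrow> L2_ip (\<lambda>t. x t - y t) z = L2_ip x z - L2_ip y z"
  unfolding L2_ip_def left_diff_distrib by (intro Bochner_Integration.integral_diff L2_mult_integrable)

lemma L2_ip_add_right:
  "x \<in> L2 \<Longrightarrow> y \<in> L2 \<Longrightarrow> z \<in> L2 \<Longrightarrow> L2_ip z (\<lambda>t. x t + y t) = L2_ip z x + L2_ip z y"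
  using L2_ip_add_left[of x y z] by (simp add: L2_ip_commute)

lemma L2_ip_diff_right:
  "x \<in> L2 \<Longrightarrow> y \<in> L2 \<Longrightarrow> z \<in> L2 \<Longrightarrow> L2_ip z (\<lambda>t. x t - y t) = L2_ip z x - L2_ip z y"
  using L2_ip_diff_left[of x y z] by (simp add: L2_ip_commute)

lemma L2_ip_cmult_left: "L2_ip (\<lambda>t. c * x t) y = c * L2_ip x y"
  by (simp add: L2_ip_def mult.assoc)

lemma L2_ip_cmult_right: "L2_ip x (\<lambda>t. c * y t) = c * L2_ip x y"
  by (simp add: L2_ip_def mult.left_commute)

lemma L2_ip_cong_AE:
  assumes "x =ae x'" "y =ae y'" and [measurable]: "x \<in> borel_measurable borel" "x' \<in> borel_measurable borel"
    "y \<in> borel_measurable borel" "y' \<in> borel_measurable borel"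
  shows "L2_ip x y = L2_ip x' y'"
  unfolding L2_ip_def
proof (rule integral_cong_AE)
  show "AE t in lborel. x t * y t = x' t * y' t"
    using assms(1,2) by eventually_elim simp
qed measurable

lemma L2_nrm_cong_AE:
  "x =ae y \<Longrightarrow> x \<in> borel_measurable borel \<Longrightarrow> y \<in> borel_measurable borel \<Longrightarrow> L2_nrm x = L2_nrm y"
  unfolding L2_nrm_eq_ip by (subst L2_ip_cong_AE[of x y x y]) auto

text \<open>Cauchy-Schwarz, taken from its version for nonnegative integrals. The absolute value
  stays inside the integral because the Fubini argument in \<open>L2_ip_kconv\<close> needs a bound
  on the integral of the modulus.\<close>

lemma L2_ip_bound_abs:
  assumes "x \<in> L2" "y \<in> L2"
  shows "(LINT t|lborel. \<bar>x t * y t\<bar>) \<le> L2_nrm x * L2_nrm y"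
proof -
  note [measurable] = assms[THEN L2_measurable]
  let ?P = "LINT t|lborel. \<bar>x t * y t\<bar>"
  have sq: "(\<integral>\<^sup>+t. (ennreal \<bar>u t\<bar>)\<^sup>2 \<partial>lborel) = ennreal ((L2_nrm u)\<^sup>2)" if "u \<in> L2" for u
    using nn_integral_eq_integral[OF L2_square_integrable[OF that]]
    by (simp add: L2_nrm_def ennreal_power)
  have P: "(\<integral>\<^sup>+t. ennreal \<bar>x t\<bar> * ennreal \<bar>y t\<bar> \<partial>lborel) = ennreal ?P"
    using nn_integral_eq_integral[OF integrable_abs[OF L2_mult_integrable[OF assms]]]
    by (simp add: abs_mult ennreal_mult)
  have "(\<integral>\<^sup>+t. ennreal \<bar>x t\<bar> * ennreal \<bar>y t\<bar> \<partial>lborel)\<^sup>2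
      \<le> (\<integral>\<^sup>+t. (ennreal \<bar>x t\<bar>)\<^sup>2 \<partial>lborel) * (\<integral>\<^sup>+t. (ennreal \<bar>y t\<bar>)\<^sup>2 \<partial>lborel)"
    by (rule Cauchy_Schwarz_nn_integral) measurable
  then have "ennreal (?P\<^sup>2) \<le> ennreal ((L2_nrm x * L2_nrm y)\<^sup>2)"
    unfolding P sq[OF assms(1)] sq[OF assms(2)]
    by (simp add: ennreal_power ennreal_mult power_mult_distrib)
  then have "?P\<^sup>2 \<le> (L2_nrm x * L2_nrm y)\<^sup>2"
    by simp
  then show ?thesis by (rule power2_le_imp_le) simp
qed

lemma L2_ip_bound:
  assumes "x \<in> L2" "y \<in> L2" shows "\<bar>L2_ip x y\<bar> \<le> L2_nrm x * L2_nrm y"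
  using L2_ip_bound_abs[OF assms] integral_abs_bound[of lborel "\<lambda>t. x t * y t"]
  unfolding L2_ip_def by linarith

lemma L2_nrm_triangle:
  assumes "x \<in> L2" "y \<in> L2" shows "L2_nrm (\<lambda>t. x t + y t) \<le> L2_nrm x + L2_nrm y"
proof (rule power2_le_imp_le)
  have "(L2_nrm (\<lambda>t. x t + y t))\<^sup>2 = L2_ip x x + 2 * L2_ip x y + L2_ip y y"
    using assms by (simp add: L2_nrm_power2 L2_ip_add_left L2_ip_add_right L2_add L2_ip_commute)
  also have "\<dots> \<le> (L2_nrm x + L2_nrm y)\<^sup>2"
    using L2_ip_bound[OF assms] by (simp add: power2_sum L2_nrm_power2)
  finally show "(L2_nrm (\<lambda>t. x t + y t))\<^sup>2 \<le> (L2_nrm x + L2_nrm y)\<^sup>2" .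
qed simp

lemma L2_nrm_cmult: "L2_nrm (\<lambda>t. c * x t) = \<bar>c\<bar> * L2_nrm x"
  by (simp add: L2_nrm_eq_ip L2_ip_cmult_left L2_ip_cmult_right real_sqrt_mult flip: mult.assoc)

lemma L2_nrm_divide: "L2_nrm (\<lambda>t. x t / c) = L2_nrm x / \<bar>c\<bar>"
  using L2_nrm_cmult[of "inverse c" x] by (simp add: divide_inverse_commute)

lemma L2_nrm_triangle_diff:
  assumes "x \<in> L2" "y \<in> L2" shows "L2_nrm (\<lambda>t. x t - y t) \<le> L2_nrm x + L2_nrm y"
  using L2_nrm_triangle[OF assms(1) L2_cmult[OF assms(2), of "-1"]] L2_nrm_cmult[of "-1" y] by simp

section \<open>Truncation and translation on \<open>L2\<close>\<close>

lemma trunc_measurable [measurable]: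
  "x \<in> borel_measurable borel \<Longrightarrow> trunc T x \<in> borel_measurable borel"
  unfolding trunc_def by (rule measurable_If) auto

lemma L2_trunc:
  assumes "x \<in> L2" shows "trunc T x \<in> L2" "L2_nrm (trunc T x) \<le> L2_nrm x"
  using assms L2_dominated[of x "trunc T x"] by (auto simp: trunc_def)

lemma L2_imp_L2e: "x \<in> L2 \<Longrightarrow> x \<in> L2e"
  by (auto simp: L2e_def L2_trunc)

lemma L2e_measurable [measurable_dest]: "x \<in> L2e \<Longrightarrow> x \<in> borel_measurable borel"
  by (simp add: L2e_def)

lemma L2_shift:
  assumes "x \<in> L2" shows "(\<lambda>t. x (t - a)) \<in> L2" "L2_nrm (\<lambda>t. x (t - a)) = L2_nrm x"
proof -
  note [measurable] = L2_measurable[OF assms]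
  show "(\<lambda>t. x (t - a)) \<in> L2"
    using lborel_integrable_real_affine[OF L2_square_integrable[OF assms], of 1 "- a"]
    by (simp add: L2_def)
  show "L2_nrm (\<lambda>t. x (t - a)) = L2_nrm x"
    using lborel_integral_real_affine[of 1 "\<lambda>t. (x t)\<^sup>2" "- a"] by (simp add: L2_nrm_def)
qed

lemma L2_ip_shift: "L2_ip (\<lambda>t. x (t - a)) y = L2_ip x (\<lambda>t. y (t + a))"
  using lborel_integral_real_affine[of 1 "\<lambda>t. x (t - a) * y t" a] by (simp add: L2_ip_def add.commute)

text \<open>Monotone convergence along T = 0, 1, 2, and so on. Stability is read off in this way
  from an estimate that is uniform in the truncation time.\<close>

lemma L2_of_bounded_truncations:
  assumes "x \<in> L2e" and bound: "\<And>T. L2_nrm (trunc T x) \<le> C"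
  shows "x \<in> L2"
proof -
  note [measurable] = L2e_measurable[OF assms(1)]
  have fin: "(\<integral>\<^sup>+t. ennreal ((trunc (real n) x t)\<^sup>2) \<partial>lborel) \<le> ennreal (C\<^sup>2)" for n
  proof -
    have "trunc (real n) x \<in> L2" using assms(1) by (simp add: L2e_def)
    then have "(\<integral>\<^sup>+t. ennreal ((trunc (real n) x t)\<^sup>2) \<partial>lborel) = ennreal ((L2_nrm (trunc (real n) x))\<^sup>2)"
      by (simp add: nn_integral_eq_integral L2_square_integrable L2_nrm_def)
    also have "\<dots> \<le> ennreal (C\<^sup>2)"
      using bound by (intro ennreal_leI power_mono) auto
    finally show ?thesis .
  qed
  have sup: "(SUP n. ennreal ((trunc (real n) x t)\<^sup>2)) = ennreal ((x t)\<^sup>2)" for t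
  proof (rule antisym)
    obtain n :: nat where "t \<le> real n" using real_arch_simple by blast
    then show "ennreal ((x t)\<^sup>2) \<le> (SUP n. ennreal ((trunc (real n) x t)\<^sup>2))"
      by (intro SUP_upper2[of n]) (auto simp: trunc_def)
    show "(SUP n. ennreal ((trunc (real n) x t)\<^sup>2)) \<le> ennreal ((x t)\<^sup>2)"
      by (intro SUP_least) (auto simp: trunc_def)
  qed
  have "(\<integral>\<^sup>+t. ennreal ((x t)\<^sup>2) \<partial>lborel) = (SUP n. \<integral>\<^sup>+t. ennreal ((trunc (real n) x t)\<^sup>2) \<partial>lborel)"
    unfolding sup[symmetric]
    by (rule nn_integral_monotone_convergence_SUP)
      (auto simp: incseq_def le_fun_def trunc_def)
  also have "\<dots> \<le> ennreal (C\<^sup>2)"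
    by (intro SUP_least fin)
  also have "\<dots> < \<infinity>" by simp
  finally have "integrable lborel (\<lambda>t. (x t)\<^sup>2)"
    by (intro integrableI_bounded) auto
  then show ?thesis by (simp add: L2_def)
qed

section \<open>Integral operators generated by shifts\<close>

text \<open>The transform carries no normalising factor, hence the 2 pi in Plancherel's theorem. It
  is meant for integrable signals; for all others the Bochner integral is 0 by convention.\<close>

definition ft :: "signal \<Rightarrow> real \<Rightarrow> complex" where
  "ft u \<omega> = (CLINT t|lborel. of_real (u t) * cis (- (\<omega> * t)))"

lemma cis_measurable [measurable (raw)]:
  "f \<in> borel_measurable M \<Longrightarrow> (\<lambda>x. cis (f x)) \<in> borel_measurable M"
  unfolding cis_conv_exp by measurable

text \<open>Atoms and density of a generalized function are treated alike: \<open>\<nu>\<close> is the counting measure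
  for the atoms and the Lebesgue measure for the density.\<close>

definition kconv :: "'a measure \<Rightarrow> ('a \<Rightarrow> real) \<Rightarrow> ('a \<Rightarrow> real) \<Rightarrow> signal \<Rightarrow> signal" where
  "kconv \<nu> c F u = (\<lambda>t. LINT x|\<nu>. c x * u (t - F x))"

definition kfreq :: "'a measure \<Rightarrow> ('a \<Rightarrow> real) \<Rightarrow> ('a \<Rightarrow> real) \<Rightarrow> real \<Rightarrow> complex" where
  "kfreq \<nu> c F \<omega> = (CLINT x|\<nu>. of_real (c x) * cis (- (\<omega> * F x)))"

locale kernel = sigma_finite_measure \<nu> for \<nu> :: "'a measure" +
  fixes c F :: "'a \<Rightarrow> real"
  assumes c_integrable: "integrable \<nu> c" and F_measurable: "F \<in> borel_measurable \<nu>"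
begin

lemma c_measurable [measurable]: "c \<in> borel_measurable \<nu>"
  using c_integrable by (rule borel_measurable_integrable)

sublocale P: pair_sigma_finite \<nu> "lborel :: real measure" ..

definition mass :: real where "mass = (LINT x|\<nu>. \<bar>c x\<bar>)"

lemma mass_nonneg: "0 \<le> mass"
  by (simp add: mass_def)

lemma kconv_measurable [measurable]:
  assumes [measurable]: "u \<in> borel_measurable borel"
  shows "kconv \<nu> c F u \<in> borel_measurable borel"
proof -
  note [measurable] = F_measurable
  show ?thesis unfolding kconv_def by measurable
qed

lemma nn_mass: "(\<integral>\<^sup>+x. ennreal \<bar>c x\<bar> \<partial>\<nu>) = ennreal mass"
  using c_integrable by (simp add: mass_def nn_integral_eq_integral)

text \<open>Young's inequality for an integrable kernel acting on \<open>L2\<close>: split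
  \<open>\<bar>c x\<bar>\<close> into two square roots, apply Cauchy-Schwarz in \<open>x\<close>,
  then Tonelli and translation invariance in \<open>t\<close>. With nonnegative integrals,
  convergence does not have to be known beforehand.\<close>

lemma nn_kconv_bound:
  assumes u: "u \<in> L2"
  shows "(\<integral>\<^sup>+t. (\<integral>\<^sup>+x. ennreal (\<bar>c x\<bar> * \<bar>u (t - F x)\<bar>) \<partial>\<nu>)\<^sup>2 \<partial>lborel) \<le> ennreal ((mass * L2_nrm u)\<^sup>2)"
proof -
  note [measurable] = F_measurable L2_measurable[OF u]
  have "(\<integral>\<^sup>+x. ennreal (\<bar>c x\<bar> * \<bar>u (t - F x)\<bar>) \<partial>\<nu>)\<^sup>2
      \<le> ennreal mass * (\<integral>\<^sup>+x. ennreal (\<bar>c x\<bar> * (u (t - F x))\<^sup>2) \<partial>\<nu>)" for t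
  proof -
    have e1: "ennreal (\<bar>c x\<bar> * \<bar>u (t - F x)\<bar>) = ennreal (sqrt \<bar>c x\<bar>) * ennreal (sqrt \<bar>c x\<bar> * \<bar>u (t - F x)\<bar>)" for x
    proof -
      have "\<bar>c x\<bar> * \<bar>u (t - F x)\<bar> = sqrt \<bar>c x\<bar> * (sqrt \<bar>c x\<bar> * \<bar>u (t - F x)\<bar>)"
        using real_sqrt_mult_self[of "\<bar>c x\<bar>"] by (metis abs_abs mult.assoc)
      then show ?thesis by (subst ennreal_mult[symmetric]) simp_all
    qed
    have e2: "(ennreal (sqrt \<bar>c x\<bar> * \<bar>u (t - F x)\<bar>))\<^sup>2 = ennreal (\<bar>c x\<bar> * (u (t - F x))\<^sup>2)" for x
      by (subst ennreal_power) (simp_all add: power_mult_distrib)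
    have e3: "(ennreal (sqrt \<bar>c x\<bar>))\<^sup>2 = ennreal \<bar>c x\<bar>" for x
      by (subst ennreal_power) simp_all
    have "(\<integral>\<^sup>+x. ennreal (sqrt \<bar>c x\<bar>) * ennreal (sqrt \<bar>c x\<bar> * \<bar>u (t - F x)\<bar>) \<partial>\<nu>)\<^sup>2
      \<le> (\<integral>\<^sup>+x. (ennreal (sqrt \<bar>c x\<bar>))\<^sup>2 \<partial>\<nu>) * (\<integral>\<^sup>+x. (ennreal (sqrt \<bar>c x\<bar> * \<bar>u (t - F x)\<bar>))\<^sup>2 \<partial>\<nu>)"
      by (rule Cauchy_Schwarz_nn_integral) measurable
    then show ?thesis
      by (simp only: e1 e2 e3 nn_mass)
  qed
  then have "(\<integral>\<^sup>+t. (\<integral>\<^sup>+x. ennreal (\<bar>c x\<bar> * \<bar>u (t - F x)\<bar>) \<partial>\<nu>)\<^sup>2 \<partial>lborel)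
      \<le> (\<integral>\<^sup>+t. ennreal mass * (\<integral>\<^sup>+x. ennreal (\<bar>c x\<bar> * (u (t - F x))\<^sup>2) \<partial>\<nu>) \<partial>lborel)"
    by (intro nn_integral_mono)
  also have "\<dots> = ennreal mass * (\<integral>\<^sup>+t. (\<integral>\<^sup>+x. ennreal (\<bar>c x\<bar> * (u (t - F x))\<^sup>2) \<partial>\<nu>) \<partial>lborel)"
    by (rule nn_integral_cmult) measurable
  also have "(\<integral>\<^sup>+t. (\<integral>\<^sup>+x. ennreal (\<bar>c x\<bar> * (u (t - F x))\<^sup>2) \<partial>\<nu>) \<partial>lborel)
      = (\<integral>\<^sup>+x. (\<integral>\<^sup>+t. ennreal (\<bar>c x\<bar> * (u (t - F x))\<^sup>2) \<partial>lborel) \<partial>\<nu>)"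
    by (rule P.Fubini') measurable
  also have "\<dots> = (\<integral>\<^sup>+x. ennreal \<bar>c x\<bar> * ennreal ((L2_nrm u)\<^sup>2) \<partial>\<nu>)"
  proof (rule nn_integral_cong)
    fix x
    have "(\<integral>\<^sup>+t. ennreal (\<bar>c x\<bar> * (u (t - F x))\<^sup>2) \<partial>lborel) = ennreal \<bar>c x\<bar> * (\<integral>\<^sup>+t. ennreal ((u (t - F x))\<^sup>2) \<partial>lborel)"
      by (simp add: ennreal_mult nn_integral_cmult)
    also have "(\<integral>\<^sup>+t. ennreal ((u (t - F x))\<^sup>2) \<partial>lborel) = ennreal ((L2_nrm (\<lambda>t. u (t - F x)))\<^sup>2)"
      using L2_square_integrable[OF L2_shift(1)[OF u]] by (simp add: L2_nrm_def nn_integral_eq_integral)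
    finally show "(\<integral>\<^sup>+t. ennreal (\<bar>c x\<bar> * (u (t - F x))\<^sup>2) \<partial>lborel) = ennreal \<bar>c x\<bar> * ennreal ((L2_nrm u)\<^sup>2)"
      by (simp add: L2_shift(2)[OF u])
  qed
  also have "\<dots> = ennreal mass * ennreal ((L2_nrm u)\<^sup>2)"
    by (subst nn_integral_multc) (auto simp: nn_mass)
  finally show ?thesis
    by (simp add: mass_nonneg power_mult_distrib power2_eq_square[of mass] ennreal_mult mult.assoc)
qed

text \<open>By \<open>nn_kconv_bound\<close> the squared integral of the moduli has finite integral
  over \<open>t\<close>, so it is finite for almost every \<open>t\<close>.\<close>

lemma AE_kconv_integrable:
  assumes u: "u \<in> L2"
  shows "AE t in lborel. integrable \<nu> (\<lambda>x. c x * u (t - F x))"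
proof -
  note [measurable] = F_measurable L2_measurable[OF u]
  have "AE t in lborel. (\<integral>\<^sup>+x. ennreal (\<bar>c x\<bar> * \<bar>u (t - F x)\<bar>) \<partial>\<nu>)\<^sup>2 \<noteq> \<infinity>"
    by (rule nn_integral_PInf_AE) (use nn_kconv_bound[OF u] in \<open>auto simp: top_unique\<close>)
  then show ?thesis
  proof eventually_elim
    case (elim t)
    then have "(\<integral>\<^sup>+x. ennreal (\<bar>c x\<bar> * \<bar>u (t - F x)\<bar>) \<partial>\<nu>) < \<infinity>"
      by (auto simp: power2_eq_square ennreal_mult_eq_top_iff less_top)
    then show ?case
      by (intro integrableI_bounded) (auto simp: abs_mult)
  qed
qed

lemma kconv_L2:
  assumes u: "u \<in> L2"
  shows "kconv \<nu> c F u \<in> L2" "L2_nrm (kconv \<nu> c F u) \<le> mass * L2_nrm u"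
proof -
  note [measurable] = F_measurable L2_measurable[OF u]
  \<comment> \<open>Where the integral over \<open>x\<close> does not converge absolutely,
    \<open>kconv\<close> is 0 by default and the bound is trivial.\<close>
  have "ennreal ((kconv \<nu> c F u t)\<^sup>2) \<le> (\<integral>\<^sup>+x. ennreal (\<bar>c x\<bar> * \<bar>u (t - F x)\<bar>) \<partial>\<nu>)\<^sup>2" for t
  proof (cases "integrable \<nu> (\<lambda>x. c x * u (t - F x))")
    case True
    have "ennreal \<bar>kconv \<nu> c F u t\<bar> \<le> (\<integral>\<^sup>+x. ennreal (\<bar>c x\<bar> * \<bar>u (t - F x)\<bar>) \<partial>\<nu>)"
      using integral_norm_bound_ennreal[OF True] by (simp add: kconv_def abs_mult)
    then have "(ennreal \<bar>kconv \<nu> c F u t\<bar>)\<^sup>2 \<le> (\<integral>\<^sup>+x. ennreal (\<bar>c x\<bar> * \<bar>u (t - F x)\<bar>) \<partial>\<nu>)\<^sup>2"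
      by (rule power_mono) simp
    then show ?thesis by (simp add: ennreal_power)
  qed (simp add: kconv_def not_integrable_integral_eq)
  then have "(\<integral>\<^sup>+t. ennreal ((kconv \<nu> c F u t)\<^sup>2) \<partial>lborel)
     \<le> (\<integral>\<^sup>+t. (\<integral>\<^sup>+x. ennreal (\<bar>c x\<bar> * \<bar>u (t - F x)\<bar>) \<partial>\<nu>)\<^sup>2 \<partial>lborel)"
    by (intro nn_integral_mono)
  then have le: "(\<integral>\<^sup>+t. ennreal ((kconv \<nu> c F u t)\<^sup>2) \<partial>lborel) \<le> ennreal ((mass * L2_nrm u)\<^sup>2)"
    using nn_kconv_bound[OF u] by (rule order_trans)
  then have int: "integrable lborel (\<lambda>t. (kconv \<nu> c F u t)\<^sup>2)"
    by (intro integrableI_bounded) (auto simp: less_top[symmetric] top_unique)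
  then show "kconv \<nu> c F u \<in> L2" by (simp add: L2_def)
  have "ennreal ((L2_nrm (kconv \<nu> c F u))\<^sup>2) \<le> ennreal ((mass * L2_nrm u)\<^sup>2)"
    using le nn_integral_eq_integral[OF int] by (simp add: L2_nrm_def)
  then have "(L2_nrm (kconv \<nu> c F u))\<^sup>2 \<le> (mass * L2_nrm u)\<^sup>2" by simp
  then show "L2_nrm (kconv \<nu> c F u) \<le> mass * L2_nrm u"
    by (rule power2_le_imp_le) (simp add: mass_nonneg)
qed

text \<open>Fubini. Translation is isometric, so the inner integral of moduli is at most
  \<open>\<bar>c x\<bar>\<close> times the product of the two norms, which is integrable in
  \<open>x\<close>.\<close>

lemma L2_ip_kconv:
  assumes u: "u \<in> L2" and v: "v \<in> L2"
  shows "integrable \<nu> (\<lambda>x. c x * L2_ip (\<lambda>t. u (t - F x)) v)"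
    "L2_ip (kconv \<nu> c F u) v = (LINT x|\<nu>. c x * L2_ip (\<lambda>t. u (t - F x)) v)"
proof -
  note [measurable] = F_measurable L2_measurable[OF u] L2_measurable[OF v]
  let ?f = "\<lambda>x t. c x * (u (t - F x) * v t)"
  have "integrable (\<nu> \<Otimes>\<^sub>M lborel) (case_prod ?f)"
  proof (rule P.Fubini_integrable)
    have m: "(\<lambda>x. LINT t|lborel. norm (case (x, t) of (x, t) \<Rightarrow> ?f x t)) \<in> borel_measurable \<nu>"
      by measurable
    show "integrable \<nu> (\<lambda>x. LINT t|lborel. norm (case (x, t) of (x, t) \<Rightarrow> ?f x t))"
    proof (rule Bochner_Integration.integrable_bound[OF _ m])
      show "integrable \<nu> (\<lambda>x. c x * (L2_nrm u * L2_nrm v))"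
        using c_integrable by simp
      have "(LINT t|lborel. \<bar>u (t - F x) * v t\<bar>) \<le> L2_nrm u * L2_nrm v" for x
        using L2_ip_bound_abs[OF L2_shift(1)[OF u, of "F x"] v] by (simp add: L2_shift(2)[OF u])
      then show "AE x in \<nu>. norm (LINT t|lborel. norm (case (x, t) of (x, t) \<Rightarrow> ?f x t)) \<le> norm (c x * (L2_nrm u * L2_nrm v))"
        by (simp add: abs_mult integral_nonneg_AE mult_left_mono)
    qed
    show "AE x in \<nu>. integrable lborel (\<lambda>t. case (x, t) of (x, t) \<Rightarrow> ?f x t)"
      using L2_mult_integrable[OF L2_shift(1)[OF u] v] by simp
  qed measurable
  note fub = P.integrable_fst[OF this] P.Fubini_integral[OF this]
  show "integrable \<nu> (\<lambda>x. c x * L2_ip (\<lambda>t. u (t - F x)) v)"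
    using fub(1) by (simp add: L2_ip_def)
  have "L2_ip (kconv \<nu> c F u) v = (LINT t|lborel. LINT x|\<nu>. ?f x t)"
    by (simp add: L2_ip_def kconv_def mult.assoc flip: integral_mult_left_zero)
  then show "L2_ip (kconv \<nu> c F u) v = (LINT x|\<nu>. c x * L2_ip (\<lambda>t. u (t - F x)) v)"
    using fub(2) by (simp add: L2_ip_def)
qed

text \<open>The convolution theorem: after Fubini, substituting \<open>F x + t\<close> for
  \<open>t\<close> splits off the phase of the shift.\<close>

lemma kconv_ft:
  assumes u: "integrable lborel u"
  shows "integrable lborel (kconv \<nu> c F u)" "ft (kconv \<nu> c F u) \<omega> = kfreq \<nu> c F \<omega> * ft u \<omega>"
proof -
  note [measurable] = F_measurable
  have [measurable]: "u \<in> borel_measurable borel" using u by auto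
  have sh: "integrable lborel (\<lambda>t. u (t - a))" "(LINT t|lborel. \<bar>u (t - a)\<bar>) = (LINT t|lborel. \<bar>u t\<bar>)" for a
    using lborel_integrable_real_affine[OF u, of 1 "- a"]
      lborel_integral_real_affine[of 1 "\<lambda>t. \<bar>u t\<bar>" "- a"] by simp_all
  have int: "integrable (\<nu> \<Otimes>\<^sub>M lborel) (\<lambda>(x, t). c x * u (t - F x))"
  proof (rule P.Fubini_integrable)
    show "integrable \<nu> (\<lambda>x. LINT t|lborel. norm (case (x, t) of (x, t) \<Rightarrow> c x * u (t - F x)))"
      using c_integrable by (simp add: abs_mult sh)
  qed (use sh in auto)
  from P.integrable_snd[OF this] show "integrable lborel (kconv \<nu> c F u)"
    by (simp add: kconv_def)
  let ?g = "\<lambda>x t. of_real (c x * u (t - F x)) * cis (- (\<omega> * t))"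
  have "integrable (\<nu> \<Otimes>\<^sub>M lborel) (case_prod ?g)"
  proof (rule Bochner_Integration.integrable_bound[OF int])
    show "AE p in \<nu> \<Otimes>\<^sub>M lborel. norm (case_prod ?g p) \<le> norm (case p of (x, t) \<Rightarrow> c x * u (t - F x))"
      by (auto simp: norm_mult)
  qed measurable
  note eq = P.Fubini_integral[OF this]
  have "ft (kconv \<nu> c F u) \<omega> = (CLINT t|lborel. CLINT x|\<nu>. ?g x t)"
    by (simp add: ft_def kconv_def flip: integral_complex_of_real)
  also have "\<dots> = (CLINT x|\<nu>. CLINT t|lborel. ?g x t)"
    by (rule eq)
  also have "\<dots> = (CLINT x|\<nu>. of_real (c x) * cis (- (\<omega> * F x)) * ft u \<omega>)"
  proof (rule Bochner_Integration.integral_cong[OF refl])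
    fix x
    have "(CLINT t|lborel. ?g x t) = (CLINT t|lborel. ?g x (F x + t))"
      using lborel_integral_real_affine[of 1 "?g x" "F x"] by simp
    also have "\<dots> = (CLINT t|lborel. (of_real (c x) * cis (- (\<omega> * F x))) * (of_real (u t) * cis (- (\<omega> * t))))"
      by (intro Bochner_Integration.integral_cong) (simp_all add: distrib_left cis_mult)
    finally show "(CLINT t|lborel. ?g x t) = of_real (c x) * cis (- (\<omega> * F x)) * ft u \<omega>"
      by (simp add: ft_def)
  qed
  finally show "ft (kconv \<nu> c F u) \<omega> = kfreq \<nu> c F \<omega> * ft u \<omega>"
    by (simp add: kfreq_def)
qed

end

section \<open>Continuity of translation\<close>

lemma L2_abs: "x \<in> L2 \<Longrightarrow> (\<lambda>t. \<bar>x t\<bar>) \<in> L2"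
  by (rule L2_dominated(1)) auto

lemma L2_dominated_convergence:
  assumes X: "\<And>m. X m \<in> borel_measurable borel" and x: "x \<in> borel_measurable borel" and w: "w \<in> L2"
    and bound: "\<And>m. AE t in lborel. \<bar>X m t\<bar> \<le> w t" and lim: "AE t in lborel. (\<lambda>m. X m t) \<longlonglongrightarrow> x t"
  shows "x \<in> L2" "\<And>m. X m \<in> L2" "(\<lambda>m. L2_nrm (\<lambda>t. X m t - x t)) \<longlonglongrightarrow> 0"
proof -
  note [measurable] = X x L2_measurable[OF w]
  have all: "AE t in lborel. \<forall>m. \<bar>X m t\<bar> \<le> w t"
    using bound by (simp add: AE_all_countable)
  have xw: "AE t in lborel. \<bar>x t\<bar> \<le> w t"
    using all lim
  proof eventually_elim
    case (elim t)
    show ?case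
      by (rule LIMSEQ_le_const2[OF tendsto_rabs[OF elim(2)]]) (use elim(1) in auto)
  qed
  then show "x \<in> L2"
    by (intro L2_dominated(1)[OF w x]) (auto elim!: eventually_mono)
  show XL: "X m \<in> L2" for m
    using bound[of m] by (intro L2_dominated(1)[OF w X]) (auto elim!: eventually_mono)
  \<comment> \<open>Both \<open>X m\<close> and \<open>x\<close> are bounded by \<open>w\<close>, so
    the squared difference has the majorant \<open>4 * (w t)\<^sup>2\<close>.\<close>
  have "(\<lambda>m. LINT t|lborel. (X m t - x t)\<^sup>2) \<longlonglongrightarrow> integral\<^sup>L lborel (\<lambda>t::real. 0::real)"
  proof (rule integral_dominated_convergence)
    show "integrable lborel (\<lambda>t. 4 * (w t)\<^sup>2)"
      using L2_square_integrable[OF w] by simp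
    show "AE t in lborel. (\<lambda>m. (X m t - x t)\<^sup>2) \<longlonglongrightarrow> 0"
      using lim
    proof eventually_elim
      case (elim t)
      then have "(\<lambda>m. (X m t - x t)\<^sup>2) \<longlonglongrightarrow> (x t - x t)\<^sup>2"
        by (intro tendsto_intros)
      then show ?case by simp
    qed
    show "AE t in lborel. norm ((X m t - x t)\<^sup>2) \<le> 4 * (w t)\<^sup>2" for m
      using all xw
    proof eventually_elim
      case (elim t)
      then have "\<bar>X m t\<bar> \<le> w t" "\<bar>x t\<bar> \<le> w t" by auto
      then have "\<bar>X m t - x t\<bar> \<le> \<bar>2 * w t\<bar>" by linarith
      then have "(X m t - x t)\<^sup>2 \<le> (2 * w t)\<^sup>2" by (simp add: abs_le_square_iff)
      then show ?case by simp
    qed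
  qed measurable
  then show "(\<lambda>m. L2_nrm (\<lambda>t. X m t - x t)) \<longlonglongrightarrow> 0"
    unfolding L2_nrm_def using tendsto_real_sqrt by fastforce
qed

text \<open>Translations are isometries, so replacing \<open>x\<close> by \<open>X m\<close> costs
  the same error for every shift; an argument with thirds of \<open>e\<close> then exchanges the two
  limits.\<close>

lemma shift_continuity_closed:
  assumes X: "\<And>m. X m \<in> L2" and x: "x \<in> L2" and y: "y \<in> L2"
    and lim: "(\<lambda>m. L2_nrm (\<lambda>t. X m t - x t)) \<longlonglongrightarrow> 0"
    and X_cont: "\<And>m. (\<lambda>n. L2_ip (\<lambda>t. X m (t - a n)) y) \<longlonglongrightarrow> L2_ip (X m) y"
  shows "(\<lambda>n. L2_ip (\<lambda>t. x (t - a n)) y) \<longlonglongrightarrow> L2_ip x y"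
proof (rule metric_LIMSEQ_I)
  fix e :: real assume e: "e > 0"
  have close: "\<bar>L2_ip (\<lambda>t. X m (t - b)) y - L2_ip (\<lambda>t. x (t - b)) y\<bar> \<le> L2_nrm (\<lambda>t. X m t - x t) * L2_nrm y" for m b
  proof -
    have "L2_ip (\<lambda>t. X m (t - b)) y - L2_ip (\<lambda>t. x (t - b)) y = L2_ip (\<lambda>t. X m (t - b) - x (t - b)) y"
      by (simp add: L2_ip_diff_left L2_shift X x y)
    also have "\<bar>\<dots>\<bar> \<le> L2_nrm (\<lambda>t. X m (t - b) - x (t - b)) * L2_nrm y"
      using L2_diff[OF L2_shift(1)[OF X[of m], of b] L2_shift(1)[OF x, of b]] y by (rule L2_ip_bound)
    finally show ?thesis
      using L2_shift(2)[OF L2_diff[OF X[of m] x], of b] by simp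
  qed
  have "(\<lambda>m. L2_nrm (\<lambda>t. X m t - x t) * L2_nrm y) \<longlonglongrightarrow> 0 * L2_nrm y"
    by (intro tendsto_intros lim)
  then have "eventually (\<lambda>m. L2_nrm (\<lambda>t. X m t - x t) * L2_nrm y < e / 3) sequentially"
    using e by (intro order_tendstoD(2)) auto
  then obtain m where m: "L2_nrm (\<lambda>t. X m t - x t) * L2_nrm y < e / 3"
    by (auto simp: eventually_sequentially)
  obtain N where N: "\<And>n. n \<ge> N \<Longrightarrow> \<bar>L2_ip (\<lambda>t. X m (t - a n)) y - L2_ip (X m) y\<bar> < e / 3"
    using metric_LIMSEQ_D[OF X_cont[of m], of "e / 3"] e by (auto simp: dist_real_def)
  show "\<exists>N. \<forall>n\<ge>N. dist (L2_ip (\<lambda>t. x (t - a n)) y) (L2_ip x y) < e"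
  proof (intro exI allI impI)
    fix n assume "N \<le> n"
    have "\<bar>L2_ip (X m) y - L2_ip x y\<bar> \<le> L2_nrm (\<lambda>t. X m t - x t) * L2_nrm y"
      using close[of m 0] by simp
    with N[OF \<open>N \<le> n\<close>] close[of m "a n"] m
    show "dist (L2_ip (\<lambda>t. x (t - a n)) y) (L2_ip x y) < e"
      unfolding dist_real_def by linarith
  qed
qed

lemma L2_bounded_interval:
  assumes "f \<in> borel_measurable borel" "\<And>t. \<bar>f t\<bar> \<le> M" "\<And>t. R < \<bar>t\<bar> \<Longrightarrow> f t = 0"
  shows "f \<in> L2"
proof -
  have "integrable lborel (\<lambda>t. (f t)\<^sup>2)"
  proof (rule Bochner_Integration.integrable_bound)
    show "integrable lborel (\<lambda>t. indicator {- R..R} t * M\<^sup>2 :: real)"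
      by (intro integrable_mult_left integrable_real_indicator) (auto simp: emeasure_lborel_Icc_eq)
    have "(f t)\<^sup>2 \<le> indicator {- R..R} t * M\<^sup>2" for t
      using assms(2)[of t] assms(3)[of t] by (cases "R < \<bar>t\<bar>") (auto simp: abs_le_square_iff[symmetric] indicator_def)
    then show "AE t in lborel. norm ((f t)\<^sup>2) \<le> norm (indicator {- R..R} t * M\<^sup>2 :: real)"
      by simp
  qed (use assms(1) in measurable)
  then show ?thesis using assms(1) by (simp add: L2_def)
qed

text \<open>Cutting in time and clipping in amplitude brings every measurable function into
  \<open>L2\<close>, with a majorant that depends only on \<open>R\<close> and \<open>M\<close>, and
  it respects pointwise limits.\<close>

definition box_clip :: "real \<Rightarrow> real \<Rightarrow> signal \<Rightarrow> signal" where
  "box_clip R M f = (\<lambda>t. indicator {- R..R} t * max (- M) (min M (f t)))"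

lemma box_clip_bound: "M \<ge> 0 \<Longrightarrow> \<bar>box_clip R M f t\<bar> \<le> indicator {- R..R} t * M"
  by (auto simp: box_clip_def indicator_def)

lemma box_clip_measurable [measurable]:
  assumes [measurable]: "f \<in> borel_measurable borel"
  shows "box_clip R M f \<in> borel_measurable borel"
  unfolding box_clip_def by measurable

lemma box_clip_L2: "f \<in> borel_measurable borel \<Longrightarrow> M \<ge> 0 \<Longrightarrow> box_clip R M f \<in> L2"
  by (rule L2_bounded_interval[where M = M and R = R]) (auto simp: box_clip_def indicator_def)

text \<open>Clipping preserves continuity, so the shifted boxes converge pointwise except at the two
  jumps \<open>R\<close> and \<open>- R\<close>, and dominated convergence applies.\<close>

lemma shift_continuity_continuous:
  assumes f: "continuous_on UNIV f" and M: "M \<ge> 0" and y: "y \<in> L2" and a: "a \<longlonglongrightarrow> 0"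
  shows "(\<lambda>n. L2_ip (\<lambda>t. box_clip R M f (t - a n)) y) \<longlonglongrightarrow> L2_ip (box_clip R M f) y"
proof -
  have [measurable]: "f \<in> borel_measurable borel" using f by (rule borel_measurable_continuous_onI)
  note [measurable] = L2_measurable[OF y]
  obtain A where A: "\<And>n. \<bar>a n\<bar> \<le> A"
    using convergent_imp_Bseq[of a] a by (auto simp: convergent_def Bseq_def)
  \<comment> \<open>Every shifted box lies in the interval enlarged by the bound \<open>A\<close> on
    the shifts, which gives one majorant for all \<open>n\<close>.\<close>
  define w where "w = (\<lambda>t. indicator {- (R + A)..R + A} t * M :: real)"
  have w: "w \<in> L2"
    by (rule L2_bounded_interval[where M = M and R = "R + A"]) (use M in \<open>auto simp: w_def indicator_def\<close>)
  have lim: "(\<lambda>n. box_clip R M f (t - a n)) \<longlonglongrightarrow> box_clip R M f t" if "t \<noteq> R" "t \<noteq> - R" for t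
  proof -
    have ta: "(\<lambda>n. t - a n) \<longlonglongrightarrow> t" using tendsto_diff[OF tendsto_const a, of t] by simp
    have g: "(\<lambda>n. max (- M) (min M (f (t - a n)))) \<longlonglongrightarrow> max (- M) (min M (f t))"
      by (intro tendsto_max tendsto_min tendsto_const continuous_on_tendsto_compose[OF f ta]) auto
    have "isCont (indicator {- R..R} :: real \<Rightarrow> real) t"
      using that by (auto simp: isCont_indicator frontier_def)
    from isCont_tendsto_compose[OF this ta] g show ?thesis
      unfolding box_clip_def by (intro tendsto_mult)
  qed
  show ?thesis
    unfolding L2_ip_def
  proof (rule integral_dominated_convergence)
    show "integrable lborel (\<lambda>t. w t * \<bar>y t\<bar>)"
      using w L2_abs[OF y] by (rule L2_mult_integrable)
    have "AE t in lborel. t \<noteq> R \<and> t \<noteq> - R"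
      using AE_lborel_singleton[of R] AE_lborel_singleton[of "- R"] by auto
    then show "AE t in lborel. (\<lambda>n. box_clip R M f (t - a n) * y t) \<longlonglongrightarrow> box_clip R M f t * y t"
    proof eventually_elim
      case (elim t) then show ?case by (intro tendsto_intros lim) auto
    qed
    have "\<bar>box_clip R M f (t - a n)\<bar> \<le> w t" for n t
    proof (cases "- R \<le> t - a n \<and> t - a n \<le> R")
      case True
      then have "- (R + A) \<le> t" "t \<le> R + A" using A[of n] by linarith+
      then show ?thesis
        using box_clip_bound[OF M, of R f "t - a n"] True by (simp add: w_def)
    next
      case False
      then show ?thesis
        using box_clip_bound[OF M, of R f "t - a n"] M by (auto simp: w_def)
    qed
    then show "AE t in lborel. norm (box_clip R M f (t - a n) * y t) \<le> w t * \<bar>y t\<bar>" for n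
      by (auto simp: abs_mult mult_right_mono)
  qed measurable
qed

text \<open>Translation is continuous in the weak sense, which is the form Plancherel's theorem
  uses: only inner products of a signal with its shifts occur there. Continuous functions
  approximate the clipped signal, and clipped signals approximate \<open>x\<close>.\<close>

lemma shift_continuity:
  assumes x: "x \<in> L2" and y: "y \<in> L2" and a: "a \<longlonglongrightarrow> 0"
  shows "(\<lambda>n. L2_ip (\<lambda>t. x (t - a n)) y) \<longlonglongrightarrow> L2_ip x y"
proof -
  note [measurable] = L2_measurable[OF x]
  have bounded: "(\<lambda>n. L2_ip (\<lambda>t. box_clip R M x (t - a n)) y) \<longlonglongrightarrow> L2_ip (box_clip R M x) y" if M: "M \<ge> 0" for R M
  proof -
    \<comment> \<open>\<open>measurable_on\<close> supplies continuous functions converging to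
      \<open>x\<close> off a negligible set.\<close>
    have "x measurable_on UNIV"
      using L2_measurable[OF x]
      by (simp add: measurable_on_iff_borel_measurable lebesgue_on_UNIV_eq measurable_completion)
    then obtain N g where N: "negligible N" and g: "\<And>n. continuous_on UNIV (g n)"
      and lim: "\<And>t. t \<notin> N \<Longrightarrow> (\<lambda>n. g n t) \<longlonglongrightarrow> (if t \<in> UNIV then x t else 0)"
      unfolding measurable_on_def by blast
    have [measurable]: "g n \<in> borel_measurable borel" for n
      using g by (rule borel_measurable_continuous_onI)
    have "AE t in lebesgue. (\<lambda>n. g n t) \<longlonglongrightarrow> x t"
      using N lim by (auto simp: negligible_iff_null_sets eventually_ae_filter)
    then have ae: "AE t in lborel. (\<lambda>n. g n t) \<longlonglongrightarrow> x t"
      by (subst (asm) AE_completion_iff) auto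
    define w where "w = (\<lambda>t. indicator {- R..R} t * M :: real)"
    have w: "w \<in> L2"
      by (rule L2_bounded_interval[where M = M and R = R]) (use M in \<open>auto simp: w_def indicator_def\<close>)
    have "AE t in lborel. (\<lambda>n. box_clip R M (g n) t) \<longlonglongrightarrow> box_clip R M x t"
      using ae unfolding box_clip_def by eventually_elim (intro tendsto_intros tendsto_max tendsto_min)
    from L2_dominated_convergence(3)[OF _ _ w _ this]
    have "(\<lambda>n. L2_nrm (\<lambda>t. box_clip R M (g n) t - box_clip R M x t)) \<longlonglongrightarrow> 0"
      using box_clip_bound[OF M] by (auto simp: w_def)
    then show ?thesis
      by (rule shift_continuity_closed[rotated 3])
        (auto intro!: box_clip_L2 M y shift_continuity_continuous g a)
  qed
  have "(\<lambda>n. L2_nrm (\<lambda>t. box_clip (real n) (real n) x t - x t)) \<longlonglongrightarrow> 0"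
  proof (rule L2_dominated_convergence(3))
    show "(\<lambda>t. \<bar>x t\<bar>) \<in> L2" using x by (rule L2_abs)
    have "(\<lambda>n. box_clip (real n) (real n) x t) \<longlonglongrightarrow> x t" for t
    proof (rule tendsto_eventually)
      obtain N :: nat where N: "max \<bar>t\<bar> \<bar>x t\<bar> \<le> real N" using real_arch_simple by blast
      have "box_clip (real n) (real n) x t = x t" if "n \<ge> N" for n
        using N that by (auto simp: box_clip_def indicator_def abs_le_iff)
      then show "\<forall>\<^sub>F n in sequentially. box_clip (real n) (real n) x t = x t"
        by (auto simp: eventually_sequentially)
    qed
    then show "AE t in lborel. (\<lambda>n. box_clip (real n) (real n) x t) \<longlonglongrightarrow> x t" by simp
    show "AE t in lborel. \<bar>box_clip (real n) (real n) x t\<bar> \<le> \<bar>x t\<bar>" for n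
      by (auto simp: box_clip_def indicator_def)
  qed measurable
  then show ?thesis
    by (rule shift_continuity_closed[rotated 3]) (auto intro!: box_clip_L2 bounded x y)
qed

section \<open>Plancherel's theorem\<close>

lemma gauss_integrable:
  fixes \<sigma> :: real
  assumes "\<sigma> > 0"
  shows "integrable lborel (\<lambda>\<omega>. exp (- (\<sigma> * \<omega>)\<^sup>2 / 2))"
proof -
  have "integrable lborel (\<lambda>\<omega>. sqrt (2 * pi) * std_normal_density (0 + \<sigma> * \<omega>))"
    using assms by (intro integrable_mult_right lborel_integrable_real_affine) auto
  then show ?thesis by (simp add: std_normal_density_def)
qed

text \<open>The characteristic function of the standard normal distribution, rescaled by the
  substitution \<open>\<sigma> * \<omega>\<close>.\<close>

lemma gauss_ft:
  fixes \<sigma> :: real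
  assumes \<sigma>: "\<sigma> > 0"
  shows "(CLINT \<omega>|lborel. of_real (exp (- (\<sigma> * \<omega>)\<^sup>2 / 2)) * cis (- (\<omega> * \<tau>))) = of_real (2 * pi * normal_density 0 \<sigma> \<tau>)"
proof -
  let ?g = "\<lambda>x. std_normal_density x *\<^sub>R cis (- (\<tau> / \<sigma>) * x)"
  have "complex_of_real (exp (- (\<tau> / \<sigma>)\<^sup>2 / 2)) = char std_normal_distribution (- (\<tau> / \<sigma>))"
    by (simp add: char_std_normal_distribution)
  also have "\<dots> = (CLINT x|lborel. ?g x)"
    unfolding char_def by (subst integral_density) (simp_all add: cis_conv_exp)
  also have "\<dots> = \<sigma> *\<^sub>R (CLINT \<omega>|lborel. ?g (\<sigma> * \<omega>))"
    using lborel_integral_real_affine[of \<sigma> ?g 0] \<sigma> by simp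
  also have "(CLINT \<omega>|lborel. ?g (\<sigma> * \<omega>)) =
      (CLINT \<omega>|lborel. of_real (1 / sqrt (2 * pi)) * (of_real (exp (- (\<sigma> * \<omega>)\<^sup>2 / 2)) * cis (- (\<omega> * \<tau>))))"
    using \<sigma> by (intro Bochner_Integration.integral_cong) (simp_all add: std_normal_density_def scaleR_conv_of_real mult.commute)
  also have "\<dots> = of_real (1 / sqrt (2 * pi)) * (CLINT \<omega>|lborel. of_real (exp (- (\<sigma> * \<omega>)\<^sup>2 / 2)) * cis (- (\<omega> * \<tau>)))"
    by (rule integral_mult_right_zero)
  finally have eq: "complex_of_real (exp (- (\<tau> / \<sigma>)\<^sup>2 / 2)) = of_real (\<sigma> / sqrt (2 * pi)) *
      (CLINT \<omega>|lborel. of_real (exp (- (\<sigma> * \<omega>)\<^sup>2 / 2)) * cis (- (\<omega> * \<tau>)))" (is "_ = _ * ?I")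
    by (simp add: scaleR_conv_of_real)
  have "?I = of_real (sqrt (2 * pi) / \<sigma>) * (of_real (\<sigma> / sqrt (2 * pi)) * ?I)"
    using \<sigma> by simp
  also have "\<dots> = of_real (sqrt (2 * pi) / \<sigma>) * of_real (exp (- (\<tau> / \<sigma>)\<^sup>2 / 2))"
    unfolding eq[symmetric] ..
  also have "\<dots> = of_real (sqrt (2 * pi) / \<sigma> * exp (- (\<tau> / \<sigma>)\<^sup>2 / 2))"
    by simp
  also have "sqrt (2 * pi) / \<sigma> * exp (- (\<tau> / \<sigma>)\<^sup>2 / 2) = 2 * pi * normal_density 0 \<sigma> \<tau>"
    using \<sigma> real_sqrt_mult_self[of "2 * pi"]
    by (simp add: normal_density_def real_sqrt_mult power_divide field_simps)
  finally show ?thesis .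
qed

lemma cnj_measurable [measurable (raw)]:
  "f \<in> borel_measurable M \<Longrightarrow> (\<lambda>x. cnj (f x)) \<in> borel_measurable M"
  by (rule measurable_compose[OF _ borel_measurable_continuous_onI[OF continuous_on_cnj[OF continuous_on_id]]])

lemma ft_measurable [measurable]:
  assumes [measurable]: "x \<in> borel_measurable borel"
  shows "ft x \<in> borel_measurable borel"
  unfolding ft_def by measurable

lemma ft_integrable:
  assumes "integrable lborel x"
  shows "integrable lborel (\<lambda>t. of_real (x t) * cis (- (\<omega> * t)))"
proof (rule Bochner_Integration.integrable_bound[OF assms])
  have [measurable]: "x \<in> borel_measurable borel" using assms by auto
  show "(\<lambda>t. of_real (x t) * cis (- (\<omega> * t))) \<in> borel_measurable lborel" by measurable
qed (simp add: norm_mult)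

lemma cmod_ft_le:
  assumes "integrable lborel x"
  shows "cmod (ft x \<omega>) \<le> (LINT t|lborel. \<bar>x t\<bar>)"
  using integral_norm_bound[of lborel "\<lambda>t. of_real (x t) * cis (- (\<omega> * t))"]
  by (simp add: ft_def norm_mult)

text \<open>Fubini moves the Fourier transform from one factor to the other.\<close>

lemma ft_multiplication_formula:
  fixes q :: "real \<Rightarrow> complex"
  assumes x: "integrable lborel x" and q: "integrable lborel q"
  shows "(CLINT \<omega>|lborel. ft x \<omega> * q \<omega>) = (CLINT t|lborel. of_real (x t) * (CLINT \<omega>|lborel. q \<omega> * cis (- (\<omega> * t))))"
proof -
  have [measurable]: "x \<in> borel_measurable borel" "q \<in> borel_measurable borel" using x q by auto
  let ?f = "\<lambda>t \<omega>. of_real (x t) * (q \<omega> * cis (- (\<omega> * t)))"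
  have "integrable (lborel \<Otimes>\<^sub>M lborel) (case_prod ?f)"
  proof (rule lborel_pair.Fubini_integrable)
    show "integrable lborel (\<lambda>t. LINT \<omega>|lborel. norm (case (t, \<omega>) of (t, \<omega>) \<Rightarrow> ?f t \<omega>))"
      using x by (simp add: norm_mult)
    have "integrable lborel (\<lambda>\<omega>. q \<omega> * cis (- (\<omega> * t)))" for t
      by (rule Bochner_Integration.integrable_bound[OF q]) (auto simp: norm_mult)
    then show "AE t in lborel. integrable lborel (\<lambda>\<omega>. case (t, \<omega>) of (t, \<omega>) \<Rightarrow> ?f t \<omega>)"
      by simp
  qed measurable
  from lborel_pair.Fubini_integral[OF this]
  have "(CLINT \<omega>|lborel. CLINT t|lborel. ?f t \<omega>) = (CLINT t|lborel. CLINT \<omega>|lborel. ?f t \<omega>)" .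
  moreover have "(CLINT t|lborel. ?f t \<omega>) = ft x \<omega> * q \<omega>" for \<omega>
  proof -
    have "(CLINT t|lborel. ?f t \<omega>) = (CLINT t|lborel. of_real (x t) * cis (- (\<omega> * t)) * q \<omega>)"
      by (intro Bochner_Integration.integral_cong) (simp_all add: mult_ac)
    then show ?thesis by (simp add: ft_def)
  qed
  ultimately show ?thesis by simp
qed

lemma kernel_normal: "kernel lborel (normal_density 0 \<sigma>) (\<lambda>\<tau>. \<tau>)" if "\<sigma> > 0" for \<sigma> :: real
  by unfold_locales (use that in auto)

text \<open>Plancherel's identity with a Gaussian damping of the spectrum, which makes every
  integral absolutely convergent. In the time domain the damping is convolution with a normal
  density of width \<open>\<sigma>\<close>.\<close>

lemma plancherel_gauss:
  fixes \<sigma> :: real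
  assumes x: "x \<in> L2" "integrable lborel x" and \<sigma>: "\<sigma> > 0"
  shows "(LINT \<omega>|lborel. (cmod (ft x \<omega>))\<^sup>2 * exp (- (\<sigma> * \<omega>)\<^sup>2 / 2))
    = 2 * pi * (LINT \<tau>|lborel. std_normal_density \<tau> * L2_ip (\<lambda>t. x (t - \<sigma> * \<tau>)) x)"
proof -
  note [measurable] = L2_measurable[OF x(1)]
  define \<gamma> where "\<gamma> = (\<lambda>\<omega>. exp (- (\<sigma> * \<omega>)\<^sup>2 / 2))"
  have \<gamma>: "integrable lborel \<gamma>" and [measurable]: "\<gamma> \<in> borel_measurable borel"
    using gauss_integrable[OF \<sigma>] by (auto simp: \<gamma>_def)
  interpret N: kernel lborel "normal_density 0 \<sigma>" "\<lambda>\<tau>. \<tau>" by (rule kernel_normal[OF \<sigma>])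
  define K where "K = kconv lborel (normal_density 0 \<sigma>) (\<lambda>\<tau>. \<tau>) x"
  have K: "K \<in> L2" unfolding K_def by (rule N.kconv_L2[OF x(1)])
  \<comment> \<open>Conjugating the integral brings in \<open>ft x\<close> itself, so that the
    multiplication formula applies; what comes out is the mollified signal \<open>K\<close>.\<close>
  have inner: "(CLINT \<omega>|lborel. (cnj (ft x \<omega>) * of_real (\<gamma> \<omega>)) * cis (- (\<omega> * t))) = of_real (2 * pi * K t)" for t
  proof -
    have "cnj (CLINT \<omega>|lborel. (cnj (ft x \<omega>) * of_real (\<gamma> \<omega>)) * cis (- (\<omega> * t)))
        = (CLINT \<omega>|lborel. ft x \<omega> * (of_real (\<gamma> \<omega>) * cis (\<omega> * t)))"
      by (simp add: cis_cnj mult.assoc flip: Bochner_Integration.integral_cnj)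
    also have "\<dots> = (CLINT s|lborel. of_real (x s) * (CLINT \<omega>|lborel. (of_real (\<gamma> \<omega>) * cis (\<omega> * t)) * cis (- (\<omega> * s))))"
    proof (rule ft_multiplication_formula[OF x(2)])
      show "integrable lborel (\<lambda>\<omega>. of_real (\<gamma> \<omega>) * cis (\<omega> * t))"
        by (rule Bochner_Integration.integrable_bound[OF \<gamma>]) (auto simp: norm_mult)
    qed
    also have "\<dots> = (CLINT s|lborel. of_real (2 * pi * (normal_density 0 \<sigma> (s - t) * x s)))"
    proof (rule Bochner_Integration.integral_cong[OF refl])
      fix s
      have "(CLINT \<omega>|lborel. (of_real (\<gamma> \<omega>) * cis (\<omega> * t)) * cis (- (\<omega> * s)))
          = (CLINT \<omega>|lborel. of_real (\<gamma> \<omega>) * cis (- (\<omega> * (s - t))))"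
        by (intro Bochner_Integration.integral_cong) (simp_all add: mult.assoc cis_mult right_diff_distrib)
      also have "\<dots> = of_real (2 * pi * normal_density 0 \<sigma> (s - t))"
        unfolding \<gamma>_def by (rule gauss_ft[OF \<sigma>])
      finally have eq: "(CLINT \<omega>|lborel. (of_real (\<gamma> \<omega>) * cis (\<omega> * t)) * cis (- (\<omega> * s))) = \<dots>" .
      show "of_real (x s) * (CLINT \<omega>|lborel. (of_real (\<gamma> \<omega>) * cis (\<omega> * t)) * cis (- (\<omega> * s)))
          = of_real (2 * pi * (normal_density 0 \<sigma> (s - t) * x s))"
        unfolding eq by (simp add: mult_ac)
    qed
    also have "\<dots> = of_real (2 * pi * (LINT s|lborel. normal_density 0 \<sigma> (s - t) * x s))"
      unfolding integral_complex_of_real by simp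
    also have "(LINT s|lborel. normal_density 0 \<sigma> (s - t) * x s) = K t"
      using lborel_integral_real_affine[of "-1" "\<lambda>s. normal_density 0 \<sigma> (s - t) * x s" t]
      by (simp add: K_def kconv_def normal_density_def)
    finally have "cnj (cnj (CLINT \<omega>|lborel. (cnj (ft x \<omega>) * of_real (\<gamma> \<omega>)) * cis (- (\<omega> * t)))) = cnj (of_real (2 * pi * K t))"
      by (rule arg_cong)
    then show ?thesis
      unfolding complex_cnj_cnj complex_cnj_complex_of_real .
  qed
  have q: "integrable lborel (\<lambda>\<omega>. cnj (ft x \<omega>) * of_real (\<gamma> \<omega>))"
  proof (rule Bochner_Integration.integrable_bound)
    show "integrable lborel (\<lambda>\<omega>. (LINT t|lborel. \<bar>x t\<bar>) * \<gamma> \<omega>)" using \<gamma> by simp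
    show "AE \<omega> in lborel. norm (cnj (ft x \<omega>) * of_real (\<gamma> \<omega>)) \<le> norm ((LINT t|lborel. \<bar>x t\<bar>) * \<gamma> \<omega>)"
      using cmod_ft_le[OF x(2)] by (auto simp: norm_mult abs_mult intro!: mult_right_mono)
  qed measurable
  have "complex_of_real (LINT \<omega>|lborel. (cmod (ft x \<omega>))\<^sup>2 * \<gamma> \<omega>)
      = (CLINT \<omega>|lborel. ft x \<omega> * (cnj (ft x \<omega>) * of_real (\<gamma> \<omega>)))"
    unfolding integral_complex_of_real[symmetric]
    by (intro Bochner_Integration.integral_cong refl) (simp only: of_real_mult complex_norm_square mult.assoc)
  also have "\<dots> = (CLINT t|lborel. of_real (x t) * of_real (2 * pi * K t))"
    unfolding ft_multiplication_formula[OF x(2) q] inner ..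
  also have "\<dots> = of_real (2 * pi * L2_ip K x)"
    unfolding L2_ip_def
    by (simp add: mult_ac flip: integral_complex_of_real of_real_mult integral_mult_right_zero)
  finally have "(LINT \<omega>|lborel. (cmod (ft x \<omega>))\<^sup>2 * \<gamma> \<omega>) = 2 * pi * L2_ip K x"
    unfolding of_real_eq_iff .
  also have "L2_ip K x = (LINT \<tau>|lborel. normal_density 0 \<sigma> \<tau> * L2_ip (\<lambda>t. x (t - \<tau>)) x)"
    unfolding K_def by (rule N.L2_ip_kconv(2)[OF x(1) x(1)])
  \<comment> \<open>Rescaling \<open>\<tau>\<close> puts all dependence on \<open>\<sigma>\<close>
    into the shift, ready for the limit \<open>\<sigma>\<close> to 0.\<close>
  also have "\<dots> = (LINT \<tau>|lborel. \<sigma> * (normal_density 0 \<sigma> (\<sigma> * \<tau>) * L2_ip (\<lambda>t. x (t - \<sigma> * \<tau>)) x))"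
    using lborel_integral_real_affine[of \<sigma> "\<lambda>\<tau>. normal_density 0 \<sigma> \<tau> * L2_ip (\<lambda>t. x (t - \<tau>)) x" 0] \<sigma> by simp
  also have "\<dots> = (LINT \<tau>|lborel. std_normal_density \<tau> * L2_ip (\<lambda>t. x (t - \<sigma> * \<tau>)) x)"
    using \<sigma> by (simp add: normal_density_def real_sqrt_mult power_mult_distrib)
  finally show ?thesis by (simp add: \<gamma>_def)
qed

text \<open>The width of the Gaussian shrinks to 0. In the time domain the limit follows from
  dominated convergence and continuity of translation; in the frequency domain monotone convergence
  yields both integrability and the value.\<close>

lemma plancherel:
  assumes x: "x \<in> L2" "integrable lborel x"
  shows "integrable lborel (\<lambda>\<omega>. (cmod (ft x \<omega>))\<^sup>2)" "(LINT \<omega>|lborel. (cmod (ft x \<omega>))\<^sup>2) = 2 * pi * L2_ip x x"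
proof -
  note [measurable] = L2_measurable[OF x(1)]
  let ?\<sigma> = "\<lambda>n. 1 / real (Suc n)"
  let ?f = "\<lambda>n \<omega>. (cmod (ft x \<omega>))\<^sup>2 * exp (- (?\<sigma> n * \<omega>)\<^sup>2 / 2)"
  have \<sigma>: "?\<sigma> \<longlonglongrightarrow> 0" by (rule LIMSEQ_Suc) (rule lim_1_over_n)
  have lim: "(\<lambda>n. integral\<^sup>L lborel (?f n)) \<longlonglongrightarrow> 2 * pi * L2_ip x x"
  proof -
    have "(\<lambda>n. LINT \<tau>|lborel. std_normal_density \<tau> * L2_ip (\<lambda>t. x (t - ?\<sigma> n * \<tau>)) x)
        \<longlonglongrightarrow> (LINT \<tau>|lborel. std_normal_density \<tau> * L2_ip x x)"
    proof (rule integral_dominated_convergence)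
      show "integrable lborel (\<lambda>\<tau>. std_normal_density \<tau> * (L2_nrm x * L2_nrm x))"
        by (intro integrable_mult_left) simp
      have "(\<lambda>n. L2_ip (\<lambda>t. x (t - ?\<sigma> n * \<tau>)) x) \<longlonglongrightarrow> L2_ip x x" for \<tau>
        by (rule shift_continuity[OF x(1) x(1)]) (use tendsto_mult[OF \<sigma> tendsto_const, of \<tau>] in simp)
      then show "AE \<tau> in lborel. (\<lambda>n. std_normal_density \<tau> * L2_ip (\<lambda>t. x (t - ?\<sigma> n * \<tau>)) x) \<longlonglongrightarrow> std_normal_density \<tau> * L2_ip x x"
        by (intro AE_I2 tendsto_intros)
      have "\<bar>L2_ip (\<lambda>t. x (t - a)) x\<bar> \<le> L2_nrm x * L2_nrm x" for a
        using L2_ip_bound[OF L2_shift(1)[OF x(1)] x(1), of a] L2_shift(2)[OF x(1), of a] by simp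
      then show "AE \<tau> in lborel. norm (std_normal_density \<tau> * L2_ip (\<lambda>t. x (t - ?\<sigma> n * \<tau>)) x) \<le> std_normal_density \<tau> * (L2_nrm x * L2_nrm x)" for n
        by (intro AE_I2) (simp add: abs_mult mult_left_mono)
      show "(\<lambda>\<tau>. std_normal_density \<tau> * L2_ip (\<lambda>t. x (t - ?\<sigma> n * \<tau>)) x) \<in> borel_measurable lborel" for n
        unfolding L2_ip_def by measurable
    qed measurable
    then have "(\<lambda>n. LINT \<tau>|lborel. std_normal_density \<tau> * L2_ip (\<lambda>t. x (t - ?\<sigma> n * \<tau>)) x) \<longlonglongrightarrow> L2_ip x x"
      by simp
    from tendsto_mult[OF tendsto_const[of "2 * pi"] this] show ?thesis
      by (subst plancherel_gauss[OF x]) auto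
  qed
  have *: "integrable lborel (?f n)" for n
  proof (rule Bochner_Integration.integrable_bound)
    show "integrable lborel (\<lambda>\<omega>. (LINT t|lborel. \<bar>x t\<bar>)\<^sup>2 * exp (- (?\<sigma> n * \<omega>)\<^sup>2 / 2))"
      by (intro integrable_mult_right gauss_integrable) simp
    show "AE \<omega> in lborel. norm (?f n \<omega>) \<le> norm ((LINT t|lborel. \<bar>x t\<bar>)\<^sup>2 * exp (- (?\<sigma> n * \<omega>)\<^sup>2 / 2))"
      using cmod_ft_le[OF x(2)] by (auto simp: abs_mult intro!: mult_right_mono power_mono)
  qed measurable
  have mono: "mono (\<lambda>n. ?f n \<omega>)" for \<omega>
  proof (rule monoI)
    fix m n :: nat assume "m \<le> n"
    then have "?\<sigma> n * \<bar>\<omega>\<bar> \<le> ?\<sigma> m * \<bar>\<omega>\<bar>" by (intro mult_right_mono divide_left_mono) auto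
    then have "(?\<sigma> n * \<bar>\<omega>\<bar>)\<^sup>2 \<le> (?\<sigma> m * \<bar>\<omega>\<bar>)\<^sup>2" by (rule power_mono) simp
    then have "(?\<sigma> n * \<omega>)\<^sup>2 \<le> (?\<sigma> m * \<omega>)\<^sup>2" by (simp only: power_mult_distrib power2_abs)
    then show "?f m \<omega> \<le> ?f n \<omega>" by (intro mult_left_mono) auto
  qed
  have ptw: "(\<lambda>n. ?f n \<omega>) \<longlonglongrightarrow> (cmod (ft x \<omega>))\<^sup>2" for \<omega>
  proof -
    have "(\<lambda>n. ?f n \<omega>) \<longlonglongrightarrow> (cmod (ft x \<omega>))\<^sup>2 * exp (- (0 * \<omega>)\<^sup>2 / 2)"
      by (intro tendsto_intros \<sigma>) simp
    then show ?thesis by simp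
  qed
  show "integrable lborel (\<lambda>\<omega>. (cmod (ft x \<omega>))\<^sup>2)" "(LINT \<omega>|lborel. (cmod (ft x \<omega>))\<^sup>2) = 2 * pi * L2_ip x x"
    using mono ptw
    by (intro integral_monotone_convergence_nonneg[OF * _ _ _ lim]; simp)+
qed

lemma ft_add:
  assumes "integrable lborel x" "integrable lborel y"
  shows "ft (\<lambda>t. x t + y t) \<omega> = ft x \<omega> + ft y \<omega>"
  using Bochner_Integration.integral_add[OF assms[THEN ft_integrable], of \<omega> \<omega>]
  by (simp add: ft_def distrib_right)

lemma ft_cmult: "ft (\<lambda>t. c * x t) \<omega> = of_real c * ft x \<omega>"
  by (simp add: ft_def mult.assoc)

lemma ft_diff:
  assumes "integrable lborel x" "integrable lborel y"
  shows "ft (\<lambda>t. x t - y t) \<omega> = ft x \<omega> - ft y \<omega>"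
  using ft_add[OF assms(1) integrable_mult_right[OF assms(2), of "-1"]] ft_cmult[of "-1" y] by simp

text \<open>Polarization of \<open>plancherel\<close>; with real signals only the real part of the
  spectral product is recovered.\<close>

lemma parseval:
  assumes x: "x \<in> L2" "integrable lborel x" and y: "y \<in> L2" "integrable lborel y"
  shows "(LINT \<omega>|lborel. Re (ft x \<omega> * cnj (ft y \<omega>))) = 2 * pi * L2_ip x y"
proof -
  have "integrable lborel (\<lambda>t. x t + y t)" using x y by simp
  note s = plancherel[OF L2_add[OF x(1) y(1)] this]
  have eq: "Re (ft x \<omega> * cnj (ft y \<omega>)) =
      ((cmod (ft (\<lambda>t. x t + y t) \<omega>))\<^sup>2 - (cmod (ft x \<omega>))\<^sup>2 - (cmod (ft y \<omega>))\<^sup>2) / 2" for \<omega>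
    unfolding ft_add[OF x(2) y(2)] cmod_power2 by (simp add: power2_eq_square algebra_simps)
  have "(LINT \<omega>|lborel. Re (ft x \<omega> * cnj (ft y \<omega>))) =
      (2 * pi * L2_ip (\<lambda>t. x t + y t) (\<lambda>t. x t + y t) - 2 * pi * L2_ip x x - 2 * pi * L2_ip y y) / 2"
    unfolding eq using s plancherel[OF x] plancherel[OF y] by simp
  also have "\<dots> = 2 * pi * L2_ip x y"
    using x y by (simp add: L2_ip_add_left L2_ip_add_right L2_add L2_ip_commute[of y x] field_simps)
  finally show ?thesis .
qed

section \<open>Convolution operators\<close>

text \<open>Time reversal of the impulse response, which represents the adjoint operator.\<close>

definition reflect :: "gen_fun \<Rightarrow> gen_fun" where
  "reflect h = \<lparr>weight = weight h, node = (\<lambda>i. - node h i), dens = (\<lambda>t. dens h (- t))\<rparr>"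

lemma reflect_H_class: "h \<in> H_class \<Longrightarrow> reflect h \<in> H_class"
  using lborel_integrable_real_affine[of "dens h" "-1" 0] by (auto simp: H_class_def reflect_def)

lemma H_nrm_reflect: "H_nrm (reflect h) = H_nrm h"
  using lborel_integral_real_affine[of "-1" "\<lambda>t. \<bar>dens h t\<bar>" 0] by (simp add: H_nrm_def reflect_def)

text \<open>Weights and density are real, so reversing time only conjugates the phase
  factors.\<close>

lemma conv_freq_reflect:
  assumes "h \<in> H_class"
  shows "conv_freq (reflect h) \<omega> = cnj (conv_freq h \<omega>)"
proof -
  have "summable (\<lambda>i. norm (complex_of_real (weight h i) * cis (- (\<omega> * node h i))))"
    using assms by (simp add: norm_mult H_class_def)
  then have "(\<lambda>i. complex_of_real (weight h i) * cis (- (\<omega> * node h i))) sums (\<Sum>i. complex_of_real (weight h i) * cis (- (\<omega> * node h i)))"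
    by (rule summable_sums[OF summable_norm_cancel])
  then have "(\<lambda>i. cnj (complex_of_real (weight h i) * cis (- (\<omega> * node h i)))) sums cnj (\<Sum>i. complex_of_real (weight h i) * cis (- (\<omega> * node h i)))"
    by (subst sums_cnj)
  then have 1: "(\<Sum>i. complex_of_real (weight h i) * cis (\<omega> * node h i)) = cnj (\<Sum>i. complex_of_real (weight h i) * cis (- (\<omega> * node h i)))"
    by (simp add: cis_cnj sums_iff)
  have "(CLINT t|lborel. complex_of_real (dens h (- t)) * cis (- (\<omega> * t))) = (CLINT t|lborel. complex_of_real (dens h t) * cis (\<omega> * t))"
    using lborel_integral_real_affine[of "-1" "\<lambda>t. complex_of_real (dens h t) * cis (\<omega> * t)" 0] by simp
  also have "\<dots> = cnj (CLINT t|lborel. complex_of_real (dens h t) * cis (- (\<omega> * t)))"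
    using Bochner_Integration.integral_cnj[of lborel "\<lambda>t. complex_of_real (dens h t) * cis (- (\<omega> * t))"]
    by (simp add: cis_cnj)
  finally show ?thesis
    using 1 by (simp add: conv_freq_def reflect_def)
qed

lemma mult_freq_reflect:
  "hp \<in> H_class \<Longrightarrow> hm \<in> H_class \<Longrightarrow> mult_freq (reflect hp) (reflect hm) \<omega> = cnj (mult_freq hp hm \<omega>)"
  by (simp add: mult_freq_def conv_freq_reflect)

locale conv_kernel =
  fixes h :: gen_fun
  assumes h: "h \<in> H_class"
begin

sublocale atoms: kernel "count_space UNIV" "weight h" "node h"
proof (intro kernel.intro kernel_axioms.intro)
  show "sigma_finite_measure (count_space (UNIV :: nat set))"
    by (rule sigma_finite_measure_count_space)
  have "summable (\<lambda>i. \<bar>weight h i\<bar>)" using h unfolding H_class_def by blast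
  then show "integrable (count_space UNIV) (weight h)"
    unfolding integrable_count_space_nat_iff real_norm_def .
  show "node h \<in> borel_measurable (count_space UNIV)" by simp
qed

sublocale density: kernel lborel "dens h" "\<lambda>\<tau>. \<tau>"
  using h by unfold_locales (auto simp: H_class_def)

lemma mass_sum: "atoms.mass + density.mass = H_nrm h"
proof -
  have "integrable (count_space UNIV) (\<lambda>i. \<bar>weight h i\<bar>)"
    using atoms.c_integrable by (rule integrable_abs)
  then show ?thesis
    unfolding atoms.mass_def density.mass_def H_nrm_def by (subst integral_count_space_nat) auto
qed

lemma conv_op_measurable [measurable]:
  assumes [measurable]: "u \<in> borel_measurable borel"
  shows "conv_op h u \<in> borel_measurable borel"
proof -
  have [measurable]: "dens h \<in> borel_measurable borel" using h by (simp add: H_class_def)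
  show ?thesis unfolding conv_op_def by measurable
qed

text \<open>The series in \<open>conv_op\<close> is an integral against counting measure wherever it
  converges absolutely, which is known for almost every \<open>t\<close>. All facts on
  \<open>kernel\<close> pass to \<open>conv_op\<close> along this identity.\<close>

lemma conv_op_AE:
  assumes u: "u \<in> L2"
  shows "conv_op h u =ae (\<lambda>t. kconv (count_space UNIV) (weight h) (node h) u t + kconv lborel (dens h) (\<lambda>\<tau>. \<tau>) u t)"
  using atoms.AE_kconv_integrable[OF u]
  by eventually_elim (simp add: conv_op_def kconv_def integral_count_space_nat)

lemma conv_op_L2:
  assumes u: "u \<in> L2"
  shows "conv_op h u \<in> L2" "L2_nrm (conv_op h u) \<le> H_nrm h * L2_nrm u"
proof -
  let ?K = "\<lambda>t. kconv (count_space UNIV) (weight h) (node h) u t + kconv lborel (dens h) (\<lambda>\<tau>. \<tau>) u t"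
  note [measurable] = L2_measurable[OF u]
  note K = atoms.kconv_L2[OF u] density.kconv_L2[OF u]
  have KL: "?K \<in> L2" using K by (intro L2_add)
  have ae: "?K =ae conv_op h u" using conv_op_AE[OF u] by eventually_elim simp
  show "conv_op h u \<in> L2" using L2_cong_AE[OF KL _ ae] by simp
  have "L2_nrm (conv_op h u) = L2_nrm ?K"
    using KL by (intro L2_nrm_cong_AE conv_op_AE[OF u]) auto
  also have "\<dots> \<le> (atoms.mass + density.mass) * L2_nrm u"
    using L2_nrm_triangle[OF K(1,3)] K(2,4) by (simp add: distrib_right)
  finally show "L2_nrm (conv_op h u) \<le> H_nrm h * L2_nrm u" by (simp add: mass_sum)
qed

lemma conv_op_diff:
  assumes u: "u \<in> L2" and v: "v \<in> L2"
  shows "conv_op h (\<lambda>t. u t - v t) =ae (\<lambda>t. conv_op h u t - conv_op h v t)"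
  using conv_op_AE[OF u] conv_op_AE[OF v] conv_op_AE[OF L2_diff[OF u v]]
    atoms.AE_kconv_integrable[OF u] atoms.AE_kconv_integrable[OF v]
    density.AE_kconv_integrable[OF u] density.AE_kconv_integrable[OF v]
  by eventually_elim (simp add: kconv_def right_diff_distrib)

lemma L2_ip_conv_op:
  assumes u: "u \<in> L2" and v: "v \<in> L2"
  shows "integrable (count_space UNIV) (\<lambda>i. weight h i * L2_ip (\<lambda>t. u (t - node h i)) v)"
    "integrable lborel (\<lambda>\<tau>. dens h \<tau> * L2_ip (\<lambda>t. u (t - \<tau>)) v)"
    "L2_ip (conv_op h u) v = (LINT i|count_space UNIV. weight h i * L2_ip (\<lambda>t. u (t - node h i)) v)
      + (LINT \<tau>|lborel. dens h \<tau> * L2_ip (\<lambda>t. u (t - \<tau>)) v)"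
proof -
  note [measurable] = L2_measurable[OF u] L2_measurable[OF v]
  show "integrable (count_space UNIV) (\<lambda>i. weight h i * L2_ip (\<lambda>t. u (t - node h i)) v)"
    "integrable lborel (\<lambda>\<tau>. dens h \<tau> * L2_ip (\<lambda>t. u (t - \<tau>)) v)"
    using atoms.L2_ip_kconv(1)[OF u v] density.L2_ip_kconv(1)[OF u v] .
  have "L2_ip (conv_op h u) v = L2_ip (\<lambda>t. kconv (count_space UNIV) (weight h) (node h) u t + kconv lborel (dens h) (\<lambda>\<tau>. \<tau>) u t) v"
    by (rule L2_ip_cong_AE[OF conv_op_AE[OF u]]) auto
  also have "\<dots> = L2_ip (kconv (count_space UNIV) (weight h) (node h) u) v + L2_ip (kconv lborel (dens h) (\<lambda>\<tau>. \<tau>) u) v"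
    by (intro L2_ip_add_left atoms.kconv_L2 density.kconv_L2 u v)
  finally show "L2_ip (conv_op h u) v = (LINT i|count_space UNIV. weight h i * L2_ip (\<lambda>t. u (t - node h i)) v)
      + (LINT \<tau>|lborel. dens h \<tau> * L2_ip (\<lambda>t. u (t - \<tau>)) v)"
    by (simp add: atoms.L2_ip_kconv(2)[OF u v] density.L2_ip_kconv(2)[OF u v])
qed

lemma conv_op_ft:
  assumes u: "u \<in> L2" "integrable lborel u"
  shows "integrable lborel (conv_op h u)" "ft (conv_op h u) \<omega> = conv_freq h \<omega> * ft u \<omega>"
proof -
  let ?a = "kconv (count_space UNIV) (weight h) (node h) u" and ?d = "kconv lborel (dens h) (\<lambda>\<tau>. \<tau>) u"
  note [measurable] = L2_measurable[OF u(1)]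
  note int = atoms.kconv_ft(1)[OF u(2)] density.kconv_ft(1)[OF u(2)]
  have ae: "(\<lambda>t. ?a t + ?d t) =ae conv_op h u" using conv_op_AE[OF u(1)] by eventually_elim simp
  show "integrable lborel (conv_op h u)"
    by (rule integrable_cong_AE_imp[OF Bochner_Integration.integrable_add[OF int]])
      (use conv_op_AE[OF u(1)] in auto)
  have "ft (conv_op h u) \<omega> = ft (\<lambda>t. ?a t + ?d t) \<omega>"
    unfolding ft_def
  proof (rule integral_cong_AE)
    show "AE t in lborel. of_real (conv_op h u t) * cis (- (\<omega> * t)) = of_real (?a t + ?d t) * cis (- (\<omega> * t))"
      using conv_op_AE[OF u(1)] by eventually_elim simp
  qed measurable
  also have "\<dots> = (kfreq (count_space UNIV) (weight h) (node h) \<omega> + kfreq lborel (dens h) (\<lambda>\<tau>. \<tau>) \<omega>) * ft u \<omega>"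
    by (simp add: ft_add[OF int] atoms.kconv_ft(2)[OF u(2)] density.kconv_ft(2)[OF u(2)] distrib_right)
  also have "kfreq (count_space UNIV) (weight h) (node h) \<omega> + kfreq lborel (dens h) (\<lambda>\<tau>. \<tau>) \<omega> = conv_freq h \<omega>"
    using h by (simp add: kfreq_def conv_freq_def integral_count_space_nat integrable_count_space_nat_iff norm_mult H_class_def)
  finally show "ft (conv_op h u) \<omega> = conv_freq h \<omega> * ft u \<omega>" .
qed

text \<open>The adjoint of the shift by \<open>a\<close> is the shift by \<open>- a\<close>;
  substituting \<open>- \<tau>\<close> in the density integral matches this with the reflected
  kernel.\<close>

lemma conv_op_adjoint:
  assumes u: "u \<in> L2" and v: "v \<in> L2"
  shows "L2_ip (conv_op h u) v = L2_ip u (conv_op (reflect h) v)"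
proof -
  interpret R: conv_kernel "reflect h"
    by unfold_locales (rule reflect_H_class[OF h])
  have shift: "L2_ip (\<lambda>t. u (t - a)) v = L2_ip (\<lambda>t. v (t + a)) u" for a
    by (subst L2_ip_shift) (rule L2_ip_commute)
  have "(LINT \<tau>|lborel. dens h (- \<tau>) * L2_ip (\<lambda>t. v (t - \<tau>)) u) = (LINT \<tau>|lborel. dens h \<tau> * L2_ip (\<lambda>t. v (t + \<tau>)) u)"
    using lborel_integral_real_affine[of "-1" "\<lambda>\<tau>. dens h \<tau> * L2_ip (\<lambda>t. v (t + \<tau>)) u" 0] by simp
  then have "L2_ip (conv_op (reflect h) v) u = L2_ip (conv_op h u) v"
    unfolding R.L2_ip_conv_op(3)[OF v u] L2_ip_conv_op(3)[OF u v] shift by (simp add: reflect_def)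
  then show ?thesis by (simp add: L2_ip_commute)
qed

end

section \<open>Bounded linear operators on \<open>L2\<close> and the multiplier\<close>

definition L2_bounded_linear :: "(signal \<Rightarrow> signal) \<Rightarrow> real \<Rightarrow> bool" where
  "L2_bounded_linear F C \<longleftrightarrow> (\<forall>u\<in>L2. F u \<in> L2 \<and> L2_nrm (F u) \<le> C * L2_nrm u) \<and>
     (\<forall>u\<in>L2. \<forall>v\<in>L2. F (\<lambda>t. u t - v t) =ae (\<lambda>t. F u t - F v t))"

lemma L2_bounded_linearD:
  assumes "L2_bounded_linear F C" "u \<in> L2"
  shows "F u \<in> L2" "L2_nrm (F u) \<le> C * L2_nrm u"
    "v \<in> L2 \<Longrightarrow> F (\<lambda>t. u t - v t) =ae (\<lambda>t. F u t - F v t)"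
  using assms by (auto simp: L2_bounded_linear_def)

text \<open>Compatibility with differences turns the norm bound into a Lipschitz bound, which serves
  both the limits over windows and the Neumann iteration.\<close>

lemma L2_bounded_linear_dist:
  assumes F: "L2_bounded_linear F C" and u: "u \<in> L2" and v: "v \<in> L2"
  shows "L2_nrm (\<lambda>t. F u t - F v t) \<le> C * L2_nrm (\<lambda>t. u t - v t)"
proof -
  note uv = L2_diff[OF u v]
  have "L2_nrm (\<lambda>t. F u t - F v t) = L2_nrm (F (\<lambda>t. u t - v t))"
  proof (rule L2_nrm_cong_AE)
    show "(\<lambda>t. F u t - F v t) =ae F (\<lambda>t. u t - v t)"
      using L2_bounded_linearD(3)[OF F u v] by eventually_elim simp
    show "(\<lambda>t. F u t - F v t) \<in> borel_measurable borel"
      by (intro L2_measurable L2_diff L2_bounded_linearD(1)[OF F] u v)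
    show "F (\<lambda>t. u t - v t) \<in> borel_measurable borel"
      by (intro L2_measurable L2_bounded_linearD(1)[OF F] uv)
  qed
  then show ?thesis using L2_bounded_linearD(2)[OF F uv] by simp
qed

definition off_op :: "gen_fun \<Rightarrow> gen_fun \<Rightarrow> signal \<Rightarrow> signal" where
  "off_op hp hm u = (\<lambda>t. conv_op hp u t - conv_op hm u t)"

lemma mult_op_off: "mult_op hp hm u = (\<lambda>t. u t - off_op hp hm u t)"
  by (simp add: mult_op_def off_op_def fun_eq_iff)

context
  fixes hp hm assumes hp: "hp \<in> H_class" and hm: "hm \<in> H_class"
begin

interpretation p: conv_kernel hp by unfold_locales (rule hp)
interpretation m: conv_kernel hm by unfold_locales (rule hm)

text \<open>\<open>off_op\<close> is the identity minus the multiplier. The iteration that inverts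
  compressions of the multiplier contracts once this norm bound is below one.\<close>

lemma off_op_blin: "L2_bounded_linear (off_op hp hm) (H_nrm hp + H_nrm hm)"
  unfolding L2_bounded_linear_def
proof (intro conjI ballI)
  fix u assume u: "u \<in> L2"
  show "off_op hp hm u \<in> L2"
    unfolding off_op_def by (intro L2_diff p.conv_op_L2 m.conv_op_L2 u)
  show "L2_nrm (off_op hp hm u) \<le> (H_nrm hp + H_nrm hm) * L2_nrm u"
    using L2_nrm_triangle_diff[OF p.conv_op_L2(1)[OF u] m.conv_op_L2(1)[OF u]] p.conv_op_L2(2)[OF u] m.conv_op_L2(2)[OF u]
    unfolding off_op_def by (simp add: distrib_right)
  fix v assume v: "v \<in> L2"
  show "off_op hp hm (\<lambda>t. u t - v t) =ae (\<lambda>t. off_op hp hm u t - off_op hp hm v t)"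
    using p.conv_op_diff[OF u v] m.conv_op_diff[OF u v] by eventually_elim (simp add: off_op_def)
qed

lemma mult_op_blin: "L2_bounded_linear (mult_op hp hm) (1 + H_nrm hp + H_nrm hm)"
  unfolding L2_bounded_linear_def
proof (intro conjI ballI)
  fix u assume u: "u \<in> L2"
  note N = L2_bounded_linearD[OF off_op_blin u]
  show "mult_op hp hm u \<in> L2"
    unfolding mult_op_off by (intro L2_diff u N)
  show "L2_nrm (mult_op hp hm u) \<le> (1 + H_nrm hp + H_nrm hm) * L2_nrm u"
    using L2_nrm_triangle_diff[OF u N(1)] N(2)
    unfolding mult_op_off by (simp add: distrib_right)
  fix v assume v: "v \<in> L2"
  show "mult_op hp hm (\<lambda>t. u t - v t) =ae (\<lambda>t. mult_op hp hm u t - mult_op hp hm v t)"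
    using N(3)[OF v] by eventually_elim (simp add: mult_op_off)
qed

lemma mult_op_adjoint:
  assumes u: "u \<in> L2" and v: "v \<in> L2"
  shows "L2_ip (mult_op hp hm u) v = L2_ip u (mult_op (reflect hp) (reflect hm) v)"
proof -
  interpret p': conv_kernel "reflect hp" by unfold_locales (rule reflect_H_class[OF hp])
  interpret m': conv_kernel "reflect hm" by unfold_locales (rule reflect_H_class[OF hm])
  note L = u v p.conv_op_L2(1)[OF u] m.conv_op_L2(1)[OF u] p'.conv_op_L2(1)[OF v] m'.conv_op_L2(1)[OF v]
  show ?thesis
    unfolding mult_op_def
    using L by (simp add: L2_ip_add_left L2_ip_diff_left L2_ip_add_right L2_ip_diff_right L2_diff L2_add
        p.conv_op_adjoint m.conv_op_adjoint)
qed

lemma mult_op_ft: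
  assumes u: "u \<in> L2" "integrable lborel u"
  shows "integrable lborel (mult_op hp hm u)" "ft (mult_op hp hm u) \<omega> = mult_freq hp hm \<omega> * ft u \<omega>"
  unfolding mult_op_def
  using u p.conv_op_ft[OF u] m.conv_op_ft[OF u]
  by (simp_all add: ft_add ft_diff mult_freq_def algebra_simps)

end

section \<open>Frequency-domain coercivity\<close>

text \<open>Restriction to a bounded interval makes a signal of \<open>L2\<close> integrable, so
  that \<open>ft\<close> is a genuine integral for it.\<close>

definition window :: "real \<Rightarrow> signal \<Rightarrow> signal" where
  "window R x = (\<lambda>t. indicator {- R..R} t * x t)"

lemma window_L2:
  assumes "x \<in> L2" shows "window R x \<in> L2"
proof -
  note [measurable] = L2_measurable[OF assms]
  have "window R x \<in> borel_measurable borel" unfolding window_def by measurable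
  then show ?thesis
    by (rule L2_dominated(1)[OF assms]) (auto simp: window_def indicator_def)
qed

lemma window_integrable:
  assumes "x \<in> L2" shows "integrable lborel (window R x)"
proof -
  have "(indicator {- R..R} :: signal) \<in> L2"
    by (rule L2_bounded_interval[where M = 1 and R = R]) (auto simp: indicator_def)
  from L2_mult_integrable[OF this assms] show ?thesis by (simp add: window_def)
qed

lemma window_tendsto:
  assumes "x \<in> L2"
  shows "(\<lambda>n. L2_nrm (\<lambda>t. window (real n) x t - x t)) \<longlonglongrightarrow> 0"
proof (rule L2_dominated_convergence(3))
  show "window (real n) x \<in> borel_measurable borel" for n using window_L2[OF assms] by (rule L2_measurable)
  show "x \<in> borel_measurable borel" using assms by (rule L2_measurable)
  show "(\<lambda>t. \<bar>x t\<bar>) \<in> L2" using assms by (rule L2_abs)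
  show "AE t in lborel. \<bar>window (real n) x t\<bar> \<le> \<bar>x t\<bar>" for n
    by (auto simp: window_def indicator_def)
  have "(\<lambda>n. window (real n) x t) \<longlonglongrightarrow> x t" for t
  proof (rule tendsto_eventually)
    obtain N :: nat where N: "\<bar>t\<bar> \<le> real N" using real_arch_simple by blast
    have "window (real n) x t = x t" if "n \<ge> N" for n
      using N that by (auto simp: window_def indicator_def abs_le_iff)
    then show "\<forall>\<^sub>F n in sequentially. window (real n) x t = x t"
      by (auto simp: eventually_sequentially)
  qed
  then show "AE t in lborel. (\<lambda>n. window (real n) x t) \<longlonglongrightarrow> x t" by simp
qed

lemma set_integral_ft: "(CLINT t:{- T..T}|lborel. of_real (x t) * cis (- (\<omega> * t))) = ft (window T x) \<omega>"
  by (simp add: set_lebesgue_integral_def ft_def window_def scaleR_conv_of_real mult.assoc)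

text \<open>Truncating further than the window changes nothing, so the mean-square limit is of an
  eventually constant family.\<close>

lemma L2_fourier_window:
  assumes "x \<in> L2" shows "L2_fourier (window R x) (ft (window R x))"
  unfolding L2_fourier_def set_integral_ft
proof (intro conjI)
  note [measurable] = L2_measurable[OF window_L2[OF assms]]
  show "ft (window R x) \<in> borel_measurable borel" by measurable
  show "integrable lborel (\<lambda>\<omega>. (cmod (ft (window R x) \<omega>))\<^sup>2)"
    by (rule plancherel(1)[OF window_L2[OF assms] window_integrable[OF assms]])
  have "window T (window R x) = window R x" if "T \<ge> R" for T
    using that by (auto simp: window_def indicator_def fun_eq_iff)
  then have "\<forall>\<^sub>F T in at_top. (\<integral>\<^sup>+ \<omega>. ennreal ((cmod (ft (window T (window R x)) \<omega> - ft (window R x) \<omega>))\<^sup>2) \<partial>lborel) = 0"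
    by (intro eventually_mono[OF eventually_ge_at_top[of R]]) simp
  then show "((\<lambda>T. \<integral>\<^sup>+ \<omega>. ennreal ((cmod (ft (window T (window R x)) \<omega> - ft (window R x) \<omega>))\<^sup>2) \<partial>lborel) \<longlongrightarrow> 0) at_top"
    by (rule tendsto_eventually)
qed

section \<open>Complex square-integrable spectra and Parseval's identity for mean-square
  transforms\<close>

definition CL2 :: "(real \<Rightarrow> complex) set" where
  "CL2 = {X \<in> borel_measurable borel. (\<lambda>\<omega>. cmod (X \<omega>)) \<in> L2}"

definition CL2_nrm :: "(real \<Rightarrow> complex) \<Rightarrow> real" where
  "CL2_nrm X = L2_nrm (\<lambda>\<omega>. cmod (X \<omega>))"

lemma CL2_measurable [measurable_dest]: "X \<in> CL2 \<Longrightarrow> X \<in> borel_measurable borel"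
  by (simp add: CL2_def)

lemma CL2I: "X \<in> borel_measurable borel \<Longrightarrow> integrable lborel (\<lambda>\<omega>. (cmod (X \<omega>))\<^sup>2) \<Longrightarrow> X \<in> CL2"
  by (auto simp: CL2_def L2_def)

lemma CL2_diff:
  assumes "X \<in> CL2" "Y \<in> CL2" shows "(\<lambda>\<omega>. X \<omega> - Y \<omega>) \<in> CL2"
proof -
  note [measurable] = assms[THEN CL2_measurable]
  have "(\<lambda>\<omega>. cmod (X \<omega>) + cmod (Y \<omega>)) \<in> L2" using assms by (auto simp: CL2_def intro: L2_add)
  then have "(\<lambda>\<omega>. cmod (X \<omega> - Y \<omega>)) \<in> L2"
    by (rule L2_dominated(1)) (auto intro: norm_triangle_ineq4)
  then show ?thesis by (simp add: CL2_def)
qed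

lemma CL2_Re_mult:
  assumes "X \<in> CL2" "Y \<in> CL2"
  shows "integrable lborel (\<lambda>\<omega>. Re (X \<omega> * cnj (Y \<omega>)))"
    "\<bar>LINT \<omega>|lborel. Re (X \<omega> * cnj (Y \<omega>))\<bar> \<le> CL2_nrm X * CL2_nrm Y"
proof -
  note [measurable] = assms[THEN CL2_measurable]
  have XY: "(\<lambda>\<omega>. cmod (X \<omega>)) \<in> L2" "(\<lambda>\<omega>. cmod (Y \<omega>)) \<in> L2" using assms by (auto simp: CL2_def)
  have le: "\<bar>Re (X \<omega> * cnj (Y \<omega>))\<bar> \<le> cmod (X \<omega>) * cmod (Y \<omega>)" for \<omega>
    using abs_Re_le_cmod[of "X \<omega> * cnj (Y \<omega>)"] by (simp add: norm_mult)
  show int: "integrable lborel (\<lambda>\<omega>. Re (X \<omega> * cnj (Y \<omega>)))"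
  proof (rule Bochner_Integration.integrable_bound[OF L2_mult_integrable[OF XY]])
    show "AE \<omega> in lborel. norm (Re (X \<omega> * cnj (Y \<omega>))) \<le> norm (cmod (X \<omega>) * cmod (Y \<omega>))"
      using le by simp
  qed measurable
  have "\<bar>LINT \<omega>|lborel. Re (X \<omega> * cnj (Y \<omega>))\<bar> \<le> (LINT \<omega>|lborel. \<bar>Re (X \<omega> * cnj (Y \<omega>))\<bar>)"
    by (rule integral_abs_bound)
  also have "\<dots> \<le> L2_ip (\<lambda>\<omega>. cmod (X \<omega>)) (\<lambda>\<omega>. cmod (Y \<omega>))"
    unfolding L2_ip_def by (rule integral_mono[OF integrable_abs[OF int] L2_mult_integrable[OF XY] le])
  also have "\<dots> \<le> CL2_nrm X * CL2_nrm Y"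
    using L2_ip_bound[OF XY] by (simp add: CL2_nrm_def)
  finally show "\<bar>LINT \<omega>|lborel. Re (X \<omega> * cnj (Y \<omega>))\<bar> \<le> CL2_nrm X * CL2_nrm Y" .
qed

text \<open>The transform of \<open>x\<close> is given only as a mean-square limit. Parseval's
  identity holds for the windows of \<open>x\<close>, and both sides converge: the spectra by the
  definition of \<open>L2_fourier\<close>, the signals by \<open>window_tendsto\<close>.\<close>

lemma parseval_fourier:
  assumes x: "x \<in> L2" and X: "L2_fourier x X" and v: "v \<in> L2" "integrable lborel v"
  shows "(LINT \<omega>|lborel. Re (X \<omega> * cnj (ft v \<omega>))) = 2 * pi * L2_ip x v"
proof (rule LIMSEQ_unique)
  let ?X = "\<lambda>n. ft (window (real n) x)"
  note [measurable] = L2_measurable[OF v(1)] L2_measurable[OF window_L2[OF x]]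
  have XC: "X \<in> CL2" using X by (intro CL2I) (auto simp: L2_fourier_def)
  have V: "ft v \<in> CL2" using plancherel(1)[OF v] by (intro CL2I) auto
  have Xn: "?X n \<in> CL2" for n
    using plancherel(1)[OF window_L2[OF x] window_integrable[OF x]] by (intro CL2I) auto
  have D: "(\<lambda>\<omega>. ?X n \<omega> - X \<omega>) \<in> CL2" for n using Xn XC by (rule CL2_diff)
  have nn: "(\<integral>\<^sup>+\<omega>. ennreal ((cmod (?X n \<omega> - X \<omega>))\<^sup>2) \<partial>lborel) = ennreal ((CL2_nrm (\<lambda>\<omega>. ?X n \<omega> - X \<omega>))\<^sup>2)" for n
    using D[of n] unfolding CL2_nrm_def L2_nrm_def
    by (subst nn_integral_eq_integral) (auto simp: CL2_def L2_def)
  have "((\<lambda>T. \<integral>\<^sup>+\<omega>. ennreal ((cmod (ft (window T x) \<omega> - X \<omega>))\<^sup>2) \<partial>lborel) \<longlongrightarrow> 0) at_top"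
    using X unfolding L2_fourier_def set_integral_ft by blast
  from filterlim_compose[OF this filterlim_real_sequentially]
  have "(\<lambda>n. ennreal ((CL2_nrm (\<lambda>\<omega>. ?X n \<omega> - X \<omega>))\<^sup>2)) \<longlonglongrightarrow> ennreal 0"
    by (simp add: nn)
  then have "(\<lambda>n. (CL2_nrm (\<lambda>\<omega>. ?X n \<omega> - X \<omega>))\<^sup>2) \<longlonglongrightarrow> 0"
    by (subst (asm) tendsto_ennreal_iff) auto
  from tendsto_real_sqrt[OF this] have D0: "(\<lambda>n. CL2_nrm (\<lambda>\<omega>. ?X n \<omega> - X \<omega>)) \<longlonglongrightarrow> 0"
    by (simp add: CL2_nrm_def)
  have "(\<lambda>n. (LINT \<omega>|lborel. Re (?X n \<omega> * cnj (ft v \<omega>))) - (LINT \<omega>|lborel. Re (X \<omega> * cnj (ft v \<omega>)))) \<longlonglongrightarrow> 0"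
  proof (rule Lim_null_comparison)
    show "(\<lambda>n. CL2_nrm (\<lambda>\<omega>. ?X n \<omega> - X \<omega>) * CL2_nrm (ft v)) \<longlonglongrightarrow> 0"
      using tendsto_mult[OF D0 tendsto_const, of "CL2_nrm (ft v)"] by simp
    have "(LINT \<omega>|lborel. Re (?X n \<omega> * cnj (ft v \<omega>))) - (LINT \<omega>|lborel. Re (X \<omega> * cnj (ft v \<omega>)))
        = (LINT \<omega>|lborel. Re ((?X n \<omega> - X \<omega>) * cnj (ft v \<omega>)))" for n
      by (simp add: left_diff_distrib CL2_Re_mult(1)[OF Xn V, simplified] CL2_Re_mult(1)[OF XC V, simplified]
          flip: Bochner_Integration.integral_diff)
    then show "\<forall>\<^sub>F n in sequentially. norm ((LINT \<omega>|lborel. Re (?X n \<omega> * cnj (ft v \<omega>))) - (LINT \<omega>|lborel. Re (X \<omega> * cnj (ft v \<omega>))))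
        \<le> CL2_nrm (\<lambda>\<omega>. ?X n \<omega> - X \<omega>) * CL2_nrm (ft v)"
      using CL2_Re_mult(2)[OF D V] by (intro always_eventually allI) (simp only: real_norm_def)
  qed
  then show "(\<lambda>n. LINT \<omega>|lborel. Re (?X n \<omega> * cnj (ft v \<omega>))) \<longlonglongrightarrow> (LINT \<omega>|lborel. Re (X \<omega> * cnj (ft v \<omega>)))"
    by (simp add: LIM_zero_iff)
  have "(\<lambda>n. L2_ip (window (real n) x) v - L2_ip x v) \<longlonglongrightarrow> 0"
  proof (rule Lim_null_comparison)
    show "(\<lambda>n. L2_nrm (\<lambda>t. window (real n) x t - x t) * L2_nrm v) \<longlonglongrightarrow> 0"
      using tendsto_mult[OF window_tendsto[OF x] tendsto_const, of "L2_nrm v"] by simp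
    show "\<forall>\<^sub>F n in sequentially. norm (L2_ip (window (real n) x) v - L2_ip x v) \<le> L2_nrm (\<lambda>t. window (real n) x t - x t) * L2_nrm v"
      using L2_ip_bound[OF L2_diff[OF window_L2[OF x] x] v(1)] by (simp add: L2_ip_diff_left window_L2 x v)
  qed
  then have "(\<lambda>n. L2_ip (window (real n) x) v) \<longlonglongrightarrow> L2_ip x v" by (simp add: LIM_zero_iff)
  from tendsto_mult[OF tendsto_const[of "2 * pi"] this]
  show "(\<lambda>n. LINT \<omega>|lborel. Re (?X n \<omega> * cnj (ft v \<omega>))) \<longlonglongrightarrow> 2 * pi * L2_ip x v"
    by (simp only: parseval[OF window_L2[OF x] window_integrable[OF x] v])
qed

lemma L2_ip_blin_tendsto:
  assumes F: "L2_bounded_linear F C" and H: "L2_bounded_linear H D" and X: "\<And>n. X n \<in> L2" and x: "x \<in> L2"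
    and lim: "(\<lambda>n. L2_nrm (\<lambda>t. X n t - x t)) \<longlonglongrightarrow> 0"
  shows "(\<lambda>n. L2_ip (F (X n)) (H (X n))) \<longlonglongrightarrow> L2_ip (F x) (H x)"
proof -
  have dist0: "(\<lambda>n. L2_nrm (\<lambda>t. K (X n) t - K x t)) \<longlonglongrightarrow> 0" if K: "L2_bounded_linear K E" for K E
  proof (rule Lim_null_comparison)
    show "(\<lambda>n. E * L2_nrm (\<lambda>t. X n t - x t)) \<longlonglongrightarrow> 0"
      using tendsto_mult[OF tendsto_const lim, of E] by simp
    show "\<forall>\<^sub>F n in sequentially. norm (L2_nrm (\<lambda>t. K (X n) t - K x t)) \<le> E * L2_nrm (\<lambda>t. X n t - x t)"
      using L2_bounded_linear_dist[OF K X x] by simp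
  qed
  have "(\<lambda>n. L2_ip (F (X n)) (H (X n)) - L2_ip (F x) (H x)) \<longlonglongrightarrow> 0"
  proof (rule Lim_null_comparison)
    let ?f = "\<lambda>n. L2_nrm (\<lambda>t. F (X n) t - F x t)" and ?h = "\<lambda>n. L2_nrm (\<lambda>t. H (X n) t - H x t)"
    have "(\<lambda>n. ?f n * (?h n + L2_nrm (H x)) + L2_nrm (F x) * ?h n) \<longlonglongrightarrow> 0 * (0 + L2_nrm (H x)) + L2_nrm (F x) * 0"
      by (intro tendsto_intros dist0[OF F] dist0[OF H])
    then show "(\<lambda>n. ?f n * (?h n + L2_nrm (H x)) + L2_nrm (F x) * ?h n) \<longlonglongrightarrow> 0" by simp
    show "\<forall>\<^sub>F n in sequentially. norm (L2_ip (F (X n)) (H (X n)) - L2_ip (F x) (H x))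
        \<le> ?f n * (?h n + L2_nrm (H x)) + L2_nrm (F x) * ?h n"
    proof (intro always_eventually allI)
      fix n
      note L = L2_bounded_linearD(1)[OF F X[of n]] L2_bounded_linearD(1)[OF F x] L2_bounded_linearD(1)[OF H X[of n]] L2_bounded_linearD(1)[OF H x]
      \<comment> \<open>The mixed term \<open>L2_ip (F x) (H (X n))\<close> is added and
        subtracted.\<close>
      have "L2_ip (F (X n)) (H (X n)) - L2_ip (F x) (H x)
          = L2_ip (\<lambda>t. F (X n) t - F x t) (H (X n)) + L2_ip (F x) (\<lambda>t. H (X n) t - H x t)"
        using L by (simp add: L2_ip_diff_left L2_ip_diff_right)
      moreover have "\<bar>L2_ip (\<lambda>t. F (X n) t - F x t) (H (X n))\<bar> \<le> ?f n * L2_nrm (H (X n))"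
        by (rule L2_ip_bound[OF L2_diff[OF L(1,2)] L(3)])
      moreover have "L2_nrm (H (X n)) \<le> ?h n + L2_nrm (H x)"
        using L2_nrm_triangle[OF L2_diff[OF L(3,4)] L(4)] by simp
      then have "?f n * L2_nrm (H (X n)) \<le> ?f n * (?h n + L2_nrm (H x))"
        by (rule mult_left_mono) simp
      moreover have "\<bar>L2_ip (F x) (\<lambda>t. H (X n) t - H x t)\<bar> \<le> L2_nrm (F x) * ?h n"
        by (rule L2_ip_bound[OF L(2) L2_diff[OF L(3,4)]])
      ultimately show "norm (L2_ip (F (X n)) (H (X n)) - L2_ip (F x) (H x))
          \<le> ?f n * (?h n + L2_nrm (H x)) + L2_nrm (F x) * ?h n"
        unfolding real_norm_def by linarith
    qed
  qed
  then show ?thesis by (simp add: LIM_zero_iff)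
qed

text \<open>The adjoint multiplier has the conjugate symbol, and Parseval's identity conjugates it
  back, so the inner product becomes the integral of \<open>Re (M (1 + k G))\<close> against the
  squared modulus of the spectrum. This is shown for windows of \<open>z\<close>, whose transforms
  are integrals, and passes to the limit because the operators are bounded.\<close>

lemma frequency_coercive:
  assumes hp: "hp \<in> H_class" and hm: "hm \<in> H_class" and G: "L2_bounded_linear G C"
    and resp: "frequency_response G Gf"
    and re: "\<And>\<omega>. Re (mult_freq hp hm \<omega> * (1 + of_real k * Gf \<omega>)) \<ge> \<epsilon>"
    and z: "z \<in> L2"
  shows "L2_ip (\<lambda>t. z t + k * G z t) (mult_op (reflect hp) (reflect hm) z) \<ge> \<epsilon> * L2_ip z z"
proof -
  let ?M = "mult_op (reflect hp) (reflect hm)"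
  note rH = reflect_H_class[OF hp] reflect_H_class[OF hm]
  note M = mult_op_blin[OF rH]
  define K where "K = (\<lambda>z t. z t + k * G z t)"
  have K: "L2_bounded_linear K (1 + \<bar>k\<bar> * C)"
    unfolding L2_bounded_linear_def
  proof (intro conjI ballI)
    fix u assume u: "u \<in> L2"
    note Gu = L2_bounded_linearD[OF G u]
    show "K u \<in> L2" unfolding K_def by (intro L2_add L2_cmult u Gu)
    have "L2_nrm (K u) \<le> L2_nrm u + \<bar>k\<bar> * L2_nrm (G u)"
      using L2_nrm_triangle[OF u L2_cmult[OF Gu(1)]] unfolding K_def L2_nrm_cmult .
    also have "\<dots> \<le> L2_nrm u + \<bar>k\<bar> * (C * L2_nrm u)"
      using Gu(2) by (intro add_left_mono mult_left_mono) auto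
    finally show "L2_nrm (K u) \<le> (1 + \<bar>k\<bar> * C) * L2_nrm u" by (simp add: algebra_simps)
    fix v assume v: "v \<in> L2"
    show "K (\<lambda>t. u t - v t) =ae (\<lambda>t. K u t - K v t)"
      using Gu(3)[OF v] by eventually_elim (simp add: K_def right_diff_distrib)
  qed
  have I: "L2_bounded_linear (\<lambda>u. u) 1" by (simp add: L2_bounded_linear_def)
  have "\<epsilon> * L2_ip (window (real n) z) (window (real n) z) \<le> L2_ip (K (window (real n) z)) (?M (window (real n) z))" for n
  proof -
    let ?u = "window (real n) z"
    note u = window_L2[OF z, of "real n"] window_integrable[OF z, of "real n"]
    note Mu = L2_bounded_linearD(1)[OF M u(1)] mult_op_ft(1)[OF rH u]
    have Gu: "G ?u \<in> L2" by (rule L2_bounded_linearD(1)[OF G u(1)])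
    note [measurable] = L2_measurable[OF u(1)] L2_measurable[OF Mu(1)]
    note fu = L2_fourier_window[OF z, of "real n"]
    have fG: "L2_fourier (G ?u) (\<lambda>\<omega>. Gf \<omega> * ft ?u \<omega>)"
      using resp fu u(1) by (auto simp: frequency_response_def)
    have U: "ft ?u \<in> CL2" using plancherel(1)[OF u] by (intro CL2I) auto
    have GU: "(\<lambda>\<omega>. Gf \<omega> * ft ?u \<omega>) \<in> CL2" using fG by (intro CL2I) (auto simp: L2_fourier_def)
    have MU: "ft (?M ?u) \<in> CL2" using plancherel(1)[OF Mu] by (intro CL2I) auto
    have "2 * pi * L2_ip (K ?u) (?M ?u) = 2 * pi * L2_ip ?u (?M ?u) + k * (2 * pi * L2_ip (G ?u) (?M ?u))"
      unfolding K_def using u Gu Mu by (simp add: L2_ip_add_left L2_ip_cmult_left L2_cmult algebra_simps)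
    also have "\<dots> = (LINT \<omega>|lborel. Re (ft ?u \<omega> * cnj (ft (?M ?u) \<omega>)))
        + k * (LINT \<omega>|lborel. Re ((Gf \<omega> * ft ?u \<omega>) * cnj (ft (?M ?u) \<omega>)))"
      unfolding parseval_fourier[OF u(1) fu Mu] parseval_fourier[OF Gu fG Mu] ..
    also have "\<dots> = (LINT \<omega>|lborel. Re (ft ?u \<omega> * cnj (ft (?M ?u) \<omega>)) + k * Re ((Gf \<omega> * ft ?u \<omega>) * cnj (ft (?M ?u) \<omega>)))"
      by (subst Bochner_Integration.integral_add[OF CL2_Re_mult(1)[OF U MU] integrable_mult_right[OF CL2_Re_mult(1)[OF GU MU]]])
        (simp only: integral_mult_right_zero)
    also have "\<dots> \<ge> (LINT \<omega>|lborel. \<epsilon> * (cmod (ft ?u \<omega>))\<^sup>2)"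
    proof (rule integral_mono)
      show "integrable lborel (\<lambda>\<omega>. Re (ft ?u \<omega> * cnj (ft (?M ?u) \<omega>)) + k * Re ((Gf \<omega> * ft ?u \<omega>) * cnj (ft (?M ?u) \<omega>)))"
        by (rule Bochner_Integration.integrable_add[OF CL2_Re_mult(1)[OF U MU] integrable_mult_right[OF CL2_Re_mult(1)[OF GU MU]]])
      show "integrable lborel (\<lambda>\<omega>. \<epsilon> * (cmod (ft ?u \<omega>))\<^sup>2)"
        using plancherel(1)[OF u] by (rule integrable_mult_right)
      fix \<omega>
      have "Re (ft ?u \<omega> * cnj (ft (?M ?u) \<omega>)) + k * Re ((Gf \<omega> * ft ?u \<omega>) * cnj (ft (?M ?u) \<omega>))
          = Re ((mult_freq hp hm \<omega> * (1 + of_real k * Gf \<omega>)) * (ft ?u \<omega> * cnj (ft ?u \<omega>)))"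
        unfolding mult_op_ft(2)[OF rH u] mult_freq_reflect[OF hp hm]
        by (simp add: algebra_simps)
      also have "\<dots> = Re (mult_freq hp hm \<omega> * (1 + of_real k * Gf \<omega>)) * (cmod (ft ?u \<omega>))\<^sup>2"
        unfolding complex_norm_square[symmetric] by simp
      also have "\<dots> \<ge> \<epsilon> * (cmod (ft ?u \<omega>))\<^sup>2"
        by (rule mult_right_mono[OF re]) simp
      finally show "\<epsilon> * (cmod (ft ?u \<omega>))\<^sup>2
          \<le> Re (ft ?u \<omega> * cnj (ft (?M ?u) \<omega>)) + k * Re ((Gf \<omega> * ft ?u \<omega>) * cnj (ft (?M ?u) \<omega>))" .
    qed
    also have "(LINT \<omega>|lborel. \<epsilon> * (cmod (ft ?u \<omega>))\<^sup>2) = 2 * pi * (\<epsilon> * L2_ip ?u ?u)"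
      by (simp add: plancherel(2)[OF u])
    finally show ?thesis by simp
  qed
  note le = this
  have "\<epsilon> * L2_ip z z \<le> L2_ip (K z) (?M z)"
  proof (rule LIMSEQ_le)
    show "(\<lambda>n. \<epsilon> * L2_ip (window (real n) z) (window (real n) z)) \<longlonglongrightarrow> \<epsilon> * L2_ip z z"
      by (intro tendsto_mult tendsto_const L2_ip_blin_tendsto[OF I I window_L2[OF z] z window_tendsto[OF z]])
    show "(\<lambda>n. L2_ip (K (window (real n) z)) (?M (window (real n) z))) \<longlonglongrightarrow> L2_ip (K z) (?M z)"
      by (rule L2_ip_blin_tendsto[OF K M window_L2[OF z] z window_tendsto[OF z]])
  qed (use le in auto)
  then show ?thesis by (simp add: K_def)
qed

section \<open>Positivity of the multiplier\<close>

text \<open>Multiplying through by \<open>w\<close> treats both signs at once; the last clause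
  covers \<open>w = 0\<close>, where the inequalities say nothing about \<open>y\<close>.\<close>

definition sector :: "(real \<Rightarrow> real) \<Rightarrow> real \<Rightarrow> real \<Rightarrow> real \<Rightarrow> bool" where
  "sector p A w y \<longleftrightarrow> w * p w \<le> w * y \<and> w * y \<le> A * (w * p w) \<and> (w = 0 \<longrightarrow> y = 0)"

lemma mono_mult_nonneg:
  fixes p :: "real \<Rightarrow> real"
  assumes "mono p" "p 0 = 0" shows "0 \<le> w * p w"
  using monoD[OF assms(1), of 0 w] monoD[OF assms(1), of w 0] assms(2)
  by (cases "0 \<le> w") (auto simp: mult_nonpos_nonpos)

text \<open>An antiderivative of a monotone function is convex with that function as subgradient;
  the mean value theorem gives the inequality. For odd \<open>p\<close>, the derivative of
  \<open>P (- x) - P x\<close> vanishes.\<close>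

lemma convex_potential:
  fixes p :: "real \<Rightarrow> real"
  assumes "mono p" and cont: "continuous_on UNIV p"
  obtains P where "\<And>a b. p a * (b - a) \<le> P b - P a" "P 0 = 0" "continuous_on UNIV P"
    "\<And>x. odd_fun p \<Longrightarrow> P (- x) = P x"
proof -
  have "\<exists>F. \<forall>x::real. -\<infinity> < ereal x \<longrightarrow> ereal x < \<infinity> \<longrightarrow> (F has_vector_derivative p x) (at x)"
    by (rule einterval_antiderivative) (use cont in \<open>auto simp: continuous_on_eq_continuous_at\<close>)
  then obtain F where F: "(F has_real_derivative p x) (at x)" for x
    by (auto simp: has_real_derivative_iff_has_vector_derivative)
  define P where "P = (\<lambda>x. F x - F 0)"
  have P: "(P has_real_derivative p x) (at x)" for x
    unfolding P_def by (auto intro!: derivative_eq_intros F)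
  have "p a * (b - a) \<le> P b - P a" for a b
  proof (cases a b rule: linorder_cases)
    case less
    then obtain z where z: "a < z" "P b - P a = (b - a) * p z"
      using MVT2[of a b P p] P by blast
    then show ?thesis using less monoD[OF assms(1), of a z] by (simp add: mult.commute mult_left_mono)
  next
    case greater
    then obtain z where z: "z < a" "P a - P b = (a - b) * p z"
      using MVT2[of b a P p] P by blast
    have "(a - b) * p z \<le> (a - b) * p a"
      using greater z(1) monoD[OF assms(1), of z a] by (intro mult_left_mono) auto
    with z(2) show ?thesis by (simp add: algebra_simps)
  qed simp
  moreover have "P 0 = 0" by (simp add: P_def)
  moreover have "continuous_on UNIV P"
    using P by (intro DERIV_continuous_on)
  moreover have "P (- x) = P x" if "odd_fun p" for x
  proof -
    have "((\<lambda>x. P (- x) - P x) has_real_derivative 0) (at x)" for x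
    proof -
      have "((\<lambda>x. P (- x) - P x) has_real_derivative (p (- x) * (- 1) - p x)) (at x)"
        by (intro derivative_intros DERIV_chain2[OF P] P)
      then show ?thesis using that by (simp add: odd_fun_def)
    qed
    then have "\<forall>x. ((\<lambda>x. P (- x) - P x) has_real_derivative 0) (at x)" ..
    from DERIV_isconst_all[OF this, of x 0] have "P (- x) - P x = P (- 0) - P 0" .
    then show ?thesis by simp
  qed
  ultimately show thesis by (rule that)
qed

text \<open>If \<open>b * y\<close> is positive, the sector forces \<open>b\<close> to have the sign
  of \<open>a\<close>, so \<open>y\<close> may be replaced by \<open>A * p a\<close> and the
  subgradient inequality at \<open>a\<close> applies. Otherwise the left side is nonpositive, while
  the right side is nonnegative by comparison with the point 0.\<close>

lemma sector_subgradient: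
  assumes sec: "sector p A a y" and A: "A \<ge> 0"
    and sub: "\<And>a b. p a * (b - a) \<le> P b - P a" and P0: "P 0 = 0" and p0: "p 0 = 0"
  shows "b * y \<le> A * (a * p a + P b - P a)"
proof -
  have E: "b * p a \<le> a * p a + P b - P a" using sub[of a b] by (simp add: algebra_simps)
  have E0: "0 \<le> a * p a + P b - P a"
    using sub[of a 0] sub[of 0 b] P0 p0 by (simp add: algebra_simps)
  have E1: "0 \<le> p a * a"
    using sub[of a 0] sub[of 0 a] P0 p0 by simp
  show ?thesis
  proof (cases "b * y \<le> 0")
    case True
    then show ?thesis using mult_nonneg_nonneg[OF A E0] by linarith
  next
    case False
    then have a: "a \<noteq> 0" using sec by (auto simp: sector_def)
    have "b * y \<le> A * (b * p a)"
    proof (cases "a > 0")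
      case True
      then have y: "p a \<le> y" "y \<le> A * p a"
        using sec by (auto simp: sector_def mult.left_commute[of A])
      have "p a \<ge> 0"
        using E1 True by (simp add: zero_le_mult_iff)
      then have "b > 0" using False y(1) by (auto simp: not_le zero_less_mult_iff)
      with y(2) show ?thesis by (simp add: mult.left_commute[of A])
    next
      case False': False
      with a have "a < 0" by simp
      then have y: "y \<le> p a" "A * p a \<le> y"
        using sec by (auto simp: sector_def mult.left_commute[of A])
      have "p a \<le> 0"
        using E1 \<open>a < 0\<close> by (simp add: zero_le_mult_iff)
      then have "b < 0" using False y(1) by (auto simp: not_le zero_less_mult_iff)
      with y(2) show ?thesis by (simp add: mult.left_commute[of A])
    qed
    also have "\<dots> \<le> A * (a * p a + P b - P a)" by (rule mult_left_mono[OF E A])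
    finally show ?thesis .
  qed
qed

text \<open>The potentials of the shifted and of the unshifted signal have the same integral, so
  integrating the subgradient inequality leaves only the term \<open>w p(w)\<close>.\<close>

lemma sector_shift_bound:
  assumes p: "mono p" "continuous_on UNIV p" "p 0 = 0" and A: "A \<ge> 0"
    and w: "w \<in> L2" and y: "y \<in> L2" and sec: "AE t in lborel. sector p A (w t) (y t)"
    and sgn: "\<sigma> = 1 \<or> \<sigma> = - 1 \<and> odd_fun p"
  shows "\<sigma> * L2_ip (\<lambda>t. w (t - \<tau>)) y \<le> A * L2_ip w y"
proof -
  obtain P where sub: "\<And>a b. p a * (b - a) \<le> P b - P a" and P0: "P 0 = 0"
    and cont: "continuous_on UNIV P" and even: "\<And>x. odd_fun p \<Longrightarrow> P (- x) = P x"
    using convex_potential[OF p(1,2)] by blast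
  note [measurable] = L2_measurable[OF w] L2_measurable[OF y]
    borel_measurable_continuous_onI[OF cont] borel_measurable_continuous_onI[OF p(2)]
  \<comment> \<open>The bounds 0 and \<open>x * p x\<close> on the potential make it integrable
    along \<open>w\<close>.\<close>
  have P_nonneg: "0 \<le> P x" for x using sub[of 0 x] P0 p(3) by simp
  have P_le: "P x \<le> x * p x" for x using sub[of x 0] P0 by (simp add: mult.commute)
  note wy = L2_mult_integrable[OF w y]
  have ipw: "integrable lborel (\<lambda>t. w t * p (w t))"
  proof (rule Bochner_Integration.integrable_bound[OF wy])
    show "AE t in lborel. norm (w t * p (w t)) \<le> norm (w t * y t)"
      using sec
    proof eventually_elim
      case (elim t)
      then show ?case using mono_mult_nonneg[OF p(1,3), of "w t"] unfolding sector_def real_norm_def by linarith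
    qed
  qed measurable
  have iP: "integrable lborel (\<lambda>t. P (w t))"
    by (rule Bochner_Integration.integrable_bound[OF ipw]) (auto simp: P_nonneg intro!: order_trans[OF P_le])
  have iPs: "integrable lborel (\<lambda>t. P (w (t - \<tau>)))" and ePs: "(LINT t|lborel. P (w (t - \<tau>))) = (LINT t|lborel. P (w t))"
    using lborel_integrable_real_affine[OF iP, of 1 "- \<tau>"] lborel_integral_real_affine[of 1 "\<lambda>t. P (w t)" "- \<tau>"] by simp_all
  \<comment> \<open>For odd \<open>p\<close> the potential is even and does not see the sign, so one
    computation serves both \<open>\<sigma> = 1\<close> and \<open>\<sigma> = - 1\<close>.\<close>
  have P\<sigma>: "P (\<sigma> * x) = P x" for x using sgn even by auto
  have "\<sigma> * L2_ip (\<lambda>t. w (t - \<tau>)) y = (LINT t|lborel. \<sigma> * w (t - \<tau>) * y t)"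
    by (simp add: L2_ip_def mult.assoc)
  also have "\<dots> \<le> (LINT t|lborel. A * (w t * p (w t) + P (w (t - \<tau>)) - P (w t)))"
  proof (rule integral_mono_AE)
    show "integrable lborel (\<lambda>t. \<sigma> * w (t - \<tau>) * y t)"
      using L2_mult_integrable[OF L2_cmult[OF L2_shift(1)[OF w]] y] .
    show "integrable lborel (\<lambda>t. A * (w t * p (w t) + P (w (t - \<tau>)) - P (w t)))"
      using ipw iP iPs by simp
    show "AE t in lborel. \<sigma> * w (t - \<tau>) * y t \<le> A * (w t * p (w t) + P (w (t - \<tau>)) - P (w t))"
      using sec
    proof eventually_elim
      case (elim t)
      from sector_subgradient[OF elim A sub P0 p(3), of "\<sigma> * w (t - \<tau>)"] show ?case
        unfolding P\<sigma> by simp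
    qed
  qed
  also have "\<dots> = A * (LINT t|lborel. w t * p (w t))"
    using ipw iP iPs ePs by simp
  also have "\<dots> \<le> A * L2_ip w y"
    unfolding L2_ip_def
  proof (intro mult_left_mono integral_mono_AE ipw wy A)
    show "AE t in lborel. w t * p (w t) \<le> w t * y t"
      using sec by eventually_elim (simp add: sector_def)
  qed
  finally show ?thesis .
qed

lemma Hp_imp_H: "h \<in> Hp_class \<Longrightarrow> h \<in> H_class"
  by (simp add: Hp_class_def)

lemma H_nrm_nonneg: "h \<in> H_class \<Longrightarrow> 0 \<le> H_nrm h"
  unfolding H_nrm_def H_class_def by (auto intro!: add_nonneg_nonneg suminf_nonneg)

text \<open>With nonnegative weights and density the convolution averages shifts, so a bound uniform
  in the shift is multiplied by the total weight. The sign \<open>\<sigma>\<close> distinguishes the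
  two parts of the multiplier.\<close>

lemma L2_ip_conv_op_bound:
  assumes hH: "h \<in> Hp_class" and w: "w \<in> L2" and y: "y \<in> L2"
    and bound: "\<And>\<tau>. \<sigma> * L2_ip (\<lambda>t. w (t - \<tau>)) y \<le> c"
  shows "\<sigma> * L2_ip (conv_op h w) y \<le> H_nrm h * c"
proof -
  interpret conv_kernel h by unfold_locales (rule Hp_imp_H[OF hH])
  have pos: "weight h i \<ge> 0" "dens h t \<ge> 0" for i t
    using hH by (auto simp: Hp_class_def)
  note I = L2_ip_conv_op[OF w y]
  have "\<sigma> * (LINT i|count_space UNIV. weight h i * L2_ip (\<lambda>t. w (t - node h i)) y) = (LINT i|count_space UNIV. \<sigma> * (weight h i * L2_ip (\<lambda>t. w (t - node h i)) y))"
    by (rule integral_mult_right_zero[symmetric])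
  also have "\<dots> \<le> (LINT i|count_space UNIV. \<bar>weight h i\<bar> * c)"
  proof (rule integral_mono[OF integrable_mult_right[OF I(1)]])
    show "integrable (count_space UNIV) (\<lambda>i. \<bar>weight h i\<bar> * c)"
      using atoms.c_integrable by (intro integrable_mult_left integrable_abs)
    show "\<sigma> * (weight h i * L2_ip (\<lambda>t. w (t - node h i)) y) \<le> \<bar>weight h i\<bar> * c" for i
      using mult_left_mono[OF bound[of "node h i"] pos(1)[of i]] pos(1)[of i] by (simp add: mult.left_commute)
  qed
  also have "\<dots> = atoms.mass * c" by (simp add: atoms.mass_def)
  finally have 1: "\<sigma> * (LINT i|count_space UNIV. weight h i * L2_ip (\<lambda>t. w (t - node h i)) y) \<le> atoms.mass * c" .
  have "\<sigma> * (LINT \<tau>|lborel. dens h \<tau> * L2_ip (\<lambda>t. w (t - \<tau>)) y) = (LINT \<tau>|lborel. \<sigma> * (dens h \<tau> * L2_ip (\<lambda>t. w (t - \<tau>)) y))"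
    by (rule integral_mult_right_zero[symmetric])
  also have "\<dots> \<le> (LINT \<tau>|lborel. \<bar>dens h \<tau>\<bar> * c)"
  proof (rule integral_mono[OF integrable_mult_right[OF I(2)]])
    show "integrable lborel (\<lambda>\<tau>. \<bar>dens h \<tau>\<bar> * c)"
      using density.c_integrable by (intro integrable_mult_left integrable_abs)
    show "\<sigma> * (dens h \<tau> * L2_ip (\<lambda>t. w (t - \<tau>)) y) \<le> \<bar>dens h \<tau>\<bar> * c" for \<tau>
      using mult_left_mono[OF bound[of \<tau>] pos(2)[of \<tau>]] pos(2)[of \<tau>] by (simp add: mult.left_commute)
  qed
  also have "\<dots> = density.mass * c" by (simp add: density.mass_def)
  finally show ?thesis
    using 1 unfolding I(3) mass_sum[symmetric] by (simp add: distrib_left distrib_right)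
qed

text \<open>The shift bounds make the inner product at least
  \<open>1 - (A * H_nrm hp + b * H_nrm hm)\<close> times \<open>L2_ip w y\<close>, and both factors
  are nonnegative. The hypotheses on \<open>b\<close> are conditional so as to include an infinite
  \<open>B\<close> together with a vanishing \<open>hm\<close>.\<close>

lemma multiplier_positive:
  assumes p: "mono p" "continuous_on UNIV p" "p 0 = 0"
    and q: "mono q" "continuous_on UNIV q" "q 0 = 0" "odd_fun q"
    and hp: "hp \<in> Hp_class" and hm: "hm \<in> Hp_class"
    and w: "w \<in> L2" and y: "y \<in> L2"
    and A: "A \<ge> 0" "AE t in lborel. sector p A (w t) (y t)"
    and B: "H_nrm hm \<noteq> 0 \<Longrightarrow> b \<ge> 0" "H_nrm hm \<noteq> 0 \<Longrightarrow> AE t in lborel. sector q b (w t) (y t)"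
    and nrm: "A * H_nrm hp + b * H_nrm hm \<le> 1"
  shows "0 \<le> L2_ip (mult_op hp hm w) y"
proof -
  interpret p: conv_kernel hp by unfold_locales (rule Hp_imp_H[OF hp])
  interpret m: conv_kernel hm by unfold_locales (rule Hp_imp_H[OF hm])
  have wy: "0 \<le> L2_ip w y"
    unfolding L2_ip_def
  proof (rule integral_nonneg_AE)
    show "AE t in lborel. 0 \<le> w t * y t"
      using A(2)
    proof eventually_elim
      case (elim t)
      then show ?case using mono_mult_nonneg[OF p(1,3), of "w t"] unfolding sector_def by linarith
    qed
  qed
  have "1 * L2_ip (conv_op hp w) y \<le> H_nrm hp * (A * L2_ip w y)"
    by (rule L2_ip_conv_op_bound[OF hp w y]) (rule sector_shift_bound[OF p A(1) w y A(2)], simp)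
  moreover have "- 1 * L2_ip (conv_op hm w) y \<le> H_nrm hm * (b * L2_ip w y)"
  proof (cases "H_nrm hm = 0")
    \<comment> \<open>The convolution with \<open>hm\<close> then has norm 0, which settles the case
      without a sector bound for \<open>q\<close>.\<close>
    case True
    have "\<bar>L2_ip (conv_op hm w) y\<bar> \<le> L2_nrm (conv_op hm w) * L2_nrm y"
      by (rule L2_ip_bound[OF m.conv_op_L2(1)[OF w] y])
    also have "L2_nrm (conv_op hm w) = 0"
      using m.conv_op_L2(2)[OF w] True by (intro antisym) auto
    finally show ?thesis using True by simp
  next
    case False
    show ?thesis
      by (rule L2_ip_conv_op_bound[OF hm w y]) (rule sector_shift_bound[OF q(1-3) B(1)[OF False] w y B(2)[OF False]], use q(4) in simp)
  qed
  moreover have "L2_ip (mult_op hp hm w) y = L2_ip w y - L2_ip (conv_op hp w) y + L2_ip (conv_op hm w) y"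
    unfolding mult_op_def
    by (simp add: L2_ip_add_left L2_ip_diff_left L2_diff w y p.conv_op_L2(1)[OF w] m.conv_op_L2(1)[OF w])
  moreover have "0 \<le> (1 - (A * H_nrm hp + b * H_nrm hm)) * L2_ip w y"
    using nrm wy by (intro mult_nonneg_nonneg) auto
  ultimately show ?thesis by (simp add: algebra_simps)
qed

section \<open>Loop-shifted slope-restricted functions\<close>

context
  fixes f :: "real \<Rightarrow> real" and s k :: real
  assumes slope: "slope_restricted f s" and sk: "s < k" and f0: "f 0 = 0"
begin

lemma slope_bounds:
  assumes "y \<le> x" shows "0 \<le> f x - f y" "f x - f y \<le> s * (x - y)"
proof -
  have "0 \<le> (f x - f y) / (x - y)" "(f x - f y) / (x - y) \<le> s" if "y < x"
    using slope that by (auto simp: slope_restricted_def)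
  then show "0 \<le> f x - f y" "f x - f y \<le> s * (x - y)"
    using assms by (cases "y = x"; simp add: pos_divide_le_eq zero_le_divide_iff)+
qed

lemma slope_nonneg: "0 \<le> s"
  using slope_bounds[of 0 1] by simp

lemma k_pos: "0 < k"
  using slope_nonneg sk by simp

lemma shift_arg_mono:
  assumes "y < x" shows "(1 - s / k) * (x - y) \<le> (x - f x / k) - (y - f y / k)" "y - f y / k < x - f x / k"
proof -
  have "(f x - f y) / k \<le> s * (x - y) / k"
    using slope_bounds(2)[of y x] assms k_pos by (intro divide_right_mono) auto
  then show 1: "(1 - s / k) * (x - y) \<le> (x - f x / k) - (y - f y / k)"
    by (simp add: algebra_simps diff_divide_distrib)
  have "0 < (1 - s / k) * (x - y)" using assms sk k_pos by simp
  with 1 show "y - f y / k < x - f x / k" by linarith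
qed

lemma obtain_shift_arg:
  obtains x where "w = x - f x / k" "loop_shift k f w = f x"
proof -
  obtain x where "w = x - f x / k"
    using surjD[OF bij_is_surj[OF bij_loop_shift_arg[OF slope sk]], of w] by blast
  then show thesis using that loop_shift_apply[OF slope sk] by blast
qed

lemma loop_shift_0: "loop_shift k f 0 = 0"
  using loop_shift_apply[OF slope sk, of 0] f0 by simp

text \<open>The map \<open>x - f x / k\<close> has slope at least \<open>1 - s / k\<close>, so its
  inverse has slope at most the reciprocal; composition with \<open>f\<close> contributes the factor
  \<open>s\<close>.\<close>

lemma loop_shift_diff:
  assumes "v \<le> w"
  shows "0 \<le> loop_shift k f w - loop_shift k f v" "loop_shift k f w - loop_shift k f v \<le> s / (1 - s / k) * (w - v)"
proof -
  obtain x where x: "w = x - f x / k" "loop_shift k f w = f x" by (rule obtain_shift_arg)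
  obtain y where y: "v = y - f y / k" "loop_shift k f v = f y" by (rule obtain_shift_arg)
  have yx: "y \<le> x"
    using shift_arg_mono(2)[of x y] assms x(1) y(1) by (cases "x < y") auto
  then show "0 \<le> loop_shift k f w - loop_shift k f v"
    using slope_bounds(1) x(2) y(2) by simp
  have c: "0 < 1 - s / k" using sk k_pos by simp
  have "(1 - s / k) * (x - y) \<le> w - v"
    using shift_arg_mono(1)[of y x] yx x(1) y(1) by (cases "y = x") auto
  then have "x - y \<le> (w - v) / (1 - s / k)"
    using c by (simp add: pos_le_divide_eq mult.commute)
  then have "s * (x - y) \<le> s * ((w - v) / (1 - s / k))"
    using slope_nonneg by (rule mult_left_mono)
  with slope_bounds(2)[OF yx] show "loop_shift k f w - loop_shift k f v \<le> s / (1 - s / k) * (w - v)"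
    using x(2) y(2) by simp
qed

lemma mono_loop_shift: "mono (loop_shift k f)"
  using loop_shift_diff(1) by (intro monoI) fastforce

lemma continuous_loop_shift: "continuous_on UNIV (loop_shift k f)"
proof -
  have c: "0 < 1 - s / k" using sk k_pos by simp
  have "dist (loop_shift k f x) (loop_shift k f y) \<le> s / (1 - s / k) * dist x y" for x y
    using loop_shift_diff[of x y] loop_shift_diff[of y x]
    by (cases "x \<le> y") (auto simp: dist_real_def abs_if)
  then have "(s / (1 - s / k))-lipschitz_on UNIV (loop_shift k f)"
    using c slope_nonneg by (intro lipschitz_onI) auto
  then show ?thesis by (rule lipschitz_on_continuous_on)
qed

lemma loop_shift_linear_bound: "\<bar>loop_shift k f w\<bar> \<le> s / (1 - s / k) * \<bar>w\<bar>"
  using loop_shift_diff[of 0 w] loop_shift_diff[of w 0] loop_shift_0 by (cases "0 \<le> w") auto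

lemma odd_loop_shift: "odd_fun f \<Longrightarrow> odd_fun (loop_shift k f)"
  unfolding odd_fun_def
proof
  fix w assume f: "\<forall>x. f (- x) = - f x"
  obtain x where x: "w = x - f x / k" "loop_shift k f w = f x" by (rule obtain_shift_arg)
  have "loop_shift k f (- w) = loop_shift k f (- x - f (- x) / k)" using x(1) f by simp
  also have "\<dots> = - f x" using loop_shift_apply[OF slope sk, of "- x"] f by simp
  finally show "loop_shift k f (- w) = - loop_shift k f w" using x(2) by simp
qed

text \<open>Let \<open>x'\<close> be the preimage of \<open>x - y / k\<close> and suppose
  \<open>f x' < y\<close>. Then \<open>k * (x - x') = y - f x'\<close> is positive but at most
  \<open>s * (x - x')\<close>, contradicting \<open>s < k\<close>.\<close>

lemma loop_shift_upper:
  assumes "y \<le> f x" shows "y \<le> loop_shift k f (x - y / k)"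
proof (rule ccontr)
  obtain x' where x': "x - y / k = x' - f x' / k" "loop_shift k f (x - y / k) = f x'" by (rule obtain_shift_arg)
  assume "\<not> ?thesis"
  then have "f x' < y" using x'(2) by simp
  moreover have eq: "k * (x - x') = y - f x'" using x'(1) k_pos by (simp add: field_simps)
  ultimately have "0 < k * (x - x')" by simp
  then have pos: "x' < x" using k_pos by (simp add: zero_less_mult_iff)
  have "y - f x' \<le> s * (x - x')" using slope_bounds(2)[of x' x] pos assms by simp
  moreover have "s * (x - x') < k * (x - x')" using sk pos by simp
  ultimately show False using eq by simp
qed

lemma loop_shift_lower:
  assumes "f x \<le> y" shows "loop_shift k f (x - y / k) \<le> y"
proof (rule ccontr)
  obtain x' where x': "x - y / k = x' - f x' / k" "loop_shift k f (x - y / k) = f x'" by (rule obtain_shift_arg)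
  assume "\<not> ?thesis"
  then have "y < f x'" using x'(2) by simp
  moreover have eq: "k * (x' - x) = f x' - y" using x'(1) k_pos by (simp add: field_simps)
  ultimately have "0 < k * (x' - x)" by simp
  then have pos: "x < x'" using k_pos by (simp add: zero_less_mult_iff)
  have "f x' - y \<le> s * (x' - x)" using slope_bounds(2)[of x x'] pos assms by simp
  moreover have "s * (x' - x) < k * (x' - x)" using sk pos by simp
  ultimately show False using eq by simp
qed

end

text \<open>\<open>loop_shift_lower\<close> and \<open>loop_shift_upper\<close> carry the bounds on
  \<open>y\<close> from \<open>x\<close> over to \<open>w = x - y / k\<close>. As \<open>h\<close>
  has slope below \<open>k\<close>, \<open>w\<close> keeps the sign of \<open>x\<close>, and the
  assumption on \<open>A\<close> then compares the two shifted bounds at \<open>w\<close>.\<close>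

lemma loop_shift_sector:
  assumes l: "slope_restricted l s" "l 0 = 0" and h: "slope_restricted h s" "h 0 = 0" and sk: "s < k"
    and A: "bounded_above_by (loop_shift k h) (\<lambda>x. A * loop_shift k l x)"
    and x: "x \<noteq> 0" "l x / x \<le> y / x" "y / x \<le> h x / x"
  shows "sector (loop_shift k l) A (x - y / k) y"
proof -
  let ?w = "x - y / k"
  note L = l(1) sk l(2) and H = h(1) sk h(2)
  have k: "k > 0" by (rule k_pos[OF L])
  have up: "loop_shift k h v / v \<le> A * loop_shift k l v / v" if "v \<noteq> 0" for v
    using A that by (simp add: bounded_above_by_def)
  show ?thesis
  proof (cases "x > 0")
    case True
    then have y: "l x \<le> y" "y \<le> h x" using x by (auto simp: divide_le_cancel)
    have "0 < x - h x / k" using shift_arg_mono(2)[OF H, of 0 x] True h(2) by simp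
    moreover have "y / k \<le> h x / k" using y(2) k by (simp add: divide_right_mono)
    ultimately have w: "0 < ?w" by linarith
    have 1: "loop_shift k l ?w \<le> y" by (rule loop_shift_lower[OF L y(1)])
    have "y \<le> loop_shift k h ?w" by (rule loop_shift_upper[OF H y(2)])
    also have "\<dots> \<le> A * loop_shift k l ?w" using up[of ?w] w by (simp add: divide_le_cancel)
    finally have 2: "y \<le> A * loop_shift k l ?w" .
    show ?thesis
      using mult_left_mono[OF 1, of ?w] mult_left_mono[OF 2, of ?w] w
      unfolding sector_def by (simp add: mult.left_commute[of A])
  next
    case False
    then have neg: "x < 0" using x(1) by simp
    then have y: "y \<le> l x" "h x \<le> y" using x by (auto simp: divide_le_cancel)
    have "x - h x / k < 0" using shift_arg_mono(2)[OF H, of x 0] neg h(2) by simp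
    moreover have "h x / k \<le> y / k" using y(2) k by (simp add: divide_right_mono)
    ultimately have w: "?w < 0" by linarith
    have 1: "y \<le> loop_shift k l ?w" by (rule loop_shift_upper[OF L y(1)])
    have "A * loop_shift k l ?w \<le> loop_shift k h ?w" using up[of ?w] w by (simp add: divide_le_cancel)
    also have "\<dots> \<le> y" by (rule loop_shift_lower[OF H y(2)])
    finally have 2: "A * loop_shift k l ?w \<le> y" .
    show ?thesis
      using mult_left_mono_neg[OF 1, of ?w] mult_left_mono_neg[OF 2, of ?w] w
      unfolding sector_def by (simp add: mult.left_commute[of A])
  qed
qed

text \<open>Here \<open>f\<close> and \<open>l\<close> are the lower bounds of different families,
  while \<open>h\<close> belongs to the family of \<open>l\<close>. The result is used to find a
  value that lies in both sectors at once.\<close>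

lemma loop_shift_cross:
  assumes f: "slope_restricted f s" "f 0 = 0" and l: "slope_restricted l s" "l 0 = 0"
    and h: "slope_restricted h s" "h 0 = 0" and sk: "s < k"
    and A: "bounded_above_by (loop_shift k h) (\<lambda>x. A * loop_shift k l x)"
    and le: "\<And>x. x \<noteq> 0 \<Longrightarrow> f x / x \<le> h x / x"
  shows "w * loop_shift k f w \<le> A * (w * loop_shift k l w)"
proof -
  obtain x where x: "w = x - f x / k" "loop_shift k f w = f x"
    by (rule obtain_shift_arg[OF f(1) sk f(2)])
  have up: "loop_shift k h w / w \<le> A * loop_shift k l w / w" if "w \<noteq> 0"
    using A that by (simp add: bounded_above_by_def)
  consider "x = 0" | "x > 0" | "x < 0" by linarith
  then show ?thesis
  proof cases
    case 1
    then show ?thesis using x f(2) by simp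
  next
    case 2
    then have w: "0 < w" using shift_arg_mono(2)[OF f(1) sk f(2), of 0 x] f(2) x(1) by simp
    have "f x \<le> h x" using le[of x] 2 by (simp add: divide_le_cancel)
    from loop_shift_upper[OF h(1) sk h(2) this] have "f x \<le> loop_shift k h w" using x(1) by simp
    also have "\<dots> \<le> A * loop_shift k l w" using up w by (simp add: divide_le_cancel)
    finally show ?thesis
      using mult_left_mono[of "f x" "A * loop_shift k l w" w] w x(2) by (simp add: mult.left_commute[of A])
  next
    case 3
    then have w: "w < 0" using shift_arg_mono(2)[OF f(1) sk f(2), of x 0] f(2) x(1) by simp
    have "h x \<le> f x" using le[of x] 3 by (simp add: divide_le_cancel)
    from loop_shift_lower[OF h(1) sk h(2) this] have "loop_shift k h w \<le> f x" using x(1) by simp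
    moreover have "A * loop_shift k l w \<le> loop_shift k h w" using up w by (simp add: divide_le_cancel)
    ultimately have "A * loop_shift k l w \<le> f x" by simp
    then show ?thesis
      using mult_left_mono_neg[of "A * loop_shift k l w" "f x" w] w x(2) by (simp add: mult.left_commute[of A])
  qed
qed

section \<open>Stability\<close>

definition tail :: "real \<Rightarrow> signal \<Rightarrow> signal" where
  "tail T x = (\<lambda>t. if t \<le> T then 0 else x t)"

lemma tail_L2:
  assumes "x \<in> L2" shows "tail T x \<in> L2" "L2_nrm (tail T x) \<le> L2_nrm x"
proof -
  have "tail T x = (\<lambda>t. x t - trunc T x t)" by (auto simp: tail_def trunc_def)
  then have "tail T x \<in> borel_measurable borel"
    using L2_measurable[OF L2_diff[OF assms L2_trunc(1)[OF assms]]] by simp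
  from L2_dominated[OF assms this] show "tail T x \<in> L2" "L2_nrm (tail T x) \<le> L2_nrm x"
    by (auto simp: tail_def)
qed

lemma L2_ip_tail:
  assumes x: "x \<in> L2" and d: "d \<in> L2" and zero: "AE t in lborel. t \<le> T \<longrightarrow> d t = 0"
  shows "\<bar>L2_ip x d\<bar> \<le> L2_nrm (tail T x) * L2_nrm d"
proof -
  have "L2_ip x d = L2_ip (tail T x) d"
    unfolding L2_ip_def
  proof (rule integral_cong_AE)
    show "AE t in lborel. x t * d t = tail T x t * d t"
      using zero by eventually_elim (auto simp: tail_def)
  qed (use L2_mult_integrable[OF x d] L2_mult_integrable[OF tail_L2(1)[OF x] d] in auto)
  then show ?thesis using L2_ip_bound[OF tail_L2(1)[OF x] d] by simp
qed

text \<open>Neumann iteration for the compression of \<open>1 - N\<close> to signals supported after time \<open>T\<close>.\<close>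

lemma compression_solve:
  assumes N: "L2_bounded_linear N q" and q: "0 \<le> q" "q < 1" and x: "x \<in> L2" and d: "0 < \<delta>"
  obtains x' where "x' \<in> L2" "trunc T x' = trunc T x" "L2_nrm x' \<le> L2_nrm (trunc T x) / (1 - q)"
    "L2_nrm (tail T (\<lambda>t. x' t - N x' t)) \<le> \<delta>"
proof -
  \<comment> \<open>Iteration for the equation \<open>X = trunc T x + tail T (N X)\<close>, whose
    solution keeps the past of \<open>x\<close> and makes \<open>X - N X\<close> vanish after
    \<open>T\<close>. A late iterate solves it up to \<open>\<delta>\<close>.\<close>
  define X where "X = rec_nat (trunc T x) (\<lambda>_ y t. trunc T x t + tail T (N y) t)"
  have X0: "X 0 = trunc T x" and XS: "X (Suc n) = (\<lambda>t. trunc T x t + tail T (N (X n)) t)" for n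
    by (simp_all add: X_def)
  note x0 = L2_trunc(1)[OF x, of T]
  have XL: "X n \<in> L2" for n
    by (induction n) (auto simp: X0 XS intro!: L2_add x0 tail_L2 L2_bounded_linearD(1)[OF N])
  have XT: "trunc T (X n) = trunc T x" for n
    by (cases n) (auto simp: X0 XS trunc_def tail_def)
  \<comment> \<open>With \<open>a\<close> the norm of \<open>trunc T x\<close>, the number
    \<open>a / (1 - q)\<close> is the fixed point of \<open>a + q * r\<close> in \<open>r\<close>,
    so the bound reproduces itself.\<close>
  have bound: "L2_nrm (X n) \<le> L2_nrm (trunc T x) / (1 - q)" for n
  proof (induction n)
    case 0
    have "L2_nrm (trunc T x) * (1 - q) \<le> L2_nrm (trunc T x)"
      using q by (intro mult_left_le) auto
    then show ?case using q by (simp add: X0 pos_le_divide_eq)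
  next
    case (Suc n)
    have "L2_nrm (X (Suc n)) \<le> L2_nrm (trunc T x) + L2_nrm (tail T (N (X n)))"
      unfolding XS by (intro L2_nrm_triangle x0 tail_L2 L2_bounded_linearD(1)[OF N] XL)
    also have "\<dots> \<le> L2_nrm (trunc T x) + q * L2_nrm (X n)"
      using tail_L2(2)[OF L2_bounded_linearD(1)[OF N XL]] L2_bounded_linearD(2)[OF N XL] by (meson add_left_mono order_trans)
    also have "\<dots> \<le> L2_nrm (trunc T x) + q * (L2_nrm (trunc T x) / (1 - q))"
      using Suc q by (intro add_left_mono mult_left_mono) auto
    also have "\<dots> = L2_nrm (trunc T x) / (1 - q)"
      using q by (simp add: field_simps)
    finally show ?case .
  qed
  define E where "E = (\<lambda>n t. X (Suc n) t - X n t)"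
  have EL: "E n \<in> L2" for n unfolding E_def by (intro L2_diff XL)
  have Ebound: "L2_nrm (E n) \<le> q ^ n * L2_nrm (E 0)" for n
  proof (induction n)
    case (Suc n)
    have ET: "E (Suc n) = tail T (\<lambda>t. N (X (Suc n)) t - N (X n) t)"
      unfolding E_def XS[of "Suc n"] by (subst (2) XS) (auto simp: tail_def)
    have "L2_nrm (E (Suc n)) \<le> L2_nrm (\<lambda>t. N (X (Suc n)) t - N (X n) t)"
      unfolding ET by (intro tail_L2 L2_diff L2_bounded_linearD(1)[OF N] XL)
    also have "\<dots> \<le> q * L2_nrm (E n)"
      unfolding E_def by (rule L2_bounded_linear_dist[OF N XL XL])
    also have "\<dots> \<le> q * (q ^ n * L2_nrm (E 0))"
      using Suc q by (intro mult_left_mono) auto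
    finally show ?case by simp
  qed simp
  have "(\<lambda>n. q ^ n * L2_nrm (E 0)) \<longlonglongrightarrow> 0 * L2_nrm (E 0)"
    using q by (intro tendsto_mult LIMSEQ_power_zero tendsto_const) auto
  then have "\<forall>\<^sub>F n in sequentially. q ^ n * L2_nrm (E 0) < \<delta>"
    using d by (intro order_tendstoD(2)) auto
  then obtain n where n: "q ^ n * L2_nrm (E 0) < \<delta>"
    by (auto simp: eventually_sequentially)
  \<comment> \<open>The residual after \<open>T\<close> is minus the next increment, which decays
    geometrically.\<close>
  have "tail T (\<lambda>t. X n t - N (X n) t) = (\<lambda>t. -1 * E n t)"
  proof
    fix t
    have "X n t = trunc T x t" if "t \<le> T" using XT[of n] that by (metis trunc_def)
    then show "tail T (\<lambda>t. X n t - N (X n) t) t = -1 * E n t"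
      unfolding E_def XS by (auto simp: tail_def trunc_def)
  qed
  then have "L2_nrm (tail T (\<lambda>t. X n t - N (X n) t)) = L2_nrm (E n)"
    using L2_nrm_cmult[of "-1" "E n"] by simp
  then have "L2_nrm (tail T (\<lambda>t. X n t - N (X n) t)) \<le> \<delta>"
    using Ebound[of n] n by simp
  from that[OF XL XT bound this] show thesis .
qed

text \<open>The signals \<open>w\<close> and \<open>y\<close> are extended beyond \<open>T\<close> so that \<open>M w'\<close> and \<open>M\<^sup>* z\<close> are almost
  supported before \<open>T\<close>. This plays the role of a causal/anticausal factorization of \<open>M\<close>.\<close>

lemma truncated_bound:
  assumes hp: "hp \<in> H_class" and hm: "hm \<in> H_class" and q: "H_nrm hp + H_nrm hm < 1"
    and G: "L2_bounded_linear G C"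
    and caus: "\<And>z. z \<in> L2 \<Longrightarrow> trunc T z = trunc T y \<Longrightarrow> AE t in lborel. t \<le> T \<longrightarrow> G z t = G y t"
    and coercive: "\<And>z. z \<in> L2 \<Longrightarrow> \<epsilon> * L2_ip z z \<le> L2_ip (\<lambda>t. z t + k * G z t) (mult_op (reflect hp) (reflect hm) z)"
    and pos: "\<And>w y. w \<in> L2 \<Longrightarrow> y \<in> L2 \<Longrightarrow> AE t in lborel. R (w t) (y t) \<Longrightarrow> 0 \<le> L2_ip (mult_op hp hm w) y"
    and \<psi>: "\<And>v. R v (\<psi> v)" "\<psi> \<in> borel_measurable borel" "\<And>v. \<bar>\<psi> v\<bar> \<le> c * \<bar>v\<bar>"
    and k: "0 < k" and \<epsilon>: "0 < \<epsilon>"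
    and f: "f \<in> L2" and y: "y \<in> L2e" and w: "w \<in> L2e"
    and w_eq: "w =ae (\<lambda>t. f t - (y t + k * G y t) / k)"
    and R: "AE t in lborel. R (w t) (y t)"
  shows "L2_nrm (trunc T y) \<le> 2 * L2_nrm f * k / \<epsilon>"
proof (rule ccontr)
  define q where "q = H_nrm hp + H_nrm hm"
  define Y where "Y = L2_nrm (trunc T y)"
  define F where "F = L2_nrm f"
  define W where "W = L2_nrm (trunc T w)"
  define Cw where "Cw = W / (1 - q)"
  define Cz where "Cz = Y / (1 - q)"
  \<comment> \<open>\<open>Cd\<close> bounds the norms of the two corrections that get multiplied by
    \<open>\<delta>\<close>: the first two summands belong to \<open>y' - z\<close>, the rest to
    \<open>w' - v\<close>.\<close>
  define Cd where "Cd = (Y + \<bar>c\<bar> * Cw) + Cz + (Cw + (F + (Cz + k * (\<bar>C\<bar> * Cz)) / k))"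
  define e where "e = \<epsilon> / k"
  \<comment> \<open>\<open>m\<close> is the value of \<open>r * (e * r - 2 * F)\<close> at
    \<open>r = Y\<close>, positive under the negated claim. The choice of \<open>\<delta>\<close>
    makes the total error \<open>\<delta> * Cd\<close> smaller than \<open>m\<close>.\<close>
  define m where "m = Y * (e * Y - 2 * F)"
  define \<delta> where "\<delta> = m / (Cd + 1)"
  assume "\<not> ?thesis"
  then have "2 * F * k / \<epsilon> < Y" by (simp add: Y_def F_def)
  then have "2 * F < e * Y" using k \<epsilon> by (simp add: e_def field_simps)
  have e: "0 < e" using k \<epsilon> by (simp add: e_def)
  have F0: "0 \<le> F" and Y0: "0 \<le> Y" and W0: "0 \<le> W" by (simp_all add: F_def Y_def W_def)
  have Yp: "0 < Y" using \<open>2 * F < e * Y\<close> F0 e Y0 by (cases "Y = 0") auto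
  have m: "0 < m" unfolding m_def using Yp \<open>2 * F < e * Y\<close> by simp
  have q0: "0 \<le> q" and q1: "q < 1" using H_nrm_nonneg[OF hp] H_nrm_nonneg[OF hm] q by (simp_all add: q_def)
  have Cw0: "0 \<le> Cw" and Cz0: "0 \<le> Cz" using W0 Y0 q1 by (simp_all add: Cw_def Cz_def)
  have Cd0: "0 \<le> Cd" unfolding Cd_def using Y0 Cw0 Cz0 F0 k by simp
  have \<delta>: "0 < \<delta>" using m Cd0 by (simp add: \<delta>_def)
  note rH = reflect_H_class[OF hp] reflect_H_class[OF hm]
  have N: "L2_bounded_linear (off_op hp hm) q" unfolding q_def by (rule off_op_blin[OF hp hm])
  have N': "L2_bounded_linear (off_op (reflect hp) (reflect hm)) q"
    using off_op_blin[OF rH] by (simp add: q_def H_nrm_reflect)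
  let ?M = "mult_op hp hm" and ?M' = "mult_op (reflect hp) (reflect hm)"
  note [measurable] = L2e_measurable[OF y] \<psi>(2)
  have yT: "trunc T y \<in> L2" and wT: "trunc T w \<in> L2" using y w by (auto simp: L2e_def)
  have idem: "trunc T (trunc T x) = trunc T x" for x by (auto simp: trunc_def)
  obtain w' where w': "w' \<in> L2" "trunc T w' = trunc T w" "L2_nrm w' \<le> Cw"
    and Mw': "L2_nrm (tail T (?M w')) \<le> \<delta>"
    using compression_solve[OF N q0 q1 wT \<delta>, of T] unfolding idem mult_op_off Cw_def W_def by blast
  obtain z where z: "z \<in> L2" "trunc T z = trunc T y" "L2_nrm z \<le> Cz"
    and Mz: "L2_nrm (tail T (?M' z)) \<le> \<delta>"
    using compression_solve[OF N' q0 q1 yT \<delta>, of T] unfolding idem mult_op_off Cz_def Y_def by blast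
  have w'T: "w' t = w t" and zT: "z t = y t" if "t \<le> T" for t
    using fun_cong[OF w'(2), of t] fun_cong[OF z(2), of t] that by (simp_all add: trunc_def)
  note [measurable] = L2_measurable[OF w'(1)]
  note MwL = L2_bounded_linearD(1)[OF mult_op_blin[OF hp hm] w'(1)]
  note MzL = L2_bounded_linearD(1)[OF mult_op_blin[OF rH] z(1)]
  \<comment> \<open>Up to \<open>T\<close> this is \<open>y\<close>; afterwards it follows the
    static selection \<open>\<psi>\<close> of the relation \<open>R\<close>. Hence \<open>w'\<close>
    and \<open>y'\<close> are related at almost every time and \<open>pos\<close> applies to
    them.\<close>
  define y' where "y' = (\<lambda>t. trunc T y t + tail T (\<lambda>t. \<psi> (w' t)) t)"
  have \<psi>w: "(\<lambda>t. \<psi> (w' t)) \<in> L2" "L2_nrm (\<lambda>t. \<psi> (w' t)) \<le> \<bar>c\<bar> * L2_nrm w'"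
  proof -
    have "\<bar>\<psi> (w' t)\<bar> \<le> \<bar>\<bar>c\<bar> * w' t\<bar>" for t
      using \<psi>(3)[of "w' t"] mult_right_mono[OF abs_ge_self[of c], of "\<bar>w' t\<bar>"] by (simp add: abs_mult)
    then show "(\<lambda>t. \<psi> (w' t)) \<in> L2" "L2_nrm (\<lambda>t. \<psi> (w' t)) \<le> \<bar>c\<bar> * L2_nrm w'"
      using L2_dominated[OF L2_cmult[OF w'(1), of "\<bar>c\<bar>"], of "\<lambda>t. \<psi> (w' t)"]
      unfolding L2_nrm_cmult by (simp_all del: abs_mult)
  qed
  have y'L: "y' \<in> L2" unfolding y'_def by (intro L2_add yT tail_L2 \<psi>w)
  have y'n: "L2_nrm y' \<le> Y + \<bar>c\<bar> * Cw"
  proof -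
    have "L2_nrm y' \<le> Y + L2_nrm (tail T (\<lambda>t. \<psi> (w' t)))"
      unfolding y'_def Y_def by (intro L2_nrm_triangle yT tail_L2 \<psi>w)
    also have "L2_nrm (tail T (\<lambda>t. \<psi> (w' t))) \<le> \<bar>c\<bar> * L2_nrm w'"
      using tail_L2(2)[OF \<psi>w(1)] \<psi>w(2) by (rule order_trans)
    also have "\<dots> \<le> \<bar>c\<bar> * Cw" using w'(3) by (intro mult_left_mono) auto
    finally show ?thesis by simp
  qed
  have "AE t in lborel. R (w' t) (y' t)"
    using R
  proof eventually_elim
    case (elim t)
    then show ?case using w'T[of t] \<psi>(1)[of "w' t"] by (simp add: y'_def trunc_def tail_def)
  qed
  from pos[OF w'(1) y'L this] have "0 \<le> L2_ip (?M w') y'" .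
  moreover have "L2_ip (?M w') y' = L2_ip (?M w') z + L2_ip (?M w') (\<lambda>t. y' t - z t)"
    by (simp add: L2_ip_diff_right MwL y'L z(1))
  \<comment> \<open>\<open>y'\<close> and \<open>z\<close> agree up to \<open>T\<close>, so only the
    tail of \<open>?M w'\<close> contributes, and it has norm at most
    \<open>\<delta>\<close>.\<close>
  moreover have "L2_ip (?M w') (\<lambda>t. y' t - z t) \<le> \<delta> * ((Y + \<bar>c\<bar> * Cw) + Cz)"
  proof -
    have "\<bar>L2_ip (?M w') (\<lambda>t. y' t - z t)\<bar> \<le> L2_nrm (tail T (?M w')) * L2_nrm (\<lambda>t. y' t - z t)"
      by (rule L2_ip_tail[OF MwL L2_diff[OF y'L z(1)]]) (use zT in \<open>auto simp: y'_def trunc_def tail_def\<close>)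
    also have "\<dots> \<le> \<delta> * ((Y + \<bar>c\<bar> * Cw) + Cz)"
      using L2_nrm_triangle_diff[OF y'L z(1)] y'n z(3) Mw' \<delta> by (intro mult_mono) auto
    finally show ?thesis by simp
  qed
  moreover have "L2_ip (?M w') z = L2_ip w' (?M' z)"
    by (rule mult_op_adjoint[OF hp hm w'(1) z(1)])
  ultimately have 1: "0 \<le> L2_ip w' (?M' z) + \<delta> * ((Y + \<bar>c\<bar> * Cw) + Cz)" by linarith
  \<comment> \<open>The loop equation for \<open>w\<close> with \<open>z\<close> in place of
    \<open>y\<close>. By causality \<open>v\<close> agrees with \<open>w\<close>, and so with
    \<open>w'\<close>, up to \<open>T\<close>.\<close>
  define v where "v = (\<lambda>t. f t - (z t + k * G z t) / k)"
  note Gz = L2_bounded_linearD(1,2)[OF G z(1)]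
  have KL: "(\<lambda>t. z t + k * G z t) \<in> L2" by (intro L2_add L2_cmult z Gz)
  have vL: "v \<in> L2" unfolding v_def by (intro L2_diff L2_divide f KL)
  have vn: "L2_nrm v \<le> F + (Cz + k * (\<bar>C\<bar> * Cz)) / k"
  proof -
    have "L2_nrm (G z) \<le> \<bar>C\<bar> * Cz"
      using Gz(2) mult_mono[OF abs_ge_self[of C] z(3)] by simp
    then have "k * L2_nrm (G z) \<le> k * (\<bar>C\<bar> * Cz)" using k by simp
    moreover have "L2_nrm (\<lambda>t. z t + k * G z t) \<le> L2_nrm z + k * L2_nrm (G z)"
      using L2_nrm_triangle[OF z(1) L2_cmult[OF Gz(1)], of k] k by (simp add: L2_nrm_cmult)
    ultimately have "L2_nrm (\<lambda>t. z t + k * G z t) \<le> Cz + k * (\<bar>C\<bar> * Cz)" using z(3) by linarith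
    then have "L2_nrm (\<lambda>t. (z t + k * G z t) / k) \<le> (Cz + k * (\<bar>C\<bar> * Cz)) / k"
      unfolding L2_nrm_divide using k by (simp add: divide_right_mono)
    moreover have "L2_nrm v \<le> F + L2_nrm (\<lambda>t. (z t + k * G z t) / k)"
      unfolding v_def F_def by (intro L2_nrm_triangle_diff f L2_divide KL)
    ultimately show ?thesis by linarith
  qed
  have "L2_ip w' (?M' z) = L2_ip v (?M' z) + L2_ip (\<lambda>t. w' t - v t) (?M' z)"
    by (simp add: L2_ip_diff_left MzL w'(1) vL)
  moreover have "L2_ip (\<lambda>t. w' t - v t) (?M' z) \<le> \<delta> * (Cw + (F + (Cz + k * (\<bar>C\<bar> * Cz)) / k))"
  proof -
    have "AE t in lborel. t \<le> T \<longrightarrow> w' t - v t = 0"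
      using w_eq caus[OF z(1,2)]
    proof eventually_elim
      case (elim t)
      then show ?case using w'T[of t] zT[of t] by (simp add: v_def)
    qed
    from L2_ip_tail[OF MzL L2_diff[OF w'(1) vL] this]
    have "\<bar>L2_ip (\<lambda>t. w' t - v t) (?M' z)\<bar> \<le> L2_nrm (tail T (?M' z)) * L2_nrm (\<lambda>t. w' t - v t)"
      by (simp add: L2_ip_commute)
    also have "\<dots> \<le> \<delta> * (Cw + (F + (Cz + k * (\<bar>C\<bar> * Cz)) / k))"
      using L2_nrm_triangle_diff[OF w'(1) vL] w'(3) vn Mz \<delta> by (intro mult_mono) auto
    finally show ?thesis by simp
  qed
  \<comment> \<open>Coercivity supplies the quadratic term; the factor 2 bounds the norm of the
    adjoint multiplier, which is at most \<open>1 + q\<close>.\<close>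
  moreover have "L2_ip v (?M' z) \<le> 2 * F * L2_nrm z - e * (L2_nrm z)\<^sup>2"
  proof -
    have "L2_ip v (?M' z) = L2_ip f (?M' z) - L2_ip (\<lambda>t. inverse k * (z t + k * G z t)) (?M' z)"
      unfolding v_def using L2_divide[OF KL, of k]
      by (simp add: L2_ip_diff_left f MzL divide_inverse_commute)
    also have "\<dots> = L2_ip f (?M' z) - L2_ip (\<lambda>t. z t + k * G z t) (?M' z) / k"
      by (simp only: L2_ip_cmult_left divide_inverse_commute)
    also have "\<dots> \<le> F * (2 * L2_nrm z) - \<epsilon> * L2_ip z z / k"
    proof (rule diff_mono)
      have "L2_nrm (?M' z) \<le> (1 + H_nrm hp + H_nrm hm) * L2_nrm z"
        using L2_bounded_linearD(2)[OF mult_op_blin[OF rH] z(1)] by (simp add: H_nrm_reflect)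
      also have "\<dots> \<le> 2 * L2_nrm z" using q by (intro mult_right_mono) auto
      finally have "F * L2_nrm (?M' z) \<le> F * (2 * L2_nrm z)" using F0 by (rule mult_left_mono)
      then show "L2_ip f (?M' z) \<le> F * (2 * L2_nrm z)"
        using L2_ip_bound[OF f MzL] unfolding F_def by linarith
      show "\<epsilon> * L2_ip z z / k \<le> L2_ip (\<lambda>t. z t + k * G z t) (?M' z) / k"
        using coercive[OF z(1)] k by (simp add: divide_right_mono)
    qed
    finally show ?thesis by (simp add: e_def L2_nrm_power2)
  qed
  ultimately have "e * (L2_nrm z)\<^sup>2 - 2 * F * L2_nrm z \<le> \<delta> * Cd"
    using 1 unfolding Cd_def by (simp add: distrib_left)
  \<comment> \<open>\<open>z\<close> extends the truncation of \<open>y\<close>, so its norm is at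
    least \<open>Y\<close>; from there on \<open>r * (e * r - 2 * F)\<close> only grows, because
    \<open>2 * F < e * Y\<close>.\<close>
  moreover have "m \<le> e * (L2_nrm z)\<^sup>2 - 2 * F * L2_nrm z"
  proof -
    have Yz: "Y \<le> L2_nrm z" unfolding Y_def using L2_trunc(2)[OF z(1), of T] z(2) by simp
    have "m \<le> L2_nrm z * (e * L2_nrm z - 2 * F)"
      unfolding m_def using Yz Y0 e \<open>2 * F < e * Y\<close> by (intro mult_mono) auto
    then show ?thesis by (simp add: power2_eq_square algebra_simps)
  qed
  moreover have "\<delta> * Cd < m"
    using m Cd0 by (simp add: \<delta>_def field_simps)
  ultimately show False by linarith
qed

section \<open>From the truncated estimate to the theorem on the Lurye system\<close>

lemma L2e_lincomb:
  assumes "x \<in> L2e" "y \<in> L2e" shows "(\<lambda>t. a * x t + b * y t) \<in> L2e"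
proof -
  note [measurable] = assms[THEN L2e_measurable]
  have "trunc T (\<lambda>t. a * x t + b * y t) = (\<lambda>t. a * trunc T x t + b * trunc T y t)" for T
    by (auto simp: trunc_def)
  moreover have "(\<lambda>t. a * trunc T x t + b * trunc T y t) \<in> L2" for T
    using assms by (intro L2_add L2_cmult) (auto simp: L2e_def)
  ultimately show ?thesis unfolding L2e_def by simp
qed

text \<open>Test \<open>\<phi>\<close> on a signal equal to \<open>x\<close> on the unit interval.
  Its output there has to satisfy both pairs of bounds on a set of positive measure, which forces
  the order.\<close>

lemma nonlinearity_bounds_compatible:
  assumes "nonlinearity_between \<phi> l1 u1" "nonlinearity_between \<phi> l2 u2" "x \<noteq> 0"
  shows "l1 x / x \<le> u2 x / x"
proof (rule ccontr)
  define u :: signal where "u = (\<lambda>t. indicator {0..1} t * x)"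
  have "u \<in> L2"
    by (rule L2_bounded_interval[where M = "\<bar>x\<bar>" and R = 1]) (auto simp: u_def indicator_def)
  then have u: "u \<in> L2e" by (rule L2_imp_L2e)
  assume neg: "\<not> ?thesis"
  have "AE t in lborel. t \<notin> {0..1::real}"
    using assms(1,2)[unfolded nonlinearity_between_def, rule_format, OF u]
  proof eventually_elim
    case (elim t)
    show ?case
    proof
      assume "t \<in> {0..1}"
      then have "u t = x" by (simp add: u_def)
      then show False using elim assms(3) neg by auto
    qed
  qed
  then have "emeasure lborel {0..1::real} = 0"
    by (subst (asm) AE_iff_measurable[where N = "{0..1}"]) auto
  then show False by simp
qed

theorem theorem2:
  fixes G \<phi> :: "signal \<Rightarrow> signal"
    and \<alpha>l \<alpha>u \<beta>l \<beta>u :: "real \<Rightarrow> real"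
    and s k A :: real and B :: ereal
    and hp hm :: gen_fun
  assumes G: "L2e_operator G" "linear_op G" "time_invariant G" "causal G" "stable_op G"
    and \<phi>: "L2e_operator \<phi>"
    and well_posed: "lurye_well_posed G \<phi>"
    and \<phi>_zero: "\<forall>u\<in>L2e. AE t in lborel. u t = 0 \<longrightarrow> \<phi> u t = 0"
    and \<phi>_\<alpha>: "nonlinearity_between \<phi> \<alpha>l \<alpha>u"
    and \<alpha>_mono: "mono \<alpha>l" "mono \<alpha>u"
    and \<alpha>_bounded: "lin_bounded \<alpha>l" "lin_bounded \<alpha>u"
    and \<alpha>_nonneg: "\<forall>x. x \<noteq> 0 \<longrightarrow> \<alpha>l x / x \<ge> 0"
    and \<phi>_\<beta>: "nonlinearity_between \<phi> \<beta>l \<beta>u"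
    and \<beta>_mono: "mono \<beta>l" "mono \<beta>u"
    and \<beta>_bounded: "lin_bounded \<beta>l" "lin_bounded \<beta>u"
    and \<beta>_odd: "odd_fun \<beta>l" "odd_fun \<beta>u"
    and \<beta>_nonneg: "\<forall>x. x \<noteq> 0 \<longrightarrow> \<beta>l x / x \<ge> 0"
    and slope: "slope_restricted \<alpha>l s" "slope_restricted \<alpha>u s"
               "slope_restricted \<beta>l s" "slope_restricted \<beta>u s"
    and k: "k > s"
    and A: "A \<ge> 1" "bounded_above_by (loop_shift k \<alpha>u) (\<lambda>x. A * loop_shift k \<alpha>l x)"
    and B: "B \<ge> ereal A"
           "B \<noteq> \<infinity> \<longrightarrow>
              bounded_above_by (loop_shift k \<beta>u) (\<lambda>x. real_of_ereal B * loop_shift k \<beta>l x)"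
    and h: "hp \<in> Hp_class" "hm \<in> Hp_class"
    and h_norm: "ereal A * ereal (H_nrm hp) + B * ereal (H_nrm hm) < 1"
  shows "(\<forall>u\<in>L2.
            integrable lborel (\<lambda>t. mult_op hp hm (\<lambda>\<tau>. u \<tau> - \<phi> u \<tau> / k) t * \<phi> u t) \<and>
            (LINT t|lborel. mult_op hp hm (\<lambda>\<tau>. u \<tau> - \<phi> u \<tau> / k) t * \<phi> u t) \<ge> 0)
       \<and> (\<forall>Gf. frequency_response G Gf \<longrightarrow>
            (\<exists>\<epsilon>>0. \<forall>\<omega>. Re (mult_freq hp hm \<omega> * (1 + of_real k * Gf \<omega>)) \<ge> \<epsilon>) \<longrightarrow>
            lurye_stable G \<phi>)"
proof -
  \<comment> \<open>For infinite \<open>B\<close> this is 0 by convention. In that case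
    \<open>h_norm\<close> forces \<open>H_nrm hm = 0\<close>, in accordance with reading the product
    as 0.\<close>
  define b where "b = real_of_ereal B"
  define p where "p = loop_shift k \<alpha>l"
  define q where "q = loop_shift k \<beta>l"
  define c where "c = s / (1 - s / k)"
  have zero: "f 0 = 0" if lb: "lin_bounded f" for f
  proof -
    obtain C where "\<And>x. \<bar>f x\<bar> \<le> C * \<bar>x\<bar>" using lb by (auto simp: lin_bounded_def)
    from this[of 0] show ?thesis by simp
  qed
  note f0 = \<alpha>_bounded[THEN zero] \<beta>_bounded[THEN zero]
  note \<alpha>l = slope(1) k f0(1) and \<alpha>u = slope(2) k f0(2) and \<beta>l = slope(3) k f0(3) and \<beta>u = slope(4) k f0(4)
  have k0: "0 < k" and s0: "0 \<le> s" using k_pos[OF \<alpha>l] slope_nonneg[OF \<alpha>l] .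
  have hH: "hp \<in> H_class" "hm \<in> H_class" using h by (simp_all add: Hp_imp_H)
  note H0 = H_nrm_nonneg[OF hH(1)] H_nrm_nonneg[OF hH(2)]
  have Bfin: "B \<noteq> \<infinity> \<and> A \<le> b" if "H_nrm hm \<noteq> 0"
  proof -
    have "H_nrm hm > 0" using H0 that by simp
    then show ?thesis
      using h_norm B(1) by (cases B) (auto simp: b_def)
  qed
  have nrm: "A * H_nrm hp + b * H_nrm hm < 1"
  proof (cases "H_nrm hm = 0")
    case True
    then show ?thesis using h_norm by (simp add: zero_ereal_def[symmetric])
  next
    case False
    with Bfin have "B = ereal b" using B(1) by (cases B) (auto simp: b_def)
    then show ?thesis using h_norm by simp
  qed
  have small: "H_nrm hp + H_nrm hm < 1"
  proof -
    have "H_nrm hp \<le> A * H_nrm hp" using A(1) H0(1) by (simp add: mult_le_cancel_right1)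
    moreover have "H_nrm hm \<le> b * H_nrm hm"
      using Bfin A(1) H0(2) by (cases "H_nrm hm = 0") (auto simp: mult_le_cancel_right1)
    ultimately show ?thesis using nrm by linarith
  qed
  note p = mono_loop_shift[OF \<alpha>l, folded p_def] continuous_loop_shift[OF \<alpha>l, folded p_def] loop_shift_0[OF \<alpha>l, folded p_def]
  note q = mono_loop_shift[OF \<beta>l, folded q_def] continuous_loop_shift[OF \<beta>l, folded q_def] loop_shift_0[OF \<beta>l, folded q_def]
  \<comment> \<open>The second sector is imposed only for \<open>H_nrm hm \<noteq> 0\<close>, where
    \<open>B\<close> is known to be finite and \<open>b\<close> is its true value.\<close>
  define R where "R = (\<lambda>w y. sector p A w y \<and> (H_nrm hm \<noteq> 0 \<longrightarrow> sector q b w y))"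
  have pos: "0 \<le> L2_ip (mult_op hp hm w) y" if "w \<in> L2" "y \<in> L2" "AE t in lborel. R (w t) (y t)" for w y
  proof (rule multiplier_positive[OF p q _ h that(1,2)])
    show "odd_fun q" unfolding q_def by (rule odd_loop_shift[OF \<beta>l \<beta>_odd(1)])
    show "0 \<le> A" using A(1) by simp
    show "AE t in lborel. sector p A (w t) (y t)" using that(3) by eventually_elim (simp add: R_def)
    show "0 \<le> b" if "H_nrm hm \<noteq> 0" using Bfin[OF that] A(1) by simp
    show "AE t in lborel. sector q b (w t) (y t)" if "H_nrm hm \<noteq> 0"
      using \<open>AE t in lborel. R (w t) (y t)\<close> by eventually_elim (use that in \<open>simp add: R_def\<close>)
    show "A * H_nrm hp + b * H_nrm hm \<le> 1" using nrm by simp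
  qed
  have \<beta>_above: "bounded_above_by (loop_shift k \<beta>u) (\<lambda>x. b * loop_shift k \<beta>l x)" if "H_nrm hm \<noteq> 0"
    using B(2) Bfin[OF that] by (simp add: b_def)
  have R\<phi>: "AE t in lborel. R (u t - \<phi> u t / k) (\<phi> u t)" if u: "u \<in> L2e" for u
    using \<phi>_zero[rule_format, OF u] \<phi>_\<alpha>[unfolded nonlinearity_between_def, rule_format, OF u]
      \<phi>_\<beta>[unfolded nonlinearity_between_def, rule_format, OF u]
  proof eventually_elim
    case (elim t)
    show ?case
    proof (cases "u t = 0")
      case True
      then show ?thesis using elim(1) by (simp add: R_def sector_def)
    next
      case False
      then show ?thesis
        using elim(2,3) loop_shift_sector[OF slope(1) f0(1) slope(2) f0(2) k A(2), of "u t" "\<phi> u t"]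
          loop_shift_sector[OF slope(3) f0(3) slope(4) f0(4) k \<beta>_above, of "u t" "\<phi> u t"]
        by (simp add: R_def p_def q_def)
    qed
  qed
  have \<phi>_L2: "\<phi> u \<in> L2" if u: "u \<in> L2" for u
  proof -
    have ue: "u \<in> L2e" using u by (rule L2_imp_L2e)
    \<comment> \<open>Nonnegativity of \<open>\<alpha>l x / x\<close> and the slope bound of
      \<open>\<alpha>u\<close> confine the gain of \<open>\<phi>\<close> to the interval from 0 to
      \<open>s\<close>.\<close>
    have "AE t in lborel. \<bar>\<phi> u t\<bar> \<le> \<bar>s * u t\<bar>"
      using \<phi>_zero[rule_format, OF ue] \<phi>_\<alpha>[unfolded nonlinearity_between_def, rule_format, OF ue]
    proof eventually_elim
      case (elim t)
      show ?case
      proof (cases "u t = 0")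
        case False
        have "\<alpha>u (u t) / u t \<le> s"
          using slope(2)[unfolded slope_restricted_def, rule_format, of "u t" 0] False f0(2) by simp
        then have "0 \<le> \<phi> u t / u t" "\<phi> u t / u t \<le> s"
          using elim(2) False \<alpha>_nonneg by (auto intro: order_trans)
        then have "\<bar>\<phi> u t / u t\<bar> \<le> s" by simp
        then show ?thesis using False s0 by (simp add: abs_mult abs_divide pos_divide_le_eq)
      qed (use elim(1) in simp)
    qed
    moreover have "\<phi> u \<in> L2e" using \<phi> ue by (simp add: L2e_operator_def)
    ultimately show ?thesis
      by (intro L2_dominated(1)[OF L2_cmult[OF u, of s]] L2e_measurable)
  qed
  have positivity: "integrable lborel (\<lambda>t. mult_op hp hm (\<lambda>\<tau>. u \<tau> - \<phi> u \<tau> / k) t * \<phi> u t) \<and>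
      (LINT t|lborel. mult_op hp hm (\<lambda>\<tau>. u \<tau> - \<phi> u \<tau> / k) t * \<phi> u t) \<ge> 0" if u: "u \<in> L2" for u
  proof
    have w: "(\<lambda>\<tau>. u \<tau> - \<phi> u \<tau> / k) \<in> L2" by (intro L2_diff L2_divide u \<phi>_L2)
    show "integrable lborel (\<lambda>t. mult_op hp hm (\<lambda>\<tau>. u \<tau> - \<phi> u \<tau> / k) t * \<phi> u t)"
      by (rule L2_mult_integrable[OF L2_bounded_linearD(1)[OF mult_op_blin[OF hH] w] \<phi>_L2[OF u]])
    show "(LINT t|lborel. mult_op hp hm (\<lambda>\<tau>. u \<tau> - \<phi> u \<tau> / k) t * \<phi> u t) \<ge> 0"
      using pos[OF w \<phi>_L2[OF u] R\<phi>[OF L2_imp_L2e[OF u]]] by (simp add: L2_ip_def)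
  qed
  \<comment> \<open>Of the two lower bounds \<open>p\<close> and \<open>q\<close>, the one with the
    larger product with \<open>v\<close>, so that both lower bounds hold;
    \<open>loop_shift_cross\<close> keeps it below both upper bounds. Without the second sector it
    is just \<open>p\<close>.\<close>
  define \<psi> where "\<psi> = (\<lambda>v. if H_nrm hm \<noteq> 0 \<and> v * p v \<le> v * q v then q v else p v)"
  have \<psi>R: "R v (\<psi> v)" for v
  proof -
    have 0: "0 \<le> v * p v" "0 \<le> v * q v" using mono_mult_nonneg[OF p(1,3)] mono_mult_nonneg[OF q(1,3)] .
    have 1: "v * p v \<le> A * (v * p v)" using A(1) 0(1) by (simp add: mult_le_cancel_right1)
    have 2: "v * q v \<le> A * (v * p v)"
      unfolding p_def q_def
      by (rule loop_shift_cross[OF slope(3) f0(3) slope(1) f0(1) slope(2) f0(2) k A(2)])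
        (rule nonlinearity_bounds_compatible[OF \<phi>_\<beta> \<phi>_\<alpha>])
    have 3: "v * q v \<le> b * (v * q v)" "v * p v \<le> b * (v * q v)" if "H_nrm hm \<noteq> 0"
    proof -
      show "v * q v \<le> b * (v * q v)" using Bfin[OF that] A(1) 0(2) by (simp add: mult_le_cancel_right1)
      show "v * p v \<le> b * (v * q v)"
        unfolding p_def q_def
        by (rule loop_shift_cross[OF slope(1) f0(1) slope(3) f0(3) slope(4) f0(4) k \<beta>_above[OF that]])
          (rule nonlinearity_bounds_compatible[OF \<phi>_\<alpha> \<phi>_\<beta>])
    qed
    show ?thesis
      using 1 2 3 p(3) q(3) unfolding R_def sector_def \<psi>_def by auto
  qed
  have \<psi>_measurable: "\<psi> \<in> borel_measurable borel"
  proof -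
    note [measurable] = borel_measurable_continuous_onI[OF p(2)] borel_measurable_continuous_onI[OF q(2)]
    show ?thesis unfolding \<psi>_def by measurable
  qed
  have \<psi>_bound: "\<bar>\<psi> v\<bar> \<le> c * \<bar>v\<bar>" for v
    using loop_shift_linear_bound[OF \<alpha>l, of v] loop_shift_linear_bound[OF \<beta>l, of v]
    by (simp add: \<psi>_def p_def q_def c_def)
  obtain C where C: "\<And>u. u \<in> L2 \<Longrightarrow> G u \<in> L2" "\<And>u. u \<in> L2 \<Longrightarrow> L2_nrm (G u) \<le> C * L2_nrm u"
    using G(5) unfolding stable_op_def by blast
  have G_diff: "G (\<lambda>t. u t - v t) =ae (\<lambda>t. G u t - G v t)" if "u \<in> L2e" "v \<in> L2e" for u v
    using G(2)[unfolded linear_op_def, rule_format, OF that, of 1 "-1"] by simp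
  have G_blin: "L2_bounded_linear G C"
    unfolding L2_bounded_linear_def using C G_diff by (simp add: L2_imp_L2e)
  have G_cong: "G u =ae G v" if "u \<in> L2e" "v \<in> L2e" "u =ae v" for u v
    using G(1) that unfolding L2e_operator_def by blast
  have stable: "lurye_stable G \<phi>"
    if resp: "frequency_response G Gf" and \<epsilon>: "0 < \<epsilon>"
      and re: "\<And>\<omega>. Re (mult_freq hp hm \<omega> * (1 + of_real k * Gf \<omega>)) \<ge> \<epsilon>" for Gf \<epsilon>
    unfolding lurye_stable_def
  proof (intro ballI allI impI)
    fix r1 r2 u1 u2 y1 y2
    assume r1: "r1 \<in> L2" and r2: "r2 \<in> L2" and sol: "lurye_solution G \<phi> r1 r2 u1 u2 y1 y2"
    then have L: "u1 \<in> L2e" "u2 \<in> L2e" "y1 \<in> L2e" "y2 \<in> L2e"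
      and y1: "y1 =ae G u1" and y2: "y2 =ae \<phi> u2" and u1: "u1 =ae (\<lambda>t. r1 t - y2 t)" and u2: "u2 =ae (\<lambda>t. y1 t + r2 t)"
      by (auto simp: lurye_solution_def)
    note [measurable] = L[THEN L2e_measurable]
    define f where "f = (\<lambda>t. G r1 t + r2 t)"
    define w where "w = (\<lambda>t. u2 t - y2 t / k)"
    have f: "f \<in> L2" unfolding f_def by (intro L2_add C r1 r2)
    have w: "w \<in> L2e"
      using L2e_lincomb[OF L(2,4), of 1 "- inverse k"] by (simp add: w_def divide_inverse_commute)
    have r1e: "r1 \<in> L2e" using r1 by (rule L2_imp_L2e)
    have r1y: "(\<lambda>t. r1 t - y2 t) \<in> L2e" using L2e_lincomb[OF r1e L(4), of 1 "-1"] by simp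
    \<comment> \<open>Eliminating \<open>u1\<close> and \<open>y1\<close> gives
      \<open>u2 = G r1 - G y2 + r2\<close>; subtracting \<open>y2 / k\<close> leaves
      \<open>f\<close> minus the shifted plant applied to \<open>y2\<close>.\<close>
    have w_eq: "w =ae (\<lambda>t. f t - (y2 t + k * G y2 t) / k)"
      using u2 y1 G_cong[OF L(1) r1y u1] G_diff[OF r1e L(4)]
    proof eventually_elim
      case (elim t)
      then show ?case using k0 by (simp add: w_def f_def add_divide_distrib)
    qed
    have Rw: "AE t in lborel. R (w t) (y2 t)"
      using R\<phi>[OF L(2)] y2 by eventually_elim (simp add: w_def)
    \<comment> \<open>Causality compares each output with that of the truncated input, and the two
      truncated inputs coincide.\<close>
    have causal_eq: "AE t in lborel. t \<le> T \<longrightarrow> G z t = G y2 t" if z: "z \<in> L2" "trunc T z = trunc T y2" for z T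
    proof -
      have "trunc T (G z) =ae trunc T (G (trunc T z))" "trunc T (G y2) =ae trunc T (G (trunc T y2))"
        using G(4) L2_imp_L2e[OF z(1)] L(4) by (auto simp: causal_def)
      then show ?thesis
        unfolding z(2) by eventually_elim (auto simp: trunc_def)
    qed
    \<comment> \<open>The right-hand side is free of \<open>T\<close>, so \<open>y2\<close> lies in
      \<open>L2\<close>; the other signals then follow around the loop by stability of
      \<open>G\<close>.\<close>
    have "L2_nrm (trunc T y2) \<le> 2 * L2_nrm f * k / \<epsilon>" for T
      by (rule truncated_bound[OF hH small G_blin causal_eq frequency_coercive[OF hH G_blin resp re] pos
            \<psi>R \<psi>_measurable \<psi>_bound k0 \<epsilon> f L(4) w w_eq Rw])
    then have y2L: "y2 \<in> L2" by (rule L2_of_bounded_truncations[OF L(4)])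
    have u1L: "u1 \<in> L2"
      by (rule L2_cong_AE[OF L2_diff[OF r1 y2L]]) (use u1 in auto)
    have y1L: "y1 \<in> L2"
      by (rule L2_cong_AE[OF C(1)[OF u1L]]) (use y1 in auto)
    have u2L: "u2 \<in> L2"
      by (rule L2_cong_AE[OF L2_add[OF y1L r2]]) (use u2 in auto)
    show "u1 \<in> L2 \<and> u2 \<in> L2 \<and> y1 \<in> L2 \<and> y2 \<in> L2"
      using u1L u2L y1L y2L by blast
  qed
  show ?thesis using positivity stable by blast
qed

end
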